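(* Consider the class of memoryless, acknowledgment-based Contention Resolution protocols in the LocalClock model. 1. There exists a protocol $\mathcal D$ in this class with $L^{\mathrm{whp}}_{\mathcal D}(n)=O(n\log^2 n/\log\log n)$, even against an adaptive adversary. 2. There exists a protocol $\mathcal D$ in this class with $L^{\exp}_{\mathcal D}(n)=O(n\log n/\log\log n)$, even against an adaptive adversary. 3. No protocol $\mathcal D$ in this class has $L^{\mathrm{whp}}_{\mathcal D}(n)=o(n\log^2 n/\log\log n)$, even against an oblivious adversary. 4. No protocol $\mathcal D$ in this class has $L^{\exp}_{\mathcal D}(n)=o(n\log n/\log\log n)$, even against an oblivious adversary.
   Context: Contention Resolution. Time is divided into slots indexed by $\mathbb N$. There are $n$ identical parties; $n$ is unknown to the protocol, so one fixed protocol is used for all $n$. An adversary wakes up the $n$ parties; $t_u$ is the wake-up time of party $u$. An acknowledgment-based LocalClock protocol is a distribution $\mathcal D$ over infinite binary sequences: each party $u$ independently draws $X^{(u)}=(X^{(u)}_1,X^{(u)}_2,\dots)\sim\mathcal D$ and attempts to grab the shared resource in slot $t_u+i$ (local time $i\ge1$) iff $X^{(u)}_i=1$ and $u$ has not succeeded in an earlier slot. A party succeeds in a slot iff it is the only party attempting to grab in that slot. Parties receive no other feedback. The protocol is memoryless if the bits $X^{(u)}_1,X^{(u)}_2,\dots$ are mutually independent, so that $\mathcal D$ is determined by $p(i)=\Pr[X^{(u)}_i=1]$. An oblivious adversary fixes all wake-up times in advance; an adaptive adversary decides in each slot how many parties to wake up based on the state and history of all parties; in total $n$ parties are woken up. The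 latency of $u$ is $L^{(u)}_{\mathcal D,\mathcal A[n]}=t_u^{\mathrm{succ}}-t_u$, where $t_u^{\mathrm{succ}}$ is the slot in which $u$ succeeds ($\infty$ if never). With $\mathcal A[n]$ ranging over adversaries of the considered type that wake up $n$ parties: $L^{\exp}_{\mathcal D}(n)=\sup_{\mathcal A[n]}\max_{u}\mathbb E[L^{(u)}_{\mathcal D,\mathcal A[n]}]$; $L_{\mathcal D}(n,q)$ is the least $L\in\mathbb N\cup\{\infty\}$ such that $\Pr[L^{(u)}_{\mathcal D,\mathcal A[n]}\le L]\ge 1-q$ for all $\mathcal A[n]$ and all $u$; and $L^{\mathrm{whp}}_{\mathcal D}(n)=L_{\mathcal D}(n,n^{-2})$. *)

theory Defs
  imports "HOL-Probability.Probability" "HOL-Library.Landau_Symbols"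
begin

(* Local times start at 1, so the bit sequences are indexed by {1..}. *)
definition memoryless_protocol :: "(nat \<Rightarrow> bool) measure \<Rightarrow> bool" where
  "memoryless_protocol D \<longleftrightarrow>
     prob_space D \<and>
     sets D = sets (Pi\<^sub>M {1..} (\<lambda>_. count_space UNIV)) \<and>
     prob_space.indep_vars D (\<lambda>_. count_space UNIV) (\<lambda>i x. x i) {1..}"

(* Joint law of the bits: X u i is the i-th bit of party u, and the parties are the numbers below n. *)
definition bits :: "(nat \<Rightarrow> bool) measure \<Rightarrow> nat \<Rightarrow> (nat \<Rightarrow> nat \<Rightarrow> bool) measure" where
  "bits D n = Pi\<^sub>M {..<n} (\<lambda>_. D)"

(* A history h lists, for the slots 0, ..., length h - 1, the set of parties that attempted to
   grab. In slot t the adversary A wakes up the parties in A h, where h is the history of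
   the slots 0, ..., t (so length h = t + 1). A party woken up in slot t first attempts in slot t + 1. *)
type_synonym history = "nat set list"
type_synonym adversary = "history \<Rightarrow> nat set"

(* The parties attempting in slot (length h), where h is the history of all earlier slots.
   A party u has succeeded in an earlier slot iff {u} occurs in h. All adversaries below wake
   up a party at most once, so s is the wake-up time of u. *)
definition attempters :: "adversary \<Rightarrow> (nat \<Rightarrow> nat \<Rightarrow> bool) \<Rightarrow> history \<Rightarrow> nat set" where
  "attempters A X h =
     {u. (\<exists>s<length h. u \<in> A (take (Suc s) h) \<and> X u (length h - s)) \<and> {u} \<notin> set h}"

primrec run :: "adversary \<Rightarrow> (nat \<Rightarrow> nat \<Rightarrow> bool) \<Rightarrow> nat \<Rightarrow> history" where
  "run A X 0 = []"
| "run A X (Suc t) = run A X t @ [attempters A X (run A X t)]"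

definition wake_time :: "adversary \<Rightarrow> (nat \<Rightarrow> nat \<Rightarrow> bool) \<Rightarrow> nat \<Rightarrow> nat" where
  "wake_time A X u = (LEAST t. u \<in> A (run A X (Suc t)))"

(* The infimum of the empty set is infinity. *)
definition success_time :: "adversary \<Rightarrow> (nat \<Rightarrow> nat \<Rightarrow> bool) \<Rightarrow> nat \<Rightarrow> enat" where
  "success_time A X u = (INF t\<in>{t. attempters A X (run A X t) = {u}}. enat t)"

definition latency :: "adversary \<Rightarrow> (nat \<Rightarrow> nat \<Rightarrow> bool) \<Rightarrow> nat \<Rightarrow> enat" where
  "latency A X u = success_time A X u - enat (wake_time A X u)"

(* t u is the wake-up time of party u. *)
definition oblivious_adversaries :: "nat \<Rightarrow> adversary set" where
  "oblivious_adversaries n = range (\<lambda>t h. {u. u < n \<and> length h = Suc (t u)})"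

(* c h is the number of parties to be woken up; as the parties are identical, they are
   numbered in the order of their wake-up. *)
definition wake_next :: "(history \<Rightarrow> nat) \<Rightarrow> adversary" where
  "wake_next c h =
     {(\<Sum>s<length h - 1. c (take (Suc s) h)) ..< (\<Sum>s<length h. c (take (Suc s) h))}"

(* The union is the set of all parties that are ever woken up, which is required to consist
   of exactly n parties, with probability 1. *)
definition adaptive_adversaries :: "(nat \<Rightarrow> bool) measure \<Rightarrow> nat \<Rightarrow> adversary set" where
  "adaptive_adversaries D n =
     {A \<in> range wake_next. AE X in bits D n. (\<Union>t. A (run A X (Suc t))) = {..<n}}"

definition latency_exp :: "(nat \<Rightarrow> bool) measure \<Rightarrow> adversary set \<Rightarrow> nat \<Rightarrow> ennreal" where
  "latency_exp D Adv n =
     (SUP A\<in>Adv. SUP u\<in>{..<n}. \<integral>\<^sup>+ X. ennreal_of_enat (latency A X u) \<partial>bits D n)"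

definition latency_quantile :: "(nat \<Rightarrow> bool) measure \<Rightarrow> adversary set \<Rightarrow> nat \<Rightarrow> real \<Rightarrow> enat" where
  "latency_quantile D Adv n q =
     (LEAST L. \<forall>A\<in>Adv. \<forall>u<n. measure (bits D n) {X \<in> space (bits D n). latency A X u \<le> L} \<ge> 1 - q)"

definition latency_whp :: "(nat \<Rightarrow> bool) measure \<Rightarrow> adversary set \<Rightarrow> nat \<Rightarrow> enat" where
  "latency_whp D Adv n = latency_quantile D Adv n (1 / real n ^ 2)"

(* Landau symbols for functions that may take the value infinity; note enn2real top = 0. *)
definition ext_bigo :: "(nat \<Rightarrow> ennreal) \<Rightarrow> (nat \<Rightarrow> real) \<Rightarrow> bool" where
  "ext_bigo f g \<longleftrightarrow> (\<forall>\<^sub>F n in sequentially. f n < top) \<and> (\<lambda>n. enn2real (f n)) \<in> O(g)"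

definition ext_smallo :: "(nat \<Rightarrow> ennreal) \<Rightarrow> (nat \<Rightarrow> real) \<Rightarrow> bool" where
  "ext_smallo f g \<longleftrightarrow> (\<forall>\<^sub>F n in sequentially. f n < top) \<and> (\<lambda>n. enn2real (f n)) \<in> o(g)"

end

(* Upper bounds: take p(i) of order 1/i (for the expectation) or log i / i (for high probability).
   In a window of T slots after the wake-up of u, call a slot high if its contention (expected
   number of attempts) is at least c log log n, low if it is below 1, and mid otherwise.  Since
   the total contention of a window is at most n (p(1) + ... + p(T)), few slots are high; since
   every mid slot is a success with probability at least 1/polylog(n) and only n successes are
   possible, few slots are mid.  So most slots are low, and in a low slot of age i party u
   succeeds with probability at least a constant times p(i).

   Lower bounds: an oblivious adversary that wakes parties at rate rho / S(M), with
   S(M) = p(1) + ... + p(M), keeps the contention at least rho in every slot, so a party hardly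
   ever succeeds within W slots although only about rho W / S(M) parties are used.  To prevent a
   cascade of successes from destroying the contention, only attempts with p(i) <= tau =
   1/polylog are counted: then the contention lost through successes is a sum of small increments and an
   exponential moment bound beats the union bound over all slots.  Attempts with p(i) > tau are few,
   and are blocked by groups of parties that all make their very first attempts in that slot.
   If the latency were o(n log^a n / log log n), the party would have to succeed soon after age W,
   which forces the mass S to grow by a fixed amount between W and q W for a small factor q.
   Iterating, S(M^2) >= 4096 S(M), so S(M) grows faster than (log M)^4, which the same adversary
   excludes. *)
theory Submission
  imports Defs "HOL-Real_Asymp.Real_Asymp"
begin

subsection \<open>Histories and their probabilities\<close>

text \<open>Both halves work with a finite distribution on histories, built slot by slot from
  products of attempt probabilities. Adaptive wake-ups and earlier successes leave no independence
  between slots, so every concentration bound comes from an exponential potential whose one-step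
  conditional mean is controlled. The factor \<open>ln (ln n)\<close> has the same source in both
  halves: the chance that a slot of contention \<open>b\<close> is a success is exponentially small
  in \<open>b\<close>, so contention of order \<open>ln (ln n)\<close> makes successes rarer than a
  given power of \<open>ln n\<close>. For the adversary this is enough only if the total mass is
  polylogarithmic. Hence the lower bound runs twice: first with contention of order
  \<open>ln M\<close>, which yields a crude bound on the mass, and then with contention of order
  \<open>ln (ln M)\<close>. The growth of the mass feeds on itself: the more mass there is, the
  fewer parties block a window, the shorter the assumed latency, and the more often mass must be
  gained. Small \<open>\<epsilon>\<close> turns this into any desired constant factor. The exponent
  \<open>a\<close> (1 for expectation, 2 for high probability) cancels, so one argument serves both
  lower bounds.\<close>

definition woken_once :: "nat \<Rightarrow> adversary \<Rightarrow> bool" where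
  "woken_once n A \<longleftrightarrow> (\<forall>h. A h \<subseteq> {..<n}) \<and>
     (\<forall>h s s'. s < s' \<longrightarrow> s' < length h \<longrightarrow> A (take (Suc s) h) \<inter> A (take (Suc s') h) = {})"

(* The product probabilities below describe the random history only because every party consults
   each of its independent bits at most once. *)
locale contention =
  fixes p :: "nat \<Rightarrow> real" and n :: nat and A :: adversary
  assumes p_nonneg: "0 \<le> p i" and p_le_1: "p i \<le> 1"
    and once: "woken_once n A"
begin

text \<open>Conditional probability, given \<open>h\<close>, of an attempt in slot
  \<open>length h\<close>. The wake-up slot can be read off from \<open>h\<close> because the
  adversary is a function of histories, and by \<open>once\<close> at most one term of the sum is
  nonzero.\<close>

definition attempt_prob :: "history \<Rightarrow> nat \<Rightarrow> real" where
  "attempt_prob h v = (if {v} \<in> set h then 0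
     else \<Sum>s<length h. if v \<in> A (take (Suc s) h) then p (length h - s) else 0)"

definition step_prob :: "history \<Rightarrow> nat set \<Rightarrow> real" where
  "step_prob h S = (\<Prod>v<n. if v \<in> S then attempt_prob h v else 1 - attempt_prob h v)"

definition hist_prob :: "history \<Rightarrow> real" where
  "hist_prob h = (\<Prod>t<length h. step_prob (take t h) (h ! t))"

definition histories :: "nat \<Rightarrow> history set" where
  "histories t = {h. set h \<subseteq> Pow {..<n} \<and> length h = t}"

text \<open>A finite sum over all conceivable histories, so no measurability or integrability
  conditions arise; \<open>prob_run\<close> identifies it with probabilities over the bits.\<close>

definition mean :: "nat \<Rightarrow> (history \<Rightarrow> real) \<Rightarrow> real" where
  "mean t F = (\<Sum>h\<in>histories t. hist_prob h * F h)"

definition next_mean :: "(history \<Rightarrow> real) \<Rightarrow> history \<Rightarrow> real" where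
  "next_mean F h = (\<Sum>S\<in>Pow {..<n}. step_prob h S * F (h @ [S]))"

definition contention :: "history \<Rightarrow> real" where
  "contention h = (\<Sum>v<n. attempt_prob h v)"

lemma A_subset: "A h \<subseteq> {..<n}"
  using once by (auto simp: woken_once_def)

lemma wake_unique:
  assumes "s < length h" "s' < length h" "v \<in> A (take (Suc s) h)" "v \<in> A (take (Suc s') h)"
  shows "s = s'"
proof (rule ccontr)
  assume "s \<noteq> s'"
  then consider "s < s'" | "s' < s" by linarith
  then show False
    using once assms unfolding woken_once_def by (metis IntI empty_iff)
qed

lemma attempt_prob_woken:
  assumes "s < length h" "v \<in> A (take (Suc s) h)" "{v} \<notin> set h"
  shows "attempt_prob h v = p (length h - s)"
proof -
  have "(\<Sum>s'<length h. if v \<in> A (take (Suc s') h) then p (length h - s') else 0)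
      = (\<Sum>s'<length h. if s' = s then p (length h - s) else 0)"
  proof (intro sum.cong refl)
    fix s' assume "s' \<in> {..<length h}"
    then have "v \<in> A (take (Suc s') h) \<longleftrightarrow> s' = s"
      using wake_unique[of s' h s v] assms(1,2) by auto
    then show "(if v \<in> A (take (Suc s') h) then p (length h - s') else 0)
        = (if s' = s then p (length h - s) else 0)" by simp
  qed
  then show ?thesis using assms by (simp add: attempt_prob_def)
qed

lemma attempt_prob_not_woken:
  assumes "\<And>s. s < length h \<Longrightarrow> v \<notin> A (take (Suc s) h)"
  shows "attempt_prob h v = 0"
  using assms by (simp add: attempt_prob_def)

lemma attempt_prob_bounds: "0 \<le> attempt_prob h v" "attempt_prob h v \<le> 1"
proof -
  consider "{v} \<in> set h" | s where "s < length h" "v \<in> A (take (Suc s) h)" "{v} \<notin> set h"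
    | "\<And>s. s < length h \<Longrightarrow> v \<notin> A (take (Suc s) h)" by blast
  then have "0 \<le> attempt_prob h v \<and> attempt_prob h v \<le> 1"
  proof cases
    case 1 then show ?thesis by (simp add: attempt_prob_def)
  next
    case (2 s) then show ?thesis using attempt_prob_woken[OF 2] p_nonneg p_le_1 by simp
  next
    case 3 then show ?thesis using attempt_prob_not_woken[OF 3] by simp
  qed
  then show "0 \<le> attempt_prob h v" "attempt_prob h v \<le> 1" by auto
qed

lemma step_prob_nonneg: "0 \<le> step_prob h S"
  unfolding step_prob_def using attempt_prob_bounds by (intro prod_nonneg) auto

lemma hist_prob_nonneg: "0 \<le> hist_prob h"
  unfolding hist_prob_def using step_prob_nonneg by (intro prod_nonneg) auto

text \<open>Expanding the product of \<open>q + (1 - q)\<close> over all parties yields one term per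
  set of attempters.\<close>

lemma sum_step_prob: "(\<Sum>S\<in>Pow {..<n}. step_prob h S) = 1"
proof -
  have "1 = (\<Prod>v<n. attempt_prob h v + (1 - attempt_prob h v))" by simp
  also have "\<dots> = (\<Sum>S\<in>Pow {..<n}. (\<Prod>v\<in>S. attempt_prob h v) * (\<Prod>v\<in>{..<n} - S. 1 - attempt_prob h v))"
    by (rule prod_add) auto
  also have "\<dots> = (\<Sum>S\<in>Pow {..<n}. step_prob h S)"
  proof (intro sum.cong refl)
    fix S assume S: "S \<in> Pow {..<n}"
    have *: "{..<n} = S \<union> ({..<n} - S)" using S by auto
    have "finite S" using S finite_subset by auto
    then have "(\<Prod>v\<in>S \<union> ({..<n} - S). if v \<in> S then attempt_prob h v else 1 - attempt_prob h v)
       = (\<Prod>v\<in>S. attempt_prob h v) * (\<Prod>v\<in>{..<n} - S. 1 - attempt_prob h v)"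
      by (subst prod.union_disjoint) (auto intro!: arg_cong2[where f="(*)"] prod.cong)
    then show "(\<Prod>v\<in>S. attempt_prob h v) * (\<Prod>v\<in>{..<n} - S. 1 - attempt_prob h v) = step_prob h S"
      unfolding step_prob_def using * by metis
  qed
  finally show ?thesis by simp
qed

lemma finite_histories [simp]: "finite (histories t)"
  unfolding histories_def by (rule finite_lists_length_eq) auto

lemma histories_0: "histories 0 = {[]}"
  by (auto simp: histories_def)

lemma length_histories: "h \<in> histories t \<Longrightarrow> length h = t"
  by (simp add: histories_def)

lemma mean_0: "mean 0 F = F []"
  by (simp add: mean_def histories_0 hist_prob_def)

lemma hist_prob_snoc: "hist_prob (h @ [S]) = hist_prob h * step_prob h S"
  by (simp add: hist_prob_def nth_append)

lemma histories_Suc: "histories (Suc t) = (\<lambda>(h, S). h @ [S]) ` (histories t \<times> Pow {..<n})"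
proof (intro equalityI subsetI)
  fix h assume h: "h \<in> histories (Suc t)"
  then have "h \<noteq> []" by (auto simp: histories_def)
  then obtain h' S where "h = h' @ [S]" by (cases h rule: rev_cases) auto
  moreover have "h' \<in> histories t" "S \<in> Pow {..<n}"
    using h calculation by (simp_all add: histories_def)
  ultimately show "h \<in> (\<lambda>(h, S). h @ [S]) ` (histories t \<times> Pow {..<n})"
    by (intro image_eqI[of _ _ "(h', S)"]) simp_all
next
  fix h assume "h \<in> (\<lambda>(h, S). h @ [S]) ` (histories t \<times> Pow {..<n})"
  then obtain h' S where "h = h' @ [S]" "h' \<in> histories t" "S \<in> Pow {..<n}" by force
  then show "h \<in> histories (Suc t)" by (simp add: histories_def)
qed

lemma mean_Suc: "mean (Suc t) F = mean t (next_mean F)"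
proof -
  have inj: "inj_on (\<lambda>(h, S). h @ [S]) (histories t \<times> Pow {..<n})"
    by (auto simp: inj_on_def)
  have "mean (Suc t) F = (\<Sum>(h, S)\<in>histories t \<times> Pow {..<n}. hist_prob h * step_prob h S * F (h @ [S]))"
    unfolding mean_def histories_Suc
    by (subst sum.reindex[OF inj]) (simp add: case_prod_unfold hist_prob_snoc)
  also have "\<dots> = (\<Sum>h\<in>histories t. \<Sum>S\<in>Pow {..<n}. hist_prob h * step_prob h S * F (h @ [S]))"
    by (subst sum.cartesian_product) auto
  finally show ?thesis by (simp add: mean_def next_mean_def sum_distrib_left mult.assoc)
qed

lemma mean_mono:
  assumes "\<And>h. h \<in> histories t \<Longrightarrow> hist_prob h \<noteq> 0 \<Longrightarrow> F h \<le> G h"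
  shows "mean t F \<le> mean t G"
  unfolding mean_def
proof (rule sum_mono)
  fix h assume "h \<in> histories t"
  then show "hist_prob h * F h \<le> hist_prob h * G h"
    using assms[of h] hist_prob_nonneg[of h] by (cases "hist_prob h = 0") (auto intro: mult_left_mono)
qed

lemma mean_cmult: "mean t (\<lambda>h. c * F h) = c * mean t F"
  by (simp add: mean_def sum_distrib_left mult_ac)

lemma mean_add: "mean t (\<lambda>h. F h + G h) = mean t F + mean t G"
  by (simp add: mean_def distrib_left sum.distrib)

lemma mean_diff: "mean t (\<lambda>h. F h - G h) = mean t F - mean t G"
  by (simp add: mean_def right_diff_distrib sum_subtractf)

lemma mean_const: "mean t (\<lambda>h. c) = c"
proof (induction t)
  case (Suc t)
  have "next_mean (\<lambda>h. c) = (\<lambda>h. c)"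
    using sum_step_prob by (auto simp: next_mean_def sum_distrib_right[symmetric])
  then show ?case using Suc by (simp add: mean_Suc)
qed (simp add: mean_0)

text \<open>Iterates the one-step inequality. The upper bounds take \<open>a s = 1\<close>; the
  lower bound lets the potential grow by a controlled factor per slot. Histories of probability zero
  are exempt, so facts that hold only for possible histories may be used.\<close>

lemma mean_supermartingale:
  assumes "\<And>s h. s < t \<Longrightarrow> h \<in> histories s \<Longrightarrow> hist_prob h \<noteq> 0 \<Longrightarrow> next_mean F h \<le> a s * F h"
    and "\<And>s. s < t \<Longrightarrow> 0 \<le> a s"
  shows "mean t F \<le> (\<Prod>s<t. a s) * F []"
  using assms
proof (induction t)
  case (Suc t)
  have "mean (Suc t) F \<le> mean t (\<lambda>h. a t * F h)"
    unfolding mean_Suc using Suc.prems(1)[of t] by (intro mean_mono) auto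
  also have "\<dots> = a t * mean t F" by (rule mean_cmult)
  also have "\<dots> \<le> a t * ((\<Prod>s<t. a s) * F [])"
    using Suc by (intro mult_left_mono) auto
  finally show ?case by (simp add: mult_ac)
qed (simp add: mean_0)

lemma markov_mean:
  assumes "0 < c" "\<And>h. h \<in> histories t \<Longrightarrow> hist_prob h \<noteq> 0 \<Longrightarrow> 0 \<le> F h"
    and "\<And>h. h \<in> histories t \<Longrightarrow> hist_prob h \<noteq> 0 \<Longrightarrow> P h \<Longrightarrow> c \<le> F h"
  shows "mean t (\<lambda>h. of_bool (P h)) \<le> mean t F / c"
proof -
  have "mean t (\<lambda>h. of_bool (P h)) \<le> mean t (\<lambda>h. (1 / c) * F h)"
    using assms by (intro mean_mono) (auto simp: of_bool_def)
  also have "\<dots> = mean t F / c" by (subst mean_cmult) simp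
  finally show ?thesis .
qed

lemma step_prob_nz:
  assumes "hist_prob h \<noteq> 0" "t < length h" shows "step_prob (take t h) (h ! t) \<noteq> 0"
  using assms by (auto simp: hist_prob_def)

lemma step_prob_nz_attempt:
  assumes "step_prob h S \<noteq> 0" "v \<in> S" "v < n" shows "attempt_prob h v \<noteq> 0"
  using assms by (force simp: step_prob_def)

lemma step_prob_single:
  assumes "v < n"
  shows "step_prob h {v} = attempt_prob h v * (\<Prod>w\<in>{..<n} - {v}. 1 - attempt_prob h w)"
  unfolding step_prob_def using assms
  by (subst prod.remove[of _ v]) (auto intro!: arg_cong2[where f="(*)"] prod.cong)

text \<open>Applies \<open>1 - x \<le> exp (- x)\<close> to every party except \<open>v\<close>;
  leaving \<open>v\<close> out of the contention costs at most 1, which is the 1 in the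
  exponent.\<close>

lemma step_prob_single_le:
  assumes "v < n"
  shows "step_prob h {v} \<le> attempt_prob h v * exp (1 - contention h)"
proof -
  have "(\<Prod>w\<in>{..<n} - {v}. 1 - attempt_prob h w) \<le> (\<Prod>w\<in>{..<n} - {v}. exp (- attempt_prob h w))"
    using attempt_prob_bounds exp_ge_add_one_self[of "- attempt_prob h _"]
    by (intro prod_mono) auto
  also have "\<dots> = exp (- (contention h - attempt_prob h v))"
    using assms by (simp add: exp_sum[symmetric] contention_def sum_negf sum_diff1)
  also have "\<dots> \<le> exp (1 - contention h)"
    using attempt_prob_bounds(2)[of h v] by simp
  finally show ?thesis
    using attempt_prob_bounds[of h v] by (simp add: step_prob_single[OF assms] mult_left_mono)
qed

lemma exp_m2_le:
  fixes x :: real assumes "0 \<le> x" "x \<le> 1/2" shows "exp (- 2 * x) \<le> 1 - x"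
proof -
  have "exp (2 * x) \<ge> 1 + 2 * x" by (rule exp_ge_add_one_self)
  have "1 \<le> (1 - x) * (1 + 2 * x)"
    using assms mult_nonneg_nonneg[of x "1 - 2 * x"] by (simp add: algebra_simps power2_eq_square)
  also have "\<dots> \<le> (1 - x) * exp (2 * x)"
    using assms exp_ge_add_one_self[of "2*x"] by (intro mult_left_mono) auto
  finally show ?thesis by (simp add: exp_minus field_simps)
qed

text \<open>The reverse estimate rests on \<open>exp (- 2 * x) \<le> 1 - x\<close>, which is where
  attempt probabilities of at most 1/2 are needed.\<close>

lemma step_prob_single_ge:
  assumes "v < n" "\<And>i. p i \<le> 1/2"
  shows "attempt_prob h v * exp (- 2 * contention h) \<le> step_prob h {v}"
proof -
  have ap: "attempt_prob h w \<le> 1/2" for w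
  proof -
    consider "{w} \<in> set h" | s where "s < length h" "w \<in> A (take (Suc s) h)" "{w} \<notin> set h"
      | "\<And>s. s < length h \<Longrightarrow> w \<notin> A (take (Suc s) h)" by blast
    then show ?thesis
    proof cases
      case 1 then show ?thesis by (simp add: attempt_prob_def)
    next
      case (2 s) then show ?thesis using attempt_prob_woken[OF 2] assms(2) by simp
    next
      case 3 then show ?thesis using attempt_prob_not_woken[OF 3] by simp
    qed
  qed
  have "exp (- 2 * contention h) \<le> exp (- 2 * (contention h - attempt_prob h v))"
    using attempt_prob_bounds[of h v] by simp
  also have "\<dots> = (\<Prod>w\<in>{..<n} - {v}. exp (- 2 * attempt_prob h w))"
    using assms by (simp add: exp_sum[symmetric] contention_def sum_negf sum_diff1 sum_distrib_left)
  also have "\<dots> \<le> (\<Prod>w\<in>{..<n} - {v}. 1 - attempt_prob h w)"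
    using exp_m2_le attempt_prob_bounds ap by (intro prod_mono) auto
  finally show ?thesis
    using attempt_prob_bounds[of h v] by (simp add: step_prob_single[OF assms(1)] mult_left_mono)
qed

text \<open>The potentials below depend on the attempters of the next slot only through a success,
  so all other sets share one bound \<open>f0\<close> and each possible success adds its own
  correction.\<close>

lemma next_mean_le_singles:
  assumes "\<And>S. S \<subseteq> {..<n} \<Longrightarrow> (\<And>v. v < n \<Longrightarrow> S \<noteq> {v}) \<Longrightarrow> step_prob h S \<noteq> 0 \<Longrightarrow> F (h @ [S]) \<le> f0"
    and "\<And>v. v < n \<Longrightarrow> step_prob h {v} \<noteq> 0 \<Longrightarrow> F (h @ [{v}]) \<le> f0 + f v"
  shows "next_mean F h \<le> f0 + (\<Sum>v<n. step_prob h {v} * f v)"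
proof -
  define g where "g S = (if \<exists>v<n. S = {v} then f (the_elem S) else 0)" for S
  have "next_mean F h \<le> (\<Sum>S\<in>Pow {..<n}. step_prob h S * (f0 + g S))"
    unfolding next_mean_def
  proof (rule sum_mono)
    fix S assume S: "S \<in> Pow {..<n}"
    show "step_prob h S * F (h @ [S]) \<le> step_prob h S * (f0 + g S)"
    proof (cases "step_prob h S = 0")
      case False
      then have "F (h @ [S]) \<le> f0 + g S"
        using assms S by (fastforce simp: g_def)
      then show ?thesis using step_prob_nonneg by (rule mult_left_mono)
    qed simp
  qed
  also have "\<dots> = f0 + (\<Sum>S\<in>Pow {..<n}. step_prob h S * g S)"
    by (simp add: distrib_left sum.distrib sum_distrib_right[symmetric] sum_step_prob)
  also have "(\<Sum>S\<in>Pow {..<n}. step_prob h S * g S) = (\<Sum>S\<in>(\<lambda>v. {v}) ` {..<n}. step_prob h S * g S)"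
    by (intro sum.mono_neutral_right) (auto simp: g_def)
  also have "\<dots> = (\<Sum>v<n. step_prob h {v} * f v)"
    by (subst sum.reindex) (auto simp: g_def inj_on_def)
  finally show ?thesis .
qed

end

subsection \<open>Independent bits\<close>

text \<open>Index 0 lies outside the index set of the bits; the value 0 there lets masses be summed
  over \<open>{..<m}\<close>.\<close>

definition bit_prob :: "(nat \<Rightarrow> bool) measure \<Rightarrow> nat \<Rightarrow> real" where
  "bit_prob D i = (if i = 0 then 0 else measure D {x \<in> space D. x i})"

lemma memoryless_measurable:
  assumes "memoryless_protocol D" "1 \<le> i"
  shows "(\<lambda>x. x i) \<in> measurable D (count_space UNIV)"
proof -
  have s: "sets D = sets (Pi\<^sub>M {1..} (\<lambda>_. count_space UNIV))"
    using assms by (simp add: memoryless_protocol_def)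
  have "(\<lambda>x. x i) \<in> measurable (Pi\<^sub>M {1..} (\<lambda>_. count_space UNIV)) (count_space (UNIV :: bool set))"
    using assms by (intro measurable_component_singleton) auto
  then show ?thesis unfolding measurable_cong_sets[OF s refl] .
qed

lemma memoryless_prob_space: "memoryless_protocol D \<Longrightarrow> prob_space D"
  by (simp add: memoryless_protocol_def)

lemma bit_prob_bounds: "memoryless_protocol D \<Longrightarrow> 0 \<le> bit_prob D i \<and> bit_prob D i \<le> 1"
  using prob_space.prob_le_1[OF memoryless_prob_space] by (auto simp: bit_prob_def)

lemma memoryless_cylinder:
  assumes D: "memoryless_protocol D" and J: "finite J" "J \<subseteq> {1..}"
  shows "{x \<in> space D. \<forall>i\<in>J. x i = b i} \<in> sets D"
    and "measure D {x \<in> space D. \<forall>i\<in>J. x i = b i}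
       = (\<Prod>i\<in>J. if b i then bit_prob D i else 1 - bit_prob D i)"
proof -
  interpret prob_space D using D by (rule memoryless_prob_space)
  have m: "(\<lambda>x. x i) \<in> measurable D (count_space UNIV)" if "i \<in> J" for i
    using memoryless_measurable[OF D] J that by auto
  have mi: "{x \<in> space D. x i = c} \<in> sets D" if "i \<in> J" for i c
    using measurable_sets[OF m[OF that], of "{c}"] by (simp add: vimage_def Int_def conj_commute)
  show "{x \<in> space D. \<forall>i\<in>J. x i = b i} \<in> sets D"
    using mi J by (intro sets.sets_Collect_finite_All) auto
  have one: "prob {x \<in> space D. x i = b i} = (if b i then bit_prob D i else 1 - bit_prob D i)"
    if "i \<in> J" for i
  proof (cases "b i")
    case True
    then show ?thesis using that J by (auto simp: bit_prob_def)
  next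
    case False
    have "{x \<in> space D. \<not> x i} = space D - {x \<in> space D. x i}" by auto
    moreover have "{x \<in> space D. x i} \<in> events" using mi[OF that, of True] by simp
    ultimately show ?thesis using that J False by (auto simp: bit_prob_def prob_compl)
  qed
  show "measure D {x \<in> space D. \<forall>i\<in>J. x i = b i}
       = (\<Prod>i\<in>J. if b i then bit_prob D i else 1 - bit_prob D i)"
  proof (cases "J = {}")
    case True
    then show ?thesis by (simp add: prob_space)
  next
    case False
    have "prob (\<Inter>i\<in>J. (\<lambda>x. x i) -` {b i} \<inter> space D) = (\<Prod>i\<in>J. prob ((\<lambda>x. x i) -` {b i} \<inter> space D))"
      using D J False by (intro indep_varsD[where I="{1..}"]) (auto simp: memoryless_protocol_def)
    moreover have "(\<Inter>i\<in>J. (\<lambda>x. x i) -` {b i} \<inter> space D) = {x \<in> space D. \<forall>i\<in>J. x i = b i}"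
      using False by auto
    moreover have "(\<lambda>x. x i) -` {b i} \<inter> space D = {x \<in> space D. x i = b i}" for i by auto
    ultimately show ?thesis using one by simp
  qed
qed

lemma bits_cylinder:
  assumes D: "memoryless_protocol D" and E: "\<And>v. v < n \<Longrightarrow> E v \<in> sets D"
  shows "{X \<in> space (bits D n). \<forall>v<n. X v \<in> E v} \<in> sets (bits D n)"
    and "measure (bits D n) {X \<in> space (bits D n). \<forall>v<n. X v \<in> E v} = (\<Prod>v<n. measure D (E v))"
proof -
  interpret prob_space D using D by (rule memoryless_prob_space)
  interpret finite_product_prob_space "\<lambda>_. D" "{..<n}" by unfold_locales auto
  have "E v \<subseteq> space D" if "v < n" for v using sets.sets_into_space[OF E[OF that]] .
  then have eq: "{X \<in> space (bits D n). \<forall>v<n. X v \<in> E v} = (\<Pi>\<^sub>E v\<in>{..<n}. E v)"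
    unfolding bits_def space_PiM by (intro set_eqI) (simp add: PiE_iff, blast)
  show "{X \<in> space (bits D n). \<forall>v<n. X v \<in> E v} \<in> sets (bits D n)"
    unfolding eq unfolding bits_def using E by (intro sets_PiM_I_finite) auto
  show "measure (bits D n) {X \<in> space (bits D n). \<forall>v<n. X v \<in> E v} = (\<Prod>v<n. measure D (E v))"
    unfolding eq unfolding bits_def using E by (intro prob_times) auto
qed

lemma prob_space_bits: "memoryless_protocol D \<Longrightarrow> prob_space (bits D n)"
  unfolding bits_def by (intro prob_space_PiM memoryless_prob_space)

lemma bit_measurable:
  assumes D: "memoryless_protocol D" and i: "1 \<le> i"
  shows "Measurable.pred (bits D n) (\<lambda>X. X u i)"
proof (cases "u < n")
  case True
  have "(\<lambda>X. X u) \<in> measurable (bits D n) D"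
    unfolding bits_def using True by (intro measurable_component_singleton) auto
  from measurable_compose[OF this memoryless_measurable[OF D i]] show ?thesis by simp
next
  case False
  have "Measurable.pred (bits D n) (\<lambda>X. undefined i)" by simp
  also have "?this \<longleftrightarrow> Measurable.pred (bits D n) (\<lambda>X. X u i)"
    using False by (intro measurable_cong) (auto simp: bits_def space_PiM PiE_def extensional_def)
  finally show ?thesis .
qed

section \<open>Runs as random variables: prefixes and measurability\<close>

lemma length_run [simp]: "length (run A X t) = t"
  by (induction t) auto

lemma take_run: "s \<le> t \<Longrightarrow> take s (run A X t) = run A X s"
  by (induction t) (auto simp: le_Suc_eq)

lemma nth_run: "s < t \<Longrightarrow> run A X t ! s = attempters A X (run A X s)"
  using take_run[of "Suc s" t A X] by (metis length_run lessI nth_append_length nth_take run.simps(2) Suc_leI)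

lemma run_eq_iff:
  "run A X t = h \<longleftrightarrow> length h = t \<and> (\<forall>j<t. attempters A X (take j h) = h ! j)"
proof
  assume "run A X t = h"
  then show "length h = t \<and> (\<forall>j<t. attempters A X (take j h) = h ! j)"
    by (auto simp: nth_run take_run)
next
  show "length h = t \<and> (\<forall>j<t. attempters A X (take j h) = h ! j) \<Longrightarrow> run A X t = h"
  proof (induction t arbitrary: h)
    case (Suc t)
    then obtain h' S where h: "h = h' @ [S]" "length h' = t"
      by (metis length_Suc_conv_rev)
    have "attempters A X (take j h') = h' ! j" if "j < t" for j
      using Suc.prems that h by (metis butlast_snoc less_Suc_eq nth_butlast take_butlast)
    then have "run A X t = h'" using h Suc.IH by auto
    moreover have "attempters A X h' = S" using Suc.prems h by fastforce
    ultimately show ?case using h by simp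
  qed auto
qed

lemma finite_attempters:
  assumes "\<And>h. finite (A h)" shows "finite (attempters A X h)"
proof (rule finite_subset)
  show "attempters A X h \<subseteq> (\<Union>s<length h. A (take (Suc s) h))" by (auto simp: attempters_def)
qed (use assms in auto)

lemma run_measurable:
  assumes D: "memoryless_protocol D" and fin: "\<And>h. finite (A h)"
  shows "(\<lambda>X. run A X t) \<in> measurable (bits D n) (count_space UNIV)"
proof -
  have a: "Measurable.pred (bits D n) (\<lambda>X. attempters A X h = S)" for h S
  proof -
    have *: "attempters A X h = S \<longleftrightarrow>
      (\<forall>u. ((\<exists>s\<in>{..<length h}. u \<in> A (take (Suc s) h) \<and> X u (length h - s)) \<and> {u} \<notin> set h) = (u \<in> S))" for X
      unfolding attempters_def by blast
    have [measurable]: "Measurable.pred (bits D n) (\<lambda>X. X u (length h - s))" if "s \<in> {..<length h}" for u s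
      using that by (intro bit_measurable D) auto
    show ?thesis unfolding * by measurable
  qed
  \<comment> \<open>Lists of arbitrary sets of naturals form an uncountable type. Only lists of
    finite sets occur, and there are countably many of these, so checking singletons
    suffices.\<close>
  let ?C = "{h :: history. \<forall>S\<in>set h. finite S}"
  have "countable {S :: nat set. finite S}" by (rule countable_Collect_finite)
  then have "countable (lists {S :: nat set. finite S})" by (rule countable_lists)
  moreover have "lists {S :: nat set. finite S} = ?C" by (auto simp: in_lists_conv_set)
  ultimately have C: "countable ?C" by simp
  have fr: "run A X t \<in> ?C" for X t
    by (induction t) (auto simp: finite_attempters[OF fin])
  have "(\<lambda>X. run A X t) \<in> measurable (bits D n) (count_space ?C)"
    unfolding measurable_count_space_eq_countable[OF C]
  proof (intro conjI ballI)
    fix h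
    have "(\<lambda>X. run A X t) -` {h} \<inter> space (bits D n)
        = {X \<in> space (bits D n). length h = t \<and> (\<forall>j\<in>{..<t}. attempters A X (take j h) = h ! j)}"
      by (intro set_eqI) (simp add: run_eq_iff, blast)
    also have "\<dots> \<in> sets (bits D n)"
      using a by (intro sets.sets_Collect sets.sets_Collect_countable_Ball predE) auto
    finally show "(\<lambda>X. run A X t) -` {h} \<inter> space (bits D n) \<in> sets (bits D n)" .
  qed (use fr in auto)
  from measurable_compose[OF this, of "\<lambda>x. x" "count_space UNIV"] show ?thesis by simp
qed

lemma latency_measurable:
  assumes D: "memoryless_protocol D" and fin: "\<And>h. finite (A h)"
  shows "(\<lambda>X. latency A X u) \<in> measurable (bits D n) (count_space UNIV)"
proof -
  have r [measurable]: "(\<lambda>X. run A X t) \<in> measurable (bits D n) (count_space UNIV)" for t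
    by (rule run_measurable[OF D fin])
  have P [measurable]: "Measurable.pred (bits D n) (\<lambda>X. P (run A X t))" for P t
    using measurable_compose[OF r[where t=t], where g=P and L="count_space UNIV"] by simp
  have w [measurable]: "(\<lambda>X. wake_time A X u) \<in> measurable (bits D n) (count_space UNIV)"
    unfolding wake_time_def using P[of "\<lambda>h. u \<in> A h"] by measurable
  have e: "Measurable.pred (bits D n) (\<lambda>X. attempters A X (run A X t) = {u})" for t
    using P[of "\<lambda>h. last h = {u}" "Suc t"] by simp
  have s [measurable]: "(\<lambda>X. success_time A X u) \<in> measurable (bits D n) (count_space UNIV)"
  proof -
    have eq: "success_time A X u = (if \<exists>t. attempters A X (run A X t) = {u}
        then enat (LEAST t. attempters A X (run A X t) = {u}) else \<infinity>)" for X
    proof (cases "\<exists>t. attempters A X (run A X t) = {u}")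
      case True
      then have "attempters A X (run A X (LEAST t. attempters A X (run A X t) = {u})) = {u}"
        by (rule LeastI_ex)
      then have "success_time A X u = enat (LEAST t. attempters A X (run A X t) = {u})"
        unfolding success_time_def
        by (intro antisym INF_greatest INF_lower) (auto intro: Least_le)
      then show ?thesis using True by simp
    qed (simp add: success_time_def top_enat_def)
    show ?thesis unfolding eq using e by measurable
  qed
  show ?thesis unfolding latency_def by measurable
qed

text \<open>The condition \<open>s + T < length h\<close> puts the whole window
  \<open>s + 1, ..., s + T\<close> inside \<open>h\<close>, so slots that are still to come never
  count as missed.\<close>

definition missed :: "adversary \<Rightarrow> nat \<Rightarrow> nat \<Rightarrow> history \<Rightarrow> bool" where
  "missed A u T h \<longleftrightarrow> (\<exists>s. u \<in> A (take (Suc s) h) \<and> s + T < length h \<and>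
     (\<forall>t. s < t \<longrightarrow> t \<le> s + T \<longrightarrow> h ! t \<noteq> {u}))"

section \<open>The law of the random history, and long latencies as events of histories\<close>

locale memoryless_contention =
  fixes D :: "(nat \<Rightarrow> bool) measure" and n :: nat and A :: adversary
  assumes memoryless: "memoryless_protocol D" and wk_once: "woken_once n A"

sublocale memoryless_contention \<subseteq> contention "bit_prob D" n A
  using bit_prob_bounds[OF memoryless] wk_once by unfold_locales auto

sublocale memoryless_contention \<subseteq> Bits: prob_space "bits D n"
  by (rule prob_space_bits[OF memoryless])

context memoryless_contention
begin

text \<open>The bit sequences with which \<open>v\<close> behaves as recorded in \<open>h\<close>.
  Parties influence each other only through the history, so the event that the run equals
  \<open>h\<close> splits into one such condition per party.\<close>

definition consistent :: "history \<Rightarrow> nat \<Rightarrow> (nat \<Rightarrow> bool) set" where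
  "consistent h v = {x \<in> space D. \<forall>t<length h. (v \<in> h ! t) =
     ((\<exists>s<t. v \<in> A (take (Suc s) h) \<and> x (t - s)) \<and> {v} \<notin> set (take t h))}"

text \<open>The wake-up slot \<open>s0\<close> is fixed by \<open>h\<close>, so the condition
  prescribes bits at distinct ages and is a cylinder set. In slots where \<open>v\<close> is asleep
  or has succeeded, a recorded attempt is impossible and both sides vanish.\<close>

lemma consistent_prob:
  "consistent h v \<in> sets D \<and> measure D (consistent h v) =
     (\<Prod>t<length h. if v \<in> h ! t then attempt_prob (take t h) v else 1 - attempt_prob (take t h) v)"
proof (cases "\<exists>s<length h. v \<in> A (take (Suc s) h)")
  case False
  have ap: "attempt_prob (take t h) v = 0" if "t < length h" for t
    using that False by (intro attempt_prob_not_woken) auto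
  have eq: "consistent h v = (if \<exists>t<length h. v \<in> h ! t then {} else space D)"
    unfolding consistent_def using False by auto
  interpret prob_space D using memoryless by (rule memoryless_prob_space)
  have "(\<Prod>t<length h. if v \<in> h ! t then attempt_prob (take t h) v else 1 - attempt_prob (take t h) v)
      = (if \<exists>t<length h. v \<in> h ! t then 0 else 1)"
    using ap by (auto intro!: prod.neutral)
  then show ?thesis unfolding eq by (auto simp: prob_space)
next
  case True
  then obtain s0 where s0: "s0 < length h" "v \<in> A (take (Suc s0) h)" by auto
  define T1 where "T1 = {t. t < length h \<and> s0 < t \<and> {v} \<notin> set (take t h)}"
  define J where "J = (\<lambda>t. t - s0) ` T1"
  define b where "b i = (v \<in> h ! (i + s0))" for i
  have T1: "T1 \<subseteq> {..<length h}" "finite T1" by (auto simp: T1_def)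
  have J: "finite J" "J \<subseteq> {1..}" by (auto simp: J_def T1_def)
  have cond: "(\<exists>s<t. v \<in> A (take (Suc s) h) \<and> x (t - s)) \<longleftrightarrow> s0 < t \<and> x (t - s0)"
    if "t < length h" for t x
  proof -
    have "s = s0" if "s < t" "v \<in> A (take (Suc s) h)" for s
      using wake_unique[of s h s0 v] that s0 \<open>t < length h\<close> by auto
    then show ?thesis using s0 by auto
  qed
  have ap1: "attempt_prob (take t h) v = bit_prob D (t - s0)" if "t \<in> T1" for t
  proof -
    have "attempt_prob (take t h) v = bit_prob D (length (take t h) - s0)"
      using that s0 by (intro attempt_prob_woken) (auto simp: T1_def min_def)
    then show ?thesis using that by (auto simp: T1_def)
  qed
  have ap0: "attempt_prob (take t h) v = 0" if "t < length h" "t \<notin> T1" for t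
  proof (cases "{v} \<in> set (take t h)")
    case True then show ?thesis by (simp add: attempt_prob_def)
  next
    case False
    then have "\<not> s0 < t" using that by (auto simp: T1_def)
    moreover have "s = s0" if "s < t" "v \<in> A (take (Suc s) h)" for s
      using wake_unique[of s h s0 v] that s0 \<open>t < length h\<close> by auto
    ultimately show ?thesis using that by (intro attempt_prob_not_woken) auto
  qed
  have split: "(\<Prod>t<length h. if v \<in> h ! t then attempt_prob (take t h) v else 1 - attempt_prob (take t h) v)
     = (\<Prod>t\<in>{..<length h} - T1. if v \<in> h ! t then 0 else 1) *
       (\<Prod>t\<in>T1. if v \<in> h ! t then bit_prob D (t - s0) else 1 - bit_prob D (t - s0))"
    using T1 ap1 ap0 by (subst prod.subset_diff[of T1]) (auto intro!: arg_cong2[where f="(*)"] prod.cong)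
  have T1J: "(\<Prod>t\<in>T1. if v \<in> h ! t then bit_prob D (t - s0) else 1 - bit_prob D (t - s0))
     = (\<Prod>i\<in>J. if b i then bit_prob D i else 1 - bit_prob D i)"
    unfolding J_def by (subst prod.reindex) (auto simp: inj_on_def T1_def b_def intro!: prod.cong)
  show ?thesis
  proof (cases "\<exists>t\<in>{..<length h} - T1. v \<in> h ! t")
    case True
    then obtain t where t: "t < length h" "t \<notin> T1" "v \<in> h ! t" by auto
    have "consistent h v = {}"
      unfolding consistent_def using t cond[OF t(1)] by (auto simp: T1_def)
    moreover have "(\<Prod>t\<in>{..<length h} - T1. if v \<in> h ! t then 0 else (1::real)) = 0"
      using True by (intro prod_zero) auto
    ultimately show ?thesis by (simp add: split)
  next
    case False
    have "consistent h v = {x \<in> space D. \<forall>i\<in>J. x i = b i}"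
      unfolding consistent_def
    proof (intro Collect_cong conj_cong refl)
      fix x
      have "(\<forall>t<length h. (v \<in> h ! t) = ((\<exists>s<t. v \<in> A (take (Suc s) h) \<and> x (t - s)) \<and> {v} \<notin> set (take t h)))
        \<longleftrightarrow> (\<forall>t<length h. (v \<in> h ! t) = ((s0 < t \<and> x (t - s0)) \<and> {v} \<notin> set (take t h)))"
        using cond by blast
      also have "\<dots> \<longleftrightarrow> (\<forall>t\<in>T1. (v \<in> h ! t) = x (t - s0))"
        using False by (auto simp: T1_def)
      also have "\<dots> \<longleftrightarrow> (\<forall>i\<in>J. x i = b i)"
        unfolding J_def b_def by (auto simp: T1_def)
      finally show "(\<forall>t<length h. (v \<in> h ! t) = ((\<exists>s<t. v \<in> A (take (Suc s) h) \<and> x (t - s)) \<and> {v} \<notin> set (take t h)))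
        \<longleftrightarrow> (\<forall>i\<in>J. x i = b i)" .
    qed
    moreover have "(\<Prod>t\<in>{..<length h} - T1. if v \<in> h ! t then 0 else (1::real)) = 1"
      using False by (intro prod.neutral) auto
    ultimately show ?thesis
      using memoryless_cylinder[OF memoryless J, of b] by (simp add: split T1J)
  qed
qed

lemma run_histories: "run A X t \<in> histories t"
proof -
  have "attempters A X h \<subseteq> {..<n}" for h
    using A_subset by (auto simp: attempters_def)
  then have "set (run A X t) \<subseteq> Pow {..<n}" by (induction t) auto
  then show ?thesis by (simp add: histories_def)
qed

text \<open>Independence of the parties gives a product over parties of products over slots;
  exchanging the two products gives \<open>hist_prob\<close>.\<close>

lemma run_prob:
  assumes h: "h \<in> histories t"
  shows "{X \<in> space (bits D n). run A X t = h} \<in> sets (bits D n)"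
    and "Bits.prob {X \<in> space (bits D n). run A X t = h} = hist_prob h"
proof -
  have len: "length h = t" and sub: "\<And>j. j < t \<Longrightarrow> h ! j \<subseteq> {..<n}"
    using h nth_mem[of _ h] unfolding histories_def by (simp, blast)
  have eq: "{X \<in> space (bits D n). run A X t = h} = {X \<in> space (bits D n). \<forall>v<n. X v \<in> consistent h v}"
  proof (intro Collect_cong conj_cong refl)
    fix X assume X: "X \<in> space (bits D n)"
    have att: "attempters A X (take j h) = h ! j \<longleftrightarrow> (\<forall>v<n. (v \<in> h ! j) =
       ((\<exists>s<j. v \<in> A (take (Suc s) h) \<and> X v (j - s)) \<and> {v} \<notin> set (take j h)))" if j: "j < t" for j
    proof -
      have "attempters A X (take j h) \<subseteq> {..<n}" using A_subset by (auto simp: attempters_def)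
      then have "attempters A X (take j h) = h ! j \<longleftrightarrow> (\<forall>v<n. v \<in> h ! j \<longleftrightarrow> v \<in> attempters A X (take j h))"
        using sub[OF j] by blast
      also have "\<dots> \<longleftrightarrow> (\<forall>v<n. (v \<in> h ! j) =
       ((\<exists>s<j. v \<in> A (take (Suc s) h) \<and> X v (j - s)) \<and> {v} \<notin> set (take j h)))"
      proof -
        have "take (Suc s) (take j h) = take (Suc s) h" if "s < j" for s using that by (simp add: min_def)
        then show ?thesis using j len by (simp add: attempters_def min_def cong: conj_cong)
      qed
      finally show ?thesis .
    qed
    have sp: "X v \<in> space D" if "v < n" for v
      using X that by (auto simp: bits_def space_PiM)
    show "run A X t = h \<longleftrightarrow> (\<forall>v<n. X v \<in> consistent h v)"
      unfolding run_eq_iff consistent_def using att sp len by auto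
  qed
  show "{X \<in> space (bits D n). run A X t = h} \<in> sets (bits D n)"
    unfolding eq using consistent_prob by (intro bits_cylinder(1)[OF memoryless]) auto
  have "Bits.prob {X \<in> space (bits D n). run A X t = h} = (\<Prod>v<n. measure D (consistent h v))"
    unfolding eq using consistent_prob by (intro bits_cylinder(2)[OF memoryless]) auto
  also have "\<dots> = (\<Prod>v<n. \<Prod>t<length h. if v \<in> h ! t then attempt_prob (take t h) v else 1 - attempt_prob (take t h) v)"
    using consistent_prob by (intro prod.cong) auto
  also have "\<dots> = hist_prob h"
    unfolding hist_prob_def step_prob_def by (rule prod.swap)
  finally show "Bits.prob {X \<in> space (bits D n). run A X t = h} = hist_prob h" .
qed

lemma prob_run:
  "{X \<in> space (bits D n). P (run A X t)} \<in> sets (bits D n)"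
  "Bits.prob {X \<in> space (bits D n). P (run A X t)} = mean t (\<lambda>h. of_bool (P h))"
proof -
  have eq: "{X \<in> space (bits D n). P (run A X t)}
    = (\<Union>h\<in>{h \<in> histories t. P h}. {X \<in> space (bits D n). run A X t = h})"
    using run_histories by auto
  show "{X \<in> space (bits D n). P (run A X t)} \<in> sets (bits D n)"
    unfolding eq using run_prob by (intro sets.finite_UN) auto
  have "Bits.prob {X \<in> space (bits D n). P (run A X t)} = (\<Sum>h\<in>{h \<in> histories t. P h}. hist_prob h)"
    unfolding eq using run_prob
    by (subst Bits.finite_measure_finite_Union) (auto simp: disjoint_family_on_def image_subset_iff)
  also have "\<dots> = mean t (\<lambda>h. of_bool (P h))"
    unfolding mean_def by (intro sum.mono_neutral_cong_left) auto
  finally show "Bits.prob {X \<in> space (bits D n). P (run A X t)} = mean t (\<lambda>h. of_bool (P h))" .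
qed

lemma success_time_le: "attempters A X (run A X t) = {u} \<Longrightarrow> success_time A X u \<le> enat t"
  unfolding success_time_def by (intro INF_lower) auto

lemma latency_gt_imp_missed:
  assumes woken: "u \<in> A (run A X (Suc t))" and lat: "latency A X u > enat T"
  shows "\<exists>t. missed A u T (run A X t)"
proof -
  define s where "s = wake_time A X u"
  have s: "u \<in> A (run A X (Suc s))"
    unfolding s_def wake_time_def by (rule LeastI[where P="\<lambda>t. u \<in> A (run A X (Suc t))", OF woken])
  have "missed A u T (run A X (Suc (s + T)))"
    unfolding missed_def
  proof (intro exI[of _ s] conjI allI impI)
    show "u \<in> A (take (Suc s) (run A X (Suc (s + T))))"
      using s by (subst take_run) auto
    fix t assume t: "s < t" "t \<le> s + T"
    show "run A X (Suc (s + T)) ! t \<noteq> {u}"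
    proof
      assume "run A X (Suc (s + T)) ! t = {u}"
      then have "attempters A X (run A X t) = {u}" using t by (simp add: nth_run del: run.simps)
      from success_time_le[OF this] have "success_time A X u \<le> enat t" .
      then have "latency A X u \<le> enat (t - s)"
        unfolding latency_def s_def[symmetric]
        by (cases "success_time A X u") (auto simp: diff_le_mono)
      also have "\<dots> \<le> enat T" using t by auto
      finally show False using lat by auto
    qed
  qed (auto simp del: run.simps)
  then show ?thesis by blast
qed

lemma missed_run_mono:
  assumes "missed A u T (run A X t)" "t \<le> t'" shows "missed A u T (run A X t')"
proof -
  obtain s where s: "u \<in> A (take (Suc s) (run A X t))" "s + T < t"
    "\<forall>j. s < j \<longrightarrow> j \<le> s + T \<longrightarrow> run A X t ! j \<noteq> {u}"
    using assms by (auto simp: missed_def)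
  have "take (Suc s) (run A X t') = take (Suc s) (run A X t)"
    using s assms by (simp add: take_run del: run.simps)
  moreover have "run A X t' ! j = run A X t ! j" if "j \<le> s + T" for j
    using that s(2) assms by (simp add: nth_run)
  ultimately show ?thesis using s assms unfolding missed_def by (intro exI[of _ s]) auto
qed

text \<open>The events \<open>missed\<close> increase with \<open>t\<close> and together contain
  every latency above \<open>T\<close> of a woken party, so a bound uniform in \<open>t\<close>
  passes to the limit.\<close>

lemma latency_tail:
  assumes bound: "\<And>t. mean t (\<lambda>h. of_bool (missed A u T h)) \<le> c"
    and woken: "AE X in bits D n. \<exists>t. u \<in> A (run A X (Suc t))"
  shows "Bits.prob {X \<in> space (bits D n). latency A X u > enat T} \<le> c"
proof -
  define M where "M t = {X \<in> space (bits D n). missed A u T (run A X t)}" for t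
  have M: "M t \<in> sets (bits D n)" for t unfolding M_def by (rule prob_run)
  have "incseq M" using missed_run_mono by (auto simp: incseq_def M_def)
  then have lim: "(\<lambda>t. Bits.prob (M t)) \<longlonglongrightarrow> Bits.prob (\<Union>t. M t)"
    using M by (intro Bits.finite_Lim_measure_incseq) auto
  have "Bits.prob (M t) \<le> c" for t unfolding M_def prob_run(2) by (rule bound)
  then have "Bits.prob (\<Union>t. M t) \<le> c" using lim by (intro LIMSEQ_le_const2[OF lim]) auto
  moreover have "Bits.prob {X \<in> space (bits D n). latency A X u > enat T} \<le> Bits.prob (\<Union>t. M t)"
  proof (rule Bits.finite_measure_mono_AE)
    show "AE X in bits D n. X \<in> {X \<in> space (bits D n). latency A X u > enat T} \<longrightarrow> X \<in> (\<Union>t. M t)"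
      using woken AE_space
    proof eventually_elim
      case (elim X)
      then show ?case using latency_gt_imp_missed[of u X _ T] by (auto simp: M_def)
    qed
    show "(\<Union>t. M t) \<in> Bits.events" using M by auto
  qed
  ultimately show ?thesis by linarith
qed

end

text \<open>An adaptive adversary meets its party count only almost surely, whereas
  \<open>woken_once\<close> constrains every history. Intersecting with \<open>{..<n}\<close> closes
  this gap and changes the run only on a null set.\<close>

lemma AE_latency_restrict:
  assumes "AE X in M. \<forall>t. A (run A X (Suc t)) \<subseteq> {..<n}"
  defines "B \<equiv> \<lambda>h. A h \<inter> {..<n}"
  shows "AE X in M. (\<forall>t. run B X t = run A X t) \<and> latency B X u = latency A X u"
  using assms(1)
proof eventually_elim
  case (elim X)
  have run: "run B X t = run A X t" for t
  proof (induction t)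
    case (Suc t)
    have "B (take (Suc s) (run A X t)) = A (take (Suc s) (run A X t))" if "s < t" for s
      using elim that by (auto simp: B_def take_run simp del: run.simps)
    then have "attempters B X (run A X t) = attempters A X (run A X t)"
      unfolding attempters_def by auto
    then show ?case using Suc by simp
  qed simp
  have "B (run A X (Suc t)) = A (run A X (Suc t))" for t
    using elim by (auto simp: B_def simp del: run.simps)
  moreover have "attempters B X (run A X t) = attempters A X (run A X t)" for t
    using run[of "Suc t"] run[of t] by simp
  ultimately show ?case
    by (auto simp: latency_def wake_time_def success_time_def run simp del: run.simps)
qed

lemma wake_next_disjoint:
  assumes "s < s'" "s' < length h"
  shows "wake_next c (take (Suc s) h) \<inter> wake_next c (take (Suc s') h) = {}"
proof -
  have eq: "wake_next c (take (Suc r) h) = {\<Sum>j<r. c (take (Suc j) h) ..< \<Sum>j<Suc r. c (take (Suc j) h)}"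
    if "r < length h" for r
  proof -
    have l: "length (take (Suc r) h) = Suc r" using that by simp
    have "(\<Sum>j<k. c (take (Suc j) (take (Suc r) h))) = (\<Sum>j<k. c (take (Suc j) h))" if "k \<le> Suc r" for k
      using that by (intro sum.cong) (auto simp: min_def)
    then show ?thesis unfolding wake_next_def l by simp
  qed
  have "(\<Sum>j<Suc s. c (take (Suc j) h)) \<le> (\<Sum>j<s'. c (take (Suc j) h))"
    using assms by (intro sum_mono2) auto
  then show ?thesis using assms by (auto simp: eq simp del: sum.lessThan_Suc)
qed

lemma adaptive_latency_tail:
  assumes D: "memoryless_protocol D" and A: "A \<in> adaptive_adversaries D n" and u: "u < n"
    and bound: "\<And>B t. memoryless_contention D n B \<Longrightarrow>
      contention.mean (bit_prob D) n B t (\<lambda>h. of_bool (missed B u T h)) \<le> c"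
  shows "measure (bits D n) {X \<in> space (bits D n). latency A X u > enat T} \<le> c"
proof -
  obtain c' where Ac: "A = wake_next c'" using A by (auto simp: adaptive_adversaries_def)
  have all: "AE X in bits D n. (\<Union>t. A (run A X (Suc t))) = {..<n}"
    using A by (simp add: adaptive_adversaries_def)
  define B where "B = (\<lambda>h. A h \<inter> {..<n})"
  have AE: "AE X in bits D n. (\<forall>t. run B X t = run A X t) \<and> latency B X u = latency A X u"
    unfolding B_def using all by (intro AE_latency_restrict) (auto elim!: eventually_mono)
  have "woken_once n B"
    unfolding woken_once_def B_def Ac using wake_next_disjoint[of _ _ _ c'] by blast
  then interpret memoryless_contention D n B using D by unfold_locales
  have wB: "AE X in bits D n. \<exists>t. u \<in> B (run B X (Suc t))"
    using all AE
  proof eventually_elim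
    case (elim X)
    then obtain t where "u \<in> A (run A X (Suc t))" using u by blast
    then have "u \<in> B (run A X (Suc t))" using u by (simp add: B_def)
    then show ?case using elim by metis
  qed
  have fin: "finite (A h)" "finite (B h)" for h by (auto simp: Ac B_def wake_next_def)
  have meas: "{X \<in> space (bits D n). latency C X u > enat T} \<in> sets (bits D n)" if "\<And>h. finite (C h)" for C
    using latency_measurable[OF D that, where u=u and n=n] by measurable
  have "measure (bits D n) {X \<in> space (bits D n). latency A X u > enat T}
      = Bits.prob {X \<in> space (bits D n). latency B X u > enat T}"
  proof (rule Bits.finite_measure_eq_AE)
    show "AE X in bits D n. X \<in> {X \<in> space (bits D n). latency A X u > enat T} \<longleftrightarrow>
        X \<in> {X \<in> space (bits D n). latency B X u > enat T}"
      using AE by eventually_elim simp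
  qed (use meas fin in auto)
  also have "\<dots> \<le> c"
    using bound[OF memoryless_contention_axioms] wB by (rule latency_tail)
  finally show ?thesis .
qed

subsection \<open>Upper bounds\<close>

text \<open>Induction on the cardinality, removing the maximum: it is at least
  \<open>card I\<close>, so its value is at most \<open>p (card I)\<close>.\<close>

lemma sum_antimono_upper:
  fixes p :: "nat \<Rightarrow> real"
  assumes anti: "\<And>i j. 1 \<le> i \<Longrightarrow> i \<le> j \<Longrightarrow> p j \<le> p i" and nonneg: "\<And>i. 0 \<le> p i"
    and I: "finite I" "I \<subseteq> {1..}" "card I \<le> T"
  shows "sum p I \<le> (\<Sum>i=1..T. p i)"
proof -
  have "sum p I \<le> (\<Sum>i=1..card I. p i)"
    using I(1,2)
  proof (induction "card I" arbitrary: I)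
    case (Suc k)
    define m where "m = Max I"
    have ne: "I \<noteq> {}" using Suc.hyps by auto
    have m: "m \<in> I" using Suc.prems ne by (simp add: m_def)
    have "I \<subseteq> {1..m}" using Suc.prems by (auto simp: m_def)
    then have "card I \<le> m" using card_mono[of "{1..m}" I] by simp
    then have "p m \<le> p (Suc k)" using anti Suc.hyps by simp
    moreover have "sum p (I - {m}) \<le> (\<Sum>i=1..card (I - {m}). p i)"
      using Suc m by (intro Suc.hyps) auto
    moreover have "card (I - {m}) = k" using Suc m by simp
    moreover have "sum p I = p m + sum p (I - {m})" using m Suc.prems by (simp add: sum.remove)
    ultimately show ?case using Suc.hyps(2)[symmetric] by simp
  qed simp
  also have "\<dots> \<le> (\<Sum>i=1..T. p i)" using I nonneg by (intro sum_mono2) auto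
  finally show ?thesis .
qed

text \<open>At most \<open>N\<close> ages are missing, and they cost most if they are the first
  \<open>N\<close>, which leaves \<open>{N<..T}\<close>.\<close>

lemma sum_antimono_lower:
  fixes p :: "nat \<Rightarrow> real"
  assumes anti: "\<And>i j. 1 \<le> i \<Longrightarrow> i \<le> j \<Longrightarrow> p j \<le> p i" and nonneg: "\<And>i. 0 \<le> p i"
    and I: "I \<subseteq> {1..T}" "T \<le> card I + N"
  shows "(\<Sum>i\<in>{N<..T}. p i) \<le> sum p I"
proof (cases "N \<le> T")
  case True
  have fin: "finite I" using I(1) finite_subset by auto
  have "card ({1..T} - I) = T - card I" using I fin by (simp add: card_Diff_subset)
  then have "sum p ({1..T} - I) \<le> (\<Sum>i=1..N. p i)"
    using I by (intro sum_antimono_upper anti nonneg) auto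
  moreover have "sum p {1..T} = sum p I + sum p ({1..T} - I)"
    using I by (simp add: sum.subset_diff)
  moreover have "sum p {1..T} = (\<Sum>i=1..N. p i) + (\<Sum>i\<in>{N<..T}. p i)"
    using True by (subst sum.union_disjoint[symmetric]) (auto intro!: sum.cong)
  ultimately show ?thesis by simp
qed (simp add: nonneg sum_nonneg)

section \<open>Tail bound for missed windows under decreasing attempt probabilities\<close>

context contention
begin

text \<open>Speaks about the slot about to be played, number \<open>length h\<close>; slot
  \<open>t\<close> of a longer history is therefore tested on \<open>take t h\<close>.\<close>

definition in_window :: "nat \<Rightarrow> nat \<Rightarrow> history \<Rightarrow> bool" where
  "in_window u T h \<longleftrightarrow> (\<exists>s<length h. u \<in> A (take (Suc s) h) \<and> length h \<le> s + T)"

definition mid_slot :: "nat \<Rightarrow> nat \<Rightarrow> real \<Rightarrow> history \<Rightarrow> bool" where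
  "mid_slot u T B h \<longleftrightarrow> in_window u T h \<and> 1 \<le> contention h \<and> contention h < B"

definition low_slot :: "nat \<Rightarrow> nat \<Rightarrow> history \<Rightarrow> bool" where
  "low_slot u T h \<longleftrightarrow> in_window u T h \<and> contention h < 1"

definition mid_count :: "nat \<Rightarrow> nat \<Rightarrow> real \<Rightarrow> history \<Rightarrow> nat" where
  "mid_count u T B h = card {t. t < length h \<and> mid_slot u T B (take t h)}"

definition successes :: "history \<Rightarrow> nat set" where
  "successes h = {v. v < n \<and> {v} \<in> set h}"

lemma contention_nonneg: "0 \<le> contention h"
  unfolding contention_def using attempt_prob_bounds by (intro sum_nonneg) auto

lemma mid_count_snoc: "mid_count u T B (h @ [S]) = mid_count u T B h + of_bool (mid_slot u T B h)"
proof -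
  have "{t. t < length (h @ [S]) \<and> mid_slot u T B (take t (h @ [S]))}
     = {t. t < length h \<and> mid_slot u T B (take t h)} \<union> (if mid_slot u T B h then {length h} else {})"
    by (auto simp: less_Suc_eq)
  then show ?thesis by (simp add: mid_count_def)
qed

lemma attempt_not_succeeded: "attempt_prob h v \<noteq> 0 \<Longrightarrow> {v} \<notin> set h"
  by (auto simp: attempt_prob_def)

(* The number of successful parties never exceeds n, so it is used as a clock:
   exp (- successes + c * mid slots) is a supermartingale. *)
lemma mid_count_tail:
  assumes half: "\<And>i. p i \<le> 1/2"
  shows "mean t (\<lambda>h. of_bool (M \<le> mid_count u T B h)) \<le> exp (n - exp (- 2 * B) / 2 * M)"
proof -
  \<comment> \<open>A mid slot is a success with probability at least \<open>exp (- 2 * B)\<close>,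
    and a success multiplies the potential by \<open>exp (- 1) \<le> 1/2\<close>. The expected
    factor is thus at most \<open>1 - c \<le> exp (- c)\<close>, which pays for counting the
    slot.\<close>
  define c where "c = exp (- 2 * B) / 2"
  define F where "F h = exp (- real (card (successes h)) + c * mid_count u T B h)" for h
  have step: "next_mean F h \<le> 1 * F h" for h
  proof -
    define E where "E = (if mid_slot u T B h then exp c else 1)"
    have E: "0 < E" by (simp add: E_def)
    have snoc: "F (h @ [S]) = exp (- real (card (successes (h @ [S]))) + c * mid_count u T B h) * E" for S
      by (auto simp: F_def mid_count_snoc E_def exp_add[symmetric] distrib_left)
    have fin: "finite (successes h)" for h by (simp add: successes_def)
    have "next_mean F h \<le> F h * E + (\<Sum>v<n. step_prob h {v} * (F h * E * (exp (- 1) - 1)))"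
    proof (rule next_mean_le_singles)
      fix S assume "step_prob h S \<noteq> 0"
      have "card (successes h) \<le> card (successes (h @ [S]))"
        by (intro card_mono fin) (auto simp: successes_def)
      then show "F (h @ [S]) \<le> F h * E"
        unfolding snoc using E by (auto simp: F_def)
    next
      fix v assume v: "v < n" "step_prob h {v} \<noteq> 0"
      then have "v \<notin> successes h"
        using step_prob_nz_attempt[of h "{v}" v] attempt_not_succeeded by (auto simp: successes_def)
      moreover have "successes (h @ [{v}]) = insert v (successes h)"
        using v by (auto simp: successes_def)
      ultimately have "card (successes (h @ [{v}])) = Suc (card (successes h))" using fin by simp
      then have "F (h @ [{v}]) = F h * E * exp (- 1)"
        unfolding snoc by (simp add: F_def exp_add[symmetric] exp_diff exp_minus field_simps)
      then show "F (h @ [{v}]) \<le> F h * E + F h * E * (exp (- 1) - 1)"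
        by (simp add: algebra_simps)
    qed
    also have "\<dots> = F h * (E * (1 - (1 - exp (- 1)) * (\<Sum>v<n. step_prob h {v})))"
      unfolding sum_distrib_right[symmetric] by (simp add: algebra_simps)
    also have "\<dots> \<le> F h * 1"
    proof (rule mult_left_mono)
      have e1: "exp (- 1) \<le> (1/2 :: real)" using exp_ge_add_one_self[of 1] by (simp add: exp_minus field_simps)
      have s: "0 \<le> (\<Sum>v<n. step_prob h {v})" by (intro sum_nonneg step_prob_nonneg)
      show "E * (1 - (1 - exp (- 1)) * (\<Sum>v<n. step_prob h {v})) \<le> 1"
      proof (cases "mid_slot u T B h")
        case True
        then have m: "1 \<le> contention h" "contention h < B" by (auto simp: mid_slot_def)
        have "exp (- 2 * B) \<le> exp (- 2 * contention h)" using m by simp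
        also have "\<dots> \<le> contention h * exp (- 2 * contention h)" using m by simp
        also have "\<dots> = (\<Sum>v<n. attempt_prob h v * exp (- 2 * contention h))"
          by (simp add: contention_def sum_distrib_right)
        also have "\<dots> \<le> (\<Sum>v<n. step_prob h {v})"
          using step_prob_single_ge half by (intro sum_mono) auto
        finally have "2 * c \<le> (\<Sum>v<n. step_prob h {v})" by (simp add: c_def)
        then have "1/2 * (2 * c) \<le> (1 - exp (- 1)) * (\<Sum>v<n. step_prob h {v})"
          using e1 s by (intro mult_mono) (auto simp: c_def)
        then have "1 - (1 - exp (- 1)) * (\<Sum>v<n. step_prob h {v}) \<le> 1 + - c" by simp
        also have "\<dots> \<le> exp (- c)" by (rule exp_ge_add_one_self)
        finally have "exp c * (1 - (1 - exp (- 1)) * (\<Sum>v<n. step_prob h {v})) \<le> exp c * exp (- c)"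
          by (intro mult_left_mono) auto
        then show ?thesis using True by (simp add: E_def exp_add[symmetric])
      next
        case False
        then show ?thesis using e1 s by (simp add: E_def)
      qed
    qed (simp add: F_def)
    finally show ?thesis by simp
  qed
  have "mean t F \<le> (\<Prod>s<t. 1) * F []"
    using step by (intro mean_supermartingale) auto
  also have "\<dots> = 1" by (simp add: F_def successes_def mid_count_def)
  finally have F1: "mean t F \<le> 1" .
  have "mean t (\<lambda>h. of_bool (M \<le> mid_count u T B h)) \<le> mean t F / exp (c * M - n)"
  proof (rule markov_mean)
    fix h assume "M \<le> mid_count u T B h"
    then have "c * M \<le> c * mid_count u T B h" by (intro mult_left_mono) (auto simp: c_def)
    moreover have "card (successes h) \<le> card {..<n}"
      by (intro card_mono) (auto simp: successes_def)
    ultimately show "exp (c * M - n) \<le> F h" by (simp add: F_def)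
  qed (auto simp: F_def)
  also have "\<dots> \<le> 1 / exp (c * M - n)" using F1 by (intro divide_right_mono) auto
  also have "\<dots> = exp (n - c * M)" by (simp add: exp_diff)
  finally show ?thesis by (simp add: c_def)
qed

definition unsuccessful :: "nat \<Rightarrow> nat \<Rightarrow> history \<Rightarrow> bool" where
  "unsuccessful u T h \<longleftrightarrow> (\<forall>t<length h. in_window u T (take t h) \<longrightarrow> h ! t \<noteq> {u})"

definition low_mass :: "nat \<Rightarrow> nat \<Rightarrow> history \<Rightarrow> real" where
  "low_mass u T h = (\<Sum>t<length h. if low_slot u T (take t h) then attempt_prob (take t h) u else 0)"

text \<open>In a low slot \<open>u\<close> succeeds with probability at least
  \<open>exp (- 2)\<close> times its attempt probability. The factor that the potential gains there
  is paid for by the chance that the indicator of no success drops to 0.\<close>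

lemma low_mass_tail:
  assumes half: "\<And>i. p i \<le> 1/2" and u: "u < n"
  shows "mean t (\<lambda>h. of_bool (unsuccessful u T h \<and> m \<le> low_mass u T h)) \<le> exp (- exp (- 2) * m)"
proof -
  define F where "F h = of_bool (unsuccessful u T h) * exp (exp (- 2) * low_mass u T h)" for h
  have step: "next_mean F h \<le> 1 * F h" for h
  proof -
    define E where "E = (if low_slot u T h then exp (exp (- 2) * attempt_prob h u) else 1)"
    have mass: "low_mass u T (h @ [S]) = low_mass u T h + (if low_slot u T h then attempt_prob h u else 0)" for S
      unfolding low_mass_def by (auto intro!: sum.cong)
    have uns: "unsuccessful u T (h @ [S]) \<longleftrightarrow> unsuccessful u T h \<and> (in_window u T h \<longrightarrow> S \<noteq> {u})" for S
      by (auto simp: unsuccessful_def less_Suc_eq nth_append)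
    have snoc: "F (h @ [S]) = of_bool (in_window u T h \<longrightarrow> S \<noteq> {u}) * (F h * E)" for S
      by (auto simp: F_def mass uns E_def exp_add[symmetric] distrib_left)
    have FE: "0 \<le> F h * E" by (simp add: F_def E_def)
    have "next_mean F h \<le> F h * E + (\<Sum>v<n. step_prob h {v} * (if v = u \<and> in_window u T h then - (F h * E) else 0))"
      using FE by (intro next_mean_le_singles) (auto simp: snoc)
    also have "(\<Sum>v<n. step_prob h {v} * (if v = u \<and> in_window u T h then - (F h * E) else 0))
        = (if in_window u T h then - (step_prob h {u} * (F h * E)) else 0)"
      using u by (auto simp: if_distrib if_distribR sum.delta cong: if_cong)
    also have "F h * E + (if in_window u T h then - (step_prob h {u} * (F h * E)) else 0) \<le> F h"
    proof (cases "low_slot u T h")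
      case True
      then have w: "in_window u T h" "contention h < 1" by (auto simp: low_slot_def)
      have "attempt_prob h u * exp (- 2) \<le> attempt_prob h u * exp (- 2 * contention h)"
        using w attempt_prob_bounds by (intro mult_left_mono) auto
      also have "\<dots> \<le> step_prob h {u}" using step_prob_single_ge[OF u] half by auto
      finally have "1 - step_prob h {u} \<le> 1 + - (exp (- 2) * attempt_prob h u)" by (simp add: mult.commute)
      also have "\<dots> \<le> exp (- (exp (- 2) * attempt_prob h u))" by (rule exp_ge_add_one_self)
      finally have "E * (1 - step_prob h {u}) \<le> E * exp (- (exp (- 2) * attempt_prob h u))"
        by (intro mult_left_mono) (auto simp: E_def)
      also have "\<dots> = 1" using True by (simp add: E_def exp_add[symmetric])
      finally have "F h * (E * (1 - step_prob h {u})) \<le> F h * 1"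
        by (intro mult_left_mono) (auto simp: F_def)
      then show ?thesis using w by (simp add: algebra_simps)
    next
      case False
      then show ?thesis using FE step_prob_nonneg by (auto simp: E_def)
    qed
    finally show ?thesis by simp
  qed
  have "mean t F \<le> (\<Prod>s<t. 1) * F []"
    using step by (intro mean_supermartingale) auto
  also have "\<dots> = 1" by (simp add: F_def unsuccessful_def low_mass_def)
  finally have F1: "mean t F \<le> 1" .
  have "mean t (\<lambda>h. of_bool (unsuccessful u T h \<and> m \<le> low_mass u T h)) \<le> mean t F / exp (exp (- 2) * m)"
    by (rule markov_mean) (auto simp: F_def)
  also have "\<dots> \<le> 1 / exp (exp (- 2) * m)" using F1 by (intro divide_right_mono) auto
  also have "\<dots> = exp (- exp (- 2) * m)" by (simp add: exp_minus field_simps)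
  finally show ?thesis .
qed

text \<open>Within the window a party passes through distinct ages, so for decreasing
  \<open>p\<close> it contributes at most \<open>p 1 + ... + p T\<close>, whenever it was
  woken.\<close>

lemma window_contention:
  assumes anti: "\<And>i j. 1 \<le> i \<Longrightarrow> i \<le> j \<Longrightarrow> p j \<le> p i" and len: "s + T < length h"
  shows "(\<Sum>t\<in>{s<..s+T}. contention (take t h)) \<le> n * (\<Sum>i=1..T. p i)"
proof -
  have one: "(\<Sum>t\<in>{s<..s+T}. attempt_prob (take t h) v) \<le> (\<Sum>i=1..T. p i)" for v
  proof (cases "\<exists>r<length h. v \<in> A (take (Suc r) h)")
    case False
    then have "attempt_prob (take t h) v = 0" for t by (intro attempt_prob_not_woken) auto
    then show ?thesis using p_nonneg by (simp add: sum_nonneg)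
  next
    case True
    then obtain r where r: "r < length h" "v \<in> A (take (Suc r) h)" by auto
    have le: "attempt_prob (take t h) v \<le> (if r < t then p (t - r) else 0)" if "t \<in> {s<..s+T}" for t
    proof (cases "{v} \<in> set (take t h)")
      case True then show ?thesis by (simp add: attempt_prob_def p_nonneg)
    next
      case False
      show ?thesis
      proof (cases "r < t")
        case True
        then have "attempt_prob (take t h) v = p (length (take t h) - r)"
          using r False by (intro attempt_prob_woken) (auto simp: min_def)
        then show ?thesis using True that len by simp
      next
        case False
        have "v \<notin> A (take (Suc j) h)" if "j < t" for j
          using wake_unique[of j h r v] r that False \<open>t \<in> {s<..s+T}\<close> len by auto
        then have "attempt_prob (take t h) v = 0" by (intro attempt_prob_not_woken) auto
        then show ?thesis using False by simp
      qed
    qed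
    have "(\<Sum>t\<in>{s<..s+T}. attempt_prob (take t h) v) \<le> (\<Sum>t\<in>{s<..s+T}. if r < t then p (t - r) else 0)"
      using le by (rule sum_mono)
    also have "\<dots> = (\<Sum>t\<in>{t\<in>{s<..s+T}. r < t}. p (t - r))"
      by (subst sum.inter_filter) auto
    also have "\<dots> = sum p ((\<lambda>t. t - r) ` {t\<in>{s<..s+T}. r < t})"
      by (subst sum.reindex) (auto simp: inj_on_def)
    also have "\<dots> \<le> (\<Sum>i=1..T. p i)"
    proof (rule sum_antimono_upper[OF anti p_nonneg])
      have "card ((\<lambda>t. t - r) ` {t\<in>{s<..s+T}. r < t}) \<le> card {t\<in>{s<..s+T}. r < t}"
        by (intro card_image_le) auto
      also have "\<dots> \<le> card {s<..s+T}" by (intro card_mono) auto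
      finally show "card ((\<lambda>t. t - r) ` {t\<in>{s<..s+T}. r < t}) \<le> T" by simp
    qed auto
    finally show ?thesis .
  qed
  have "(\<Sum>t\<in>{s<..s+T}. contention (take t h)) = (\<Sum>v<n. \<Sum>t\<in>{s<..s+T}. attempt_prob (take t h) v)"
    unfolding contention_def by (rule sum.swap)
  also have "\<dots> \<le> (\<Sum>v<n. \<Sum>i=1..T. p i)" using one by (rule sum_mono)
  finally show ?thesis by simp
qed

text \<open>The total contention of the window limits the high slots, and fewer than
  \<open>M\<close> are mid, so \<open>N\<close> bounds both kinds together. At least
  \<open>T - N\<close> slots remain low, and in the worst case \<open>u\<close> has the ages
  \<open>{N<..T}\<close> there.\<close>

lemma missed_cases:
  assumes anti: "\<And>i j. 1 \<le> i \<Longrightarrow> i \<le> j \<Longrightarrow> p j \<le> p i"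
    and u: "u < n" and B: "1 \<le> B" and N: "n * (\<Sum>i=1..T. p i) / B + M \<le> real N"
    and nz: "hist_prob h \<noteq> 0" and miss: "missed A u T h"
  shows "M \<le> mid_count u T B h \<or>
    (unsuccessful u T h \<and> (\<Sum>i\<in>{N<..T}. p i) \<le> low_mass u T h)"
proof (cases "M \<le> mid_count u T B h")
  case False
  obtain s where s: "u \<in> A (take (Suc s) h)" "s + T < length h"
    and fail: "\<And>t. s < t \<Longrightarrow> t \<le> s + T \<Longrightarrow> h ! t \<noteq> {u}"
    using miss by (auto simp: missed_def)
  have win: "in_window u T (take t h) \<longleftrightarrow> t \<in> {s<..s+T}" if "t < length h" for t
  proof -
    have tk: "take (Suc r) (take t h) = take (Suc r) h" if "r < t" for r using that by (simp add: min_def)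
    have iw: "in_window u T (take t h) \<longleftrightarrow> (\<exists>r<t. u \<in> A (take (Suc r) h) \<and> t \<le> r + T)"
      using that tk by (auto simp: in_window_def simp del: take_take)
    show ?thesis
    proof
      assume "in_window u T (take t h)"
      then obtain r where r: "r < t" "u \<in> A (take (Suc r) h)" "t \<le> r + T"
        using iw by auto
      then have "r = s" using wake_unique[of r h s u] s that by auto
      then show "t \<in> {s<..s+T}" using r by auto
    next
      assume "t \<in> {s<..s+T}"
      then show "in_window u T (take t h)"
        unfolding iw using s by (intro exI[of _ s]) auto
    qed
  qed
  \<comment> \<open>\<open>missed\<close> excludes successes of \<open>u\<close> only inside the
    window; a success before the wake-up is excluded by
    \<open>hist_prob h \<noteq> 0\<close>.\<close>
  have nosucc: "{u} \<notin> set (take t h)" if t: "t \<in> {s<..s+T}" for t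
  proof
    assume "{u} \<in> set (take t h)"
    then obtain j where j: "j < t" "h ! j = {u}" using t s by (auto simp: in_set_conv_nth)
    have "attempt_prob (take j h) u \<noteq> 0"
      using step_prob_nz[OF nz, of j] step_prob_nz_attempt[of "take j h" "h ! j" u] j u t s by auto
    then obtain r where r: "r < j" "u \<in> A (take (Suc r) h)"
      using attempt_prob_not_woken[of "take j h" u] j t s by (auto simp: min_def)
    then have "r = s" using wake_unique[of r h s u] s j t by auto
    then show False using fail[of j] j r t by auto
  qed
  have q: "attempt_prob (take t h) u = p (t - s)" if t: "t \<in> {s<..s+T}" for t
  proof -
    have "attempt_prob (take t h) u = p (length (take t h) - s)"
      using t s nosucc[OF t] by (intro attempt_prob_woken) (auto simp: min_def)
    then show ?thesis using t s by simp
  qed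
  have uns: "unsuccessful u T h" using win fail by (auto simp: unsuccessful_def)
  define W where "W = {s<..s+T}"
  define mid where "mid = {t\<in>W. mid_slot u T B (take t h)}"
  define high where "high = {t\<in>W. B \<le> contention (take t h)}"
  define low where "low = {t\<in>W. low_slot u T (take t h)}"
  have "card W \<le> card (low \<union> (mid \<union> high))"
    using s win by (intro card_mono)
      (auto simp: W_def low_def mid_def high_def low_slot_def mid_slot_def)
  also have "\<dots> \<le> card low + (card mid + card high)"
    using card_Un_le[of low "mid \<union> high"] card_Un_le[of mid high] by linarith
  finally have cards: "T \<le> card low + (card mid + card high)" by (simp add: W_def)
  have "card mid \<le> mid_count u T B h"
    unfolding mid_count_def using s by (intro card_mono) (auto simp: mid_def W_def)
  then have mid: "card mid < M" using False by auto
  have "real (card high) * B = (\<Sum>t\<in>high. B)" by simp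
  also have "\<dots> \<le> (\<Sum>t\<in>high. contention (take t h))" by (rule sum_mono) (auto simp: high_def)
  also have "\<dots> \<le> (\<Sum>t\<in>W. contention (take t h))"
    using contention_nonneg by (intro sum_mono2) (auto simp: high_def W_def)
  also have "\<dots> \<le> n * (\<Sum>i=1..T. p i)" unfolding W_def using anti s(2) by (rule window_contention)
  finally have "real (card high) \<le> n * (\<Sum>i=1..T. p i) / B" using B by (simp add: field_simps)
  then have "real (card mid + card high) \<le> real N" using N mid by simp
  then have lowN: "T \<le> card low + N" using cards by linarith
  have "(\<Sum>i\<in>{N<..T}. p i) \<le> sum p ((\<lambda>t. t - s) ` low)"
  proof (rule sum_antimono_lower[OF anti p_nonneg])
    have "card ((\<lambda>t. t - s) ` low) = card low"
      by (intro card_image) (auto simp: inj_on_def low_def W_def)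
    then show "T \<le> card ((\<lambda>t. t - s) ` low) + N" using lowN by simp
  qed (auto simp: low_def W_def)
  also have "\<dots> = (\<Sum>t\<in>low. p (t - s))"
    by (subst sum.reindex) (auto simp: inj_on_def low_def W_def)
  also have "\<dots> = (\<Sum>t\<in>low. attempt_prob (take t h) u)"
    using q by (intro sum.cong) (auto simp: low_def W_def)
  also have "\<dots> \<le> low_mass u T h"
    unfolding low_mass_def
    using s attempt_prob_bounds by (subst sum.inter_filter[symmetric]) (auto intro!: sum_mono2 simp: low_def W_def)
  finally show ?thesis using uns by auto
qed simp

theorem missed_tail:
  fixes M N :: nat
  assumes "\<And>i j. 1 \<le> i \<Longrightarrow> i \<le> j \<Longrightarrow> p j \<le> p i" "\<And>i. p i \<le> 1/2"
    and "u < n" "1 \<le> B" "n * (\<Sum>i=1..T. p i) / B + M \<le> real N"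
  shows "mean t (\<lambda>h. of_bool (missed A u T h))
    \<le> exp (- exp (- 2) * (\<Sum>i\<in>{N<..T}. p i)) + exp (n - exp (- 2 * B) / 2 * M)"
proof -
  let ?L = "\<lambda>h. unsuccessful u T h \<and> (\<Sum>i\<in>{N<..T}. p i) \<le> low_mass u T h"
  have "mean t (\<lambda>h. of_bool (missed A u T h))
     \<le> mean t (\<lambda>h. of_bool (?L h) + of_bool (M \<le> mid_count u T B h))"
    using missed_cases[OF assms(1,3,4,5)] by (intro mean_mono) (auto simp: of_bool_def)
  also have "\<dots> \<le> exp (- exp (- 2) * (\<Sum>i\<in>{N<..T}. p i)) + exp (n - exp (- 2 * B) / 2 * M)"
    unfolding mean_add using low_mass_tail mid_count_tail assms by (intro add_mono) auto
  finally show ?thesis .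
qed

end

section \<open>Protocols with prescribed attempt probabilities, and the bound with high
  probability\<close>

lemma memoryless_protocol_exists:
  assumes p: "\<And>i. 0 \<le> p i" "\<And>i. p i \<le> 1"
  obtains D where "memoryless_protocol D" "\<And>i. 1 \<le> i \<Longrightarrow> bit_prob D i = p i"
proof -
  define M where "M i = measure_pmf (bernoulli_pmf (p i))" for i :: nat
  define D where "D = Pi\<^sub>M {1..} M"
  have pM: "prob_space (M i)" for i unfolding M_def by (rule prob_space_measure_pmf)
  interpret D: prob_space D unfolding D_def by (rule prob_space_PiM[OF pM])
  have sM: "sets (M i) = sets (count_space UNIV)" for i by (simp add: M_def)
  have s: "sets D = sets (Pi\<^sub>M {1..} (\<lambda>_. count_space UNIV))"
    unfolding D_def using sM by (intro sets_PiM_cong) auto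
  have comp: "distr D (count_space UNIV) (\<lambda>x. x i) = M i" if "i \<in> {1..}" for i
  proof -
    have "distr D (count_space UNIV) (\<lambda>x. x i) = distr D (M i) (\<lambda>x. x i)"
      using sM by (intro distr_cong) auto
    then show ?thesis unfolding D_def using distr_PiM_component[of "{1..}" M i] pM that by simp
  qed
  have meas: "(\<lambda>x. x i) \<in> measurable D (count_space UNIV)" if "i \<in> {1..}" for i
  proof -
    have "(\<lambda>x. x i) \<in> measurable (Pi\<^sub>M {1..} (\<lambda>_. count_space UNIV)) (count_space (UNIV :: bool set))"
      using that by (intro measurable_component_singleton) auto
    then show ?thesis unfolding measurable_cong_sets[OF s refl] .
  qed
  have "D.indep_vars (\<lambda>_. count_space UNIV) (\<lambda>i x. x i) {1..}"
  proof (subst D.indep_vars_iff_distr_eq_PiM')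
    have "distr D (Pi\<^sub>M {1..} (\<lambda>_. count_space UNIV)) (\<lambda>x. \<lambda>i\<in>{1..}. x i) = distr D D (\<lambda>x. x)"
      using s by (intro distr_cong) (auto simp: D_def space_PiM restrict_def PiE_def extensional_def)
    also have "\<dots> = D" by (rule distr_id)
    also have "\<dots> = Pi\<^sub>M {1..} (\<lambda>i. distr D (count_space UNIV) (\<lambda>x. x i))"
      unfolding D_def[symmetric] using comp unfolding D_def by (intro PiM_cong) (auto simp: D_def)
    finally show "distr D (Pi\<^sub>M {1..} (\<lambda>_. count_space UNIV)) (\<lambda>x. \<lambda>i\<in>{1..}. x i)
        = Pi\<^sub>M {1..} (\<lambda>i. distr D (count_space UNIV) (\<lambda>x. x i))" .
  qed (use meas in auto)
  then have "memoryless_protocol D"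
    unfolding memoryless_protocol_def using s D.prob_space_axioms by auto
  moreover have "bit_prob D i = p i" if "1 \<le> i" for i
  proof -
    have "measure D {x \<in> space D. x i} = measure (distr D (count_space UNIV) (\<lambda>x. x i)) {True}"
      using meas[of i] that by (subst measure_distr) (auto simp: vimage_def Int_def conj_commute)
    also have "\<dots> = p i" using comp[of i] that p by (simp add: M_def measure_pmf_single)
    finally show ?thesis using that by (simp add: bit_prob_def)
  qed
  ultimately show thesis by (rule that)
qed

lemma adaptive_tail:
  fixes M N :: nat
  assumes D: "memoryless_protocol D" and pD: "\<And>i. 1 \<le> i \<Longrightarrow> bit_prob D i = p i"
    and anti: "\<And>i j. 1 \<le> i \<Longrightarrow> i \<le> j \<Longrightarrow> p j \<le> p i" and half: "\<And>i. p i \<le> 1/2"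
    and A: "A \<in> adaptive_adversaries D n" and u: "u < n"
    and B: "1 \<le> B" and N: "n * (\<Sum>i=1..T. p i) / B + M \<le> real N"
  shows "measure (bits D n) {X \<in> space (bits D n). latency A X u > enat T}
    \<le> exp (- exp (- 2) * (\<Sum>i\<in>{N<..T}. p i)) + exp (n - exp (- 2 * B) / 2 * M)"
proof (rule adaptive_latency_tail[OF D A u])
  fix C t assume "memoryless_contention D n C"
  then interpret memoryless_contention D n C .
  have S: "(\<Sum>i=1..T. bit_prob D i) = (\<Sum>i=1..T. p i)"
    "(\<Sum>i\<in>{N<..T}. bit_prob D i) = (\<Sum>i\<in>{N<..T}. p i)"
    using pD by (auto intro!: sum.cong)
  have "mean t (\<lambda>h. of_bool (missed C u T h))
    \<le> exp (- exp (- 2) * (\<Sum>i\<in>{N<..T}. bit_prob D i)) + exp (n - exp (- 2 * B) / 2 * M)"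
  proof (rule missed_tail)
    show "bit_prob D i \<le> 1/2" for i
      using half[of i] pD[of i] by (cases "i = 0") (auto simp: bit_prob_def)
    show "bit_prob D j \<le> bit_prob D i" if "1 \<le> i" "i \<le> j" for i j
      using anti[OF that] pD that by simp
  qed (use u B N S in auto)
  then show "mean t (\<lambda>h. of_bool (missed C u T h))
    \<le> exp (- exp (- 2) * (\<Sum>i\<in>{N<..T}. p i)) + exp (n - exp (- 2 * B) / 2 * M)"
    unfolding S .
qed

lemma finite_adaptive: "A \<in> adaptive_adversaries D n \<Longrightarrow> finite (A h)"
  by (auto simp: adaptive_adversaries_def wake_next_def)

lemma latency_whp_le:
  assumes D: "memoryless_protocol D" and Adv: "\<And>A h. A \<in> Adv \<Longrightarrow> finite (A h)"
    and tail: "\<And>A u. A \<in> Adv \<Longrightarrow> u < n \<Longrightarrow>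
      measure (bits D n) {X \<in> space (bits D n). latency A X u > enat T} \<le> 1 / real n ^ 2"
  shows "latency_whp D Adv n \<le> enat T"
  unfolding latency_whp_def latency_quantile_def
proof (intro Least_le ballI allI impI)
  fix A u assume A: "A \<in> Adv" and u: "u < n"
  interpret prob_space "bits D n" by (rule prob_space_bits[OF D])
  have "{X \<in> space (bits D n). latency A X u > enat T} \<in> sets (bits D n)"
    using latency_measurable[OF D Adv[OF A], where u=u and n=n] by measurable
  from prob_compl[OF this] have
    "prob (space (bits D n) - {X \<in> space (bits D n). latency A X u > enat T})
      = 1 - prob {X \<in> space (bits D n). latency A X u > enat T}" .
  moreover have "space (bits D n) - {X \<in> space (bits D n). latency A X u > enat T}
      = {X \<in> space (bits D n). latency A X u \<le> enat T}" by auto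
  ultimately show "1 - 1 / real n ^ 2 \<le> prob {X \<in> space (bits D n). latency A X u \<le> enat T}"
    using tail[OF A u] by simp
qed

lemma ext_bigoI:
  assumes "eventually (\<lambda>n. f n \<le> ennreal (c * g n)) sequentially" "eventually (\<lambda>n. 0 \<le> g n) sequentially" "0 \<le> c"
  shows "ext_bigo f g"
  unfolding ext_bigo_def
proof
  show "\<forall>\<^sub>F n in sequentially. f n < top"
    using assms(1) by eventually_elim (auto simp: le_less_trans ennreal_less_top)
  show "(\<lambda>n. enn2real (f n)) \<in> O(g)"
  proof (rule bigoI)
    show "\<forall>\<^sub>F n in sequentially. norm (enn2real (f n)) \<le> c * norm (g n)"
      using assms(1,2)
    proof eventually_elim
      case (elim n)
      have "enn2real (f n) \<le> enn2real (ennreal (c * g n))" using elim by (intro enn2real_mono) auto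
      then show ?case using elim assms(3) by simp
    qed
  qed
qed

text \<open>Comparison with the integral: each term is below a difference of logarithms, by
  \<open>ln z \<le> z - 1\<close>.\<close>

lemma harmonic_upper:
  fixes c :: real assumes "0 < c" "N \<le> T"
  shows "(\<Sum>i\<in>{N<..T}. 1 / (real i + c)) \<le> ln (T + c) - ln (N + c)"
  using assms(2)
proof (induction T rule: dec_induct)
  case (step T)
  have "ln (T + c) - ln (real (Suc T) + c) = ln ((T + c) / (real (Suc T) + c))"
    using assms by (subst ln_divide_pos) auto
  also have "\<dots> \<le> (T + c) / (real (Suc T) + c) - 1"
    using assms by (intro ln_le_minus_one divide_pos_pos) auto
  also have "\<dots> = - (1 / (real (Suc T) + c))" using assms by (simp add: field_simps)
  finally have "1 / (real (Suc T) + c) \<le> ln (real (Suc T) + c) - ln (T + c)" by simp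
  moreover have "{N<..Suc T} = insert (Suc T) {N<..T}" using step by auto
  ultimately show ?case using step by simp
qed simp

lemma harmonic_lower:
  fixes c :: real assumes "0 < c"
  shows "ln (T + c + 1) - ln (N + c + 1) \<le> (\<Sum>i\<in>{N<..T}. 1 / (real i + c))"
proof (cases "N \<le> T")
  case True
  then show ?thesis
  proof (induction T rule: dec_induct)
    case (step T)
    have "ln (real (Suc T) + c + 1) - ln (T + c + 1) = ln ((real (Suc T) + c + 1) / (T + c + 1))"
      using assms by (subst ln_divide_pos) auto
    also have "\<dots> \<le> (real (Suc T) + c + 1) / (T + c + 1) - 1"
      using assms by (intro ln_le_minus_one divide_pos_pos) auto
    also have "\<dots> = 1 / (real (Suc T) + c)" using assms by (simp add: field_simps)
    finally have "ln (real (Suc T) + c + 1) - ln (T + c + 1) \<le> 1 / (real (Suc T) + c)" .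
    moreover have "{N<..Suc T} = insert (Suc T) {N<..T}" using step by auto
    ultimately show ?case using step by simp
  qed simp
next
  case False
  then have "ln (T + c + 1) \<le> ln (N + c + 1)" using assms by (subst ln_le_cancel_iff) auto
  then show ?thesis using False by simp
qed

lemma exp_2_less_9: "exp 2 \<le> (9 :: real)"
proof -
  have "exp (2::real) = exp 1 * exp 1" by (simp add: exp_add[symmetric])
  also have "\<dots> \<le> 3 * 3" using exp_le by (intro mult_mono) auto
  finally show ?thesis by simp
qed

theorem whp_upper:
  "\<exists>D. memoryless_protocol D \<and>
     ext_bigo (\<lambda>n. ennreal_of_enat (latency_whp D (adaptive_adversaries D n) n))
       (\<lambda>n. real n * ln (real n) ^ 2 / ln (ln (real n)))"
proof -
  \<comment> \<open>The shift 3000 makes \<open>p\<close> decreasing and at most 1/2. The factor 120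
    gives the ages in \<open>{N<..T}\<close> mass at least \<open>30 * ln n\<close>, still above
    \<open>3 * ln n\<close> after the factor \<open>exp (- 2) \<ge> 1/9\<close>.\<close>
  define p where "p i = 120 * (ln (real i + 3000) / (real i + 3000))" for i :: nat
  have lnx: "ln y / y \<le> ln x / x" if "3 \<le> x" "x \<le> y" for x y :: real
    using that exp_le by (intro ln_x_over_x_mono) auto
  have ln3000: "ln (3000::real) \<le> 10"
  proof -
    have "(3000::real) \<le> 2 ^ 13" by simp
    also have "\<dots> \<le> exp 10"
    proof -
      have "(2::real) ^ 13 \<le> (5/2) ^ 10" by (simp add: field_simps)
      also have "\<dots> \<le> (exp 1) ^ 10"
        using exp_lower_Taylor_quadratic[of "1::real"] by (intro power_mono) auto
      also have "\<dots> = exp 10" by (simp add: exp_of_nat_mult[symmetric])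
      finally show ?thesis .
    qed
    finally show ?thesis using ln_le_cancel_iff[of 3000 "exp 10"] by simp
  qed
  have half: "p i \<le> 1/2" for i
  proof -
    have "p i \<le> 120 * (ln 3000 / 3000)"
      unfolding p_def using lnx[of 3000 "real i + 3000"] by (intro mult_left_mono) auto
    also have "\<dots> \<le> 1/2" using ln3000 by simp
    finally show ?thesis .
  qed
  have nonneg: "0 \<le> p i" for i by (simp add: p_def)
  have anti: "p j \<le> p i" if "i \<le> j" for i j
    using lnx[of "real i + 3000" "real j + 3000"] that by (simp add: p_def)
  have "p i \<le> 1" for i using half[of i] by simp
  then obtain D where D: "memoryless_protocol D" "\<And>i. 1 \<le> i \<Longrightarrow> bit_prob D i = p i"
    using memoryless_protocol_exists[of p] nonneg by blast
  define f where "f n = real n * ln (real n) ^ 2 / ln (ln (real n))" for n :: nat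
  \<comment> \<open>There are at most \<open>3840 * f n\<close> high slots, 24/100 of a window of
    this length; with the quarter allowed for mid slots this stays below the half that
    \<open>N\<close> stands for.\<close>
  define a :: real where "a = 16000"
  have ev: "eventually (\<lambda>n. 3 \<le> n) sequentially"
    "eventually (\<lambda>n. 1 \<le> ln (ln (real n)) / 8) sequentially"
    "eventually (\<lambda>n. ln (a * f n + 3001) \<le> 2 * ln (real n)) sequentially"
    "eventually (\<lambda>n. real n \<le> a * f n) sequentially"
    "eventually (\<lambda>n. 3000 \<le> a * f n) sequentially"
    "eventually (\<lambda>n. 1 \<le> f n) sequentially"
    "eventually (\<lambda>n. real n - ln (real n) powr (- 1/4) / 2 * (a / 4 * f n - 1) \<le> - (3 * ln (real n))) sequentially"
    unfolding f_def a_def by real_asymp+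
  have "eventually (\<lambda>n. ennreal_of_enat (latency_whp D (adaptive_adversaries D n) n) \<le> ennreal ((a + 1) * f n)) sequentially"
    using ev
  proof eventually_elim
    case (elim n)
    define T where "T = nat \<lceil>a * f n\<rceil>"
    define N where "N = T div 2"
    define M where "M = T div 4"
    \<comment> \<open>Now \<open>exp (- 2 * B)\<close> equals \<open>ln n powr (- 1/4)\<close>. The
      window exceeds \<open>n\<close> by a factor of order \<open>ln n ^ 2 / ln (ln n)\<close>, so
      even after this loss \<open>M\<close> mid slots would be expected to force more than
      \<open>n\<close> successes.\<close>
    define B where "B = ln (ln (real n)) / 8"
    have T: "a * f n \<le> T" "T \<le> a * f n + 1" using elim by (auto simp: T_def)
    have lnn: "0 < ln (real n)" using elim by simp
    have B: "1 \<le> B" using elim by (simp add: B_def)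
    have n0: "0 < real n" using elim by simp
    have f1: "0 \<le> f n" using elim(5) unfolding a_def by simp
    have lnT: "ln (real T + 3000) \<le> 2 * ln n"
    proof -
      have "ln (real T + 3000) \<le> ln (a * f n + 3001)" using T by (intro ln_mono) auto
      then show ?thesis using elim by linarith
    qed
    have "(\<Sum>i=1..T. p i) \<le> (\<Sum>i\<in>{0<..T}. 120 * ln (real T + 3000) * (1 / (real i + 3000)))"
    proof -
      have eq: "{1..T} = {0<..T}" by auto
      show ?thesis unfolding p_def eq
        by (intro sum_mono) (auto intro!: divide_right_mono)
    qed
    also have "\<dots> = 120 * ln (real T + 3000) * (\<Sum>i\<in>{0<..T}. 1 / (real i + 3000))"
      by (simp add: sum_distrib_left)
    also have "\<dots> \<le> 120 * ln (real T + 3000) * ln (real T + 3000)"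
    proof (rule mult_left_mono)
      have "0 \<le> ln (3000::real)" by (rule ln_ge_zero) simp
      then show "(\<Sum>i\<in>{0<..T}. 1 / (real i + 3000)) \<le> ln (real T + 3000)"
        using harmonic_upper[of 3000 0 T] by (simp only: of_nat_0 add_0) linarith
    qed simp
    also have "\<dots> = 120 * ln (real T + 3000) ^ 2" by (simp add: power2_eq_square)
    also have "\<dots> \<le> 120 * (2 * ln n) ^ 2" using lnT by (intro mult_left_mono power_mono) auto
    finally have S: "(\<Sum>i=1..T. p i) \<le> 480 * ln n ^ 2" by (simp add: power_mult_distrib)
    have "n * (\<Sum>i=1..T. p i) / B \<le> n * (480 * ln n ^ 2) / B"
      using S B by (intro divide_right_mono mult_left_mono) auto
    also have "\<dots> = 3840 * f n" by (simp add: B_def f_def)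
    also have "\<dots> \<le> 24/100 * T" using T by (simp add: a_def)
    finally have "n * (\<Sum>i=1..T. p i) / B + M \<le> 24/100 * T + T / 4"
      unfolding M_def by linarith
    also have "\<dots> \<le> T / 2 - 1" using T elim by simp
    also have "\<dots> \<le> N" unfolding N_def by linarith
    finally have N: "n * (\<Sum>i=1..T. p i) / B + M \<le> N" .
    have first: "exp (- exp (- 2) * (\<Sum>i\<in>{N<..T}. p i)) \<le> exp (- (3 * ln n))"
    proof -
      have "T / 2 * (120 * (ln n / (2 * T))) \<le> real (T - N) * p T"
      proof (rule mult_mono)
        show "T / 2 \<le> real (T - N)" unfolding N_def by linarith
        have "ln n / (2 * T) \<le> ln (real T + 3000) / (real T + 3000)"
          using T elim lnn by (intro frac_le) auto
        then show "120 * (ln n / (2 * T)) \<le> p T" by (simp add: p_def)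
      qed (use lnn in auto)
      also have "\<dots> = (\<Sum>i\<in>{N<..T}. p T)" by simp
      also have "\<dots> \<le> (\<Sum>i\<in>{N<..T}. p i)" using anti by (intro sum_mono) auto
      finally have "30 * ln n \<le> (\<Sum>i\<in>{N<..T}. p i)" using T elim by simp
      then have "1/9 * (30 * ln n) \<le> exp (- 2) * (\<Sum>i\<in>{N<..T}. p i)"
        using exp_2_less_9 lnn by (intro mult_mono) (auto simp: exp_minus field_simps)
      then show ?thesis using lnn by simp
    qed
    have second: "exp (n - exp (- 2 * B) / 2 * M) \<le> exp (- (3 * ln n))"
    proof -
      have e: "exp (- 2 * B) = ln n powr (- 1/4)" using lnn by (simp add: B_def powr_def)
      have "a / 4 * f n - 1 \<le> T / 4 - 1" using T by simp
      also have "\<dots> \<le> M" unfolding M_def by linarith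
      finally have "ln n powr (- 1/4) / 2 * (a / 4 * f n - 1) \<le> ln n powr (- 1/4) / 2 * M"
        by (intro mult_left_mono) auto
      then have "n - ln n powr (- 1/4) / 2 * M \<le> - (3 * ln n)" using elim by linarith
      then show ?thesis unfolding e by simp
    qed
    have "latency_whp D (adaptive_adversaries D n) n \<le> enat T"
    proof (rule latency_whp_le[OF D(1)])
      show "finite (A h)" if "A \<in> adaptive_adversaries D n" for A h using that by (rule finite_adaptive)
      fix A u assume "A \<in> adaptive_adversaries D n" "u < n"
      then have "measure (bits D n) {X \<in> space (bits D n). latency A X u > enat T}
        \<le> exp (- exp (- 2) * (\<Sum>i\<in>{N<..T}. p i)) + exp (n - exp (- 2 * B) / 2 * M)"
        using anti half N elim by (intro adaptive_tail[OF D]) (auto simp: B_def)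
      also have "\<dots> \<le> exp (- (3 * ln n)) + exp (- (3 * ln n))" using first second by (rule add_mono)
      also have "\<dots> = 2 / n ^ 3"
      proof -
        have "exp (3 * ln n) = real n ^ 3" using n0 by (simp add: exp_of_nat_mult[of 3, simplified])
        then show ?thesis by (simp add: exp_minus field_simps)
      qed
      also have "\<dots> \<le> 1 / n ^ 2" using elim by (simp add: field_simps power3_eq_cube power2_eq_square)
      finally show "measure (bits D n) {X \<in> space (bits D n). latency A X u > enat T} \<le> 1 / real n ^ 2" by simp
    qed
    then have "ennreal_of_enat (latency_whp D (adaptive_adversaries D n) n) \<le> ennreal_of_enat (enat T)"
      by (simp only: ennreal_of_enat_le_iff)
    also have "\<dots> = ennreal T" by (simp add: ennreal_of_nat_eq_real_of_nat)
    also have "\<dots> \<le> ennreal ((a + 1) * f n)"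
    proof (rule ennreal_leI)
      show "T \<le> (a + 1) * f n" using elim T by (simp add: algebra_simps)
    qed
    finally show ?case .
  qed
  moreover have "eventually (\<lambda>n. 0 \<le> f n) sequentially" unfolding f_def by real_asymp
  ultimately have "ext_bigo (\<lambda>n. ennreal_of_enat (latency_whp D (adaptive_adversaries D n) n)) f"
    by (rule ext_bigoI) (simp add: a_def)
  then show ?thesis using D(1) unfolding f_def by blast
qed

section \<open>The bound in expectation\<close>

lemma sum_inverse_square_tail:
  fixes K :: nat and c :: real
  assumes K: "1 \<le> K" and c: "0 \<le> c" and a: "\<And>T. a T \<le> 1" "\<And>T. K \<le> T \<Longrightarrow> a T \<le> c / real T ^ 2"
  shows "(\<Sum>T<m. a T) \<le> K + 2 * c / K"
proof -
  \<comment> \<open>Beyond \<open>K\<close> the bound telescopes through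
    \<open>1 / m ^ 2 \<le> 2 * (1 / m - 1 / (m + 1))\<close>; \<open>min\<close> and
    \<open>max\<close> let one induction cover both ranges.\<close>
  have "(\<Sum>T<m. a T) \<le> min m K + 2 * c * (1 / K - 1 / max m K)"
  proof (induction m)
    case 0
    show ?case using K by simp
  next
    case (Suc m)
    show ?case
    proof (cases "m < K")
      case True
      then show ?thesis using Suc a(1)[of m] by (simp add: max_def min_def)
    next
      case False
      have m: "0 < real m" using False K by simp
      have "a m \<le> c * (1 / real m ^ 2)" using a(2)[of m] False by simp
      also have "\<dots> \<le> c * (2 * (1 / real m - 1 / real (Suc m)))"
      proof (rule mult_left_mono[OF _ c])
        have "1 \<le> real m" using False K by simp
        then show "1 / real m ^ 2 \<le> 2 * (1 / real m - 1 / real (Suc m))"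
          using m by (simp add: divide_simps power2_eq_square)
      qed
      finally have "a m \<le> 2 * c * (1 / real m - 1 / real (Suc m))" by (simp add: algebra_simps)
      moreover have "min m K = K" "max m K = m" "min (Suc m) K = K" "max (Suc m) K = Suc m"
        using False by auto
      ultimately show ?thesis using Suc by (simp add: algebra_simps)
    qed
  qed
  also have "\<dots> \<le> K + 2 * c * (1 / K)"
  proof -
    have "2 * c * (1 / K - 1 / max m K) \<le> 2 * c * (1 / K)" using c by (intro mult_left_mono) auto
    then show ?thesis by (simp add: of_nat_min)
  qed
  finally show ?thesis by simp
qed

text \<open>The expectation of a value in \<open>enat\<close> is the sum of its tail probabilities;
  the first \<open>K\<close> of them are bounded by 1.\<close>

lemma latency_exp_le:
  fixes K :: nat and c :: real
  assumes D: "memoryless_protocol D" and Adv: "\<And>A h. A \<in> Adv \<Longrightarrow> finite (A h)"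
    and K: "1 \<le> K" and c: "0 \<le> c"
    and tail: "\<And>A u T. A \<in> Adv \<Longrightarrow> u < n \<Longrightarrow> K \<le> T \<Longrightarrow>
      measure (bits D n) {X \<in> space (bits D n). latency A X u > enat T} \<le> c / real T ^ 2"
  shows "latency_exp D Adv n \<le> ennreal (K + 2 * c / K)"
  unfolding latency_exp_def
proof (intro SUP_least)
  fix A u assume A: "A \<in> Adv" and u: "u \<in> {..<n}"
  interpret prob_space "bits D n" by (rule prob_space_bits[OF D])
  define a where "a T = prob {X \<in> space (bits D n). latency A X u > enat T}" for T
  have "(\<integral>\<^sup>+ X. ennreal_of_enat (latency A X u) \<partial>bits D n)
      = (\<Sum>T. emeasure (bits D n) {X \<in> space (bits D n). latency A X u > enat T})"
    using latency_measurable[OF D Adv[OF A], where u=u and n=n]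
    by (subst nn_integral_enat_function) auto
  also have "\<dots> = (\<Sum>T. ennreal (a T))" by (simp add: a_def emeasure_eq_measure)
  also have "\<dots> \<le> ennreal (K + 2 * c / K)"
  proof (rule suminf_le_const)
    fix m
    have "(\<Sum>T<m. ennreal (a T)) = ennreal (\<Sum>T<m. a T)"
      by (rule sum_ennreal) (simp add: a_def)
    also have "\<dots> \<le> ennreal (K + 2 * c / K)"
      using tail[OF A] u by (intro ennreal_leI sum_inverse_square_tail K c) (auto simp: a_def)
    finally show "(\<Sum>T<m. ennreal (a T)) \<le> ennreal (K + 2 * c / K)" .
  qed auto
  finally show "(\<integral>\<^sup>+ X. ennreal_of_enat (latency A X u) \<partial>bits D n) \<le> ennreal (K + 2 * c / K)" .
qed

text \<open>For a window of \<open>y\<close> times the scale \<open>L\<close>, the high slots and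
  the allowance for mid slots together take order \<open>L * sqrt y\<close>, because
  \<open>ln y \<le> 2 * sqrt y\<close>. So \<open>N / T\<close> is of order
  \<open>1 / sqrt y\<close>, and since \<open>36 * exp (- 2) \<ge> 4\<close> the mass of
  \<open>{N<..T}\<close> turns this ratio into its fourth power, a summable
  \<open>1 / y ^ 2\<close>.\<close>

lemma exp_upper_mass:
  fixes T :: nat and L y :: real
  defines "p \<equiv> \<lambda>i. 36 / (real i + 72)"
  assumes y: "1 \<le> y" "T = L * y" and L: "1 \<le> L" "ln L + 3 \<le> 2 * ln n" and n: "0 < n" "L = n * ln n / lln" "0 < lln"
    and N: "N = nat \<lceil>577 * L * sqrt y\<rceil>"
  shows "n * (\<Sum>i=1..T. p i) / (lln / 8) + L * sqrt y \<le> N"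
    and "exp (- exp (- 2) * (\<Sum>i\<in>{N<..T}. p i)) \<le> 700 ^ 4 / y ^ 2"
proof -
  have sq: "1 \<le> sqrt y" using y by simp
  have T0: "0 < T" using y L by (metis less_le_trans mult_pos_pos of_nat_0_less_iff zero_less_one)
  have lnT: "ln T \<le> ln L + 2 * sqrt y"
  proof -
    have "ln T = ln L + ln y" using y L by (simp add: ln_mult)
    also have "ln y = 2 * ln (sqrt y)" using y by (simp add: ln_sqrt)
    also have "ln (sqrt y) \<le> sqrt y" using ln_le_minus_one[of "sqrt y"] sq by linarith
    finally show ?thesis by simp
  qed
  have "(\<Sum>i=1..T. p i) = 36 * (\<Sum>i\<in>{0<..T}. 1 / (real i + 72))"
  proof -
    have "{1..T} = {0<..T}" by auto
    then show ?thesis by (simp add: p_def sum_distrib_left)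
  qed
  also have "\<dots> \<le> 36 * (ln (real T + 72) - ln 72)"
    using harmonic_upper[of 72 0 T] by simp
  finally have S1: "(\<Sum>i=1..T. p i) \<le> 36 * (ln (real T + 72) - ln 72)" .
  have "ln (real T + 72) - ln 72 = ln ((real T + 72) / 72)"
    by (subst ln_divide_pos) auto
  also have "\<dots> \<le> ln (real T * exp 1)"
  proof (rule ln_mono)
    have "(real T + 72) / 72 \<le> real T * 2" using T0 by (simp add: field_simps)
    also have "\<dots> \<le> real T * exp 1"
      using exp_ge_add_one_self[of "1::real"] by (intro mult_left_mono) auto
    finally show "(real T + 72) / 72 \<le> real T * exp 1" .
  qed simp
  also have "\<dots> = ln T + 1" using T0 by (simp add: ln_mult)
  also have "\<dots> \<le> (ln L + 3) * sqrt y"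
  proof -
    have "0 \<le> ln L" using L by simp
    then have "(ln L + 1) * 1 \<le> (ln L + 1) * sqrt y" using sq by (intro mult_left_mono) auto
    then show ?thesis using lnT by (simp add: algebra_simps)
  qed
  also have "\<dots> \<le> 2 * ln n * sqrt y" using L sq by (intro mult_right_mono) auto
  finally have S: "(\<Sum>i=1..T. p i) \<le> 72 * ln n * sqrt y" using S1 by (simp add: algebra_simps)
  have "n * (\<Sum>i=1..T. p i) / (lln / 8) \<le> n * (72 * ln n * sqrt y) / (lln / 8)"
    using S n by (intro divide_right_mono mult_left_mono) auto
  also have "\<dots> = 576 * L * sqrt y" using n by simp
  finally show "n * (\<Sum>i=1..T. p i) / (lln / 8) + L * sqrt y \<le> N"
    unfolding N by linarith
  have Lsq: "1 \<le> L * sqrt y" using mult_mono[OF L(1) sq] L by simp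
  have N0: "577 * L * sqrt y \<ge> 0" using L sq by simp
  have N1: "real N + 73 \<le> 700 * (L * sqrt y)"
    unfolding N using N0 Lsq by simp linarith
  have "(\<Sum>i\<in>{N<..T}. p i) = 36 * (\<Sum>i\<in>{N<..T}. 1 / (real i + 72))"
    by (simp add: p_def sum_distrib_left)
  also have "\<dots> \<ge> 36 * (ln (real T + 73) - ln (real N + 73))"
    using harmonic_lower[of 72 T N] by (simp add: add.assoc)
  finally have sumge: "36 * (ln (real T + 73) - ln (real N + 73)) \<le> (\<Sum>i\<in>{N<..T}. p i)" .
  have nonneg: "0 \<le> (\<Sum>i\<in>{N<..T}. p i)" by (intro sum_nonneg) (simp add: p_def)
  have e2: "1/9 \<le> exp (- 2 :: real)" using exp_2_less_9 by (simp add: exp_minus field_simps)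
  have "4 * (ln (real T + 73) - ln (real N + 73)) \<le> 1/9 * (\<Sum>i\<in>{N<..T}. p i)" using sumge by simp
  also have "\<dots> \<le> exp (- 2) * (\<Sum>i\<in>{N<..T}. p i)" using e2 nonneg by (rule mult_right_mono)
  finally have "exp (- exp (- 2) * (\<Sum>i\<in>{N<..T}. p i)) \<le> exp (4 * (ln (real N + 73) - ln (real T + 73)))" by simp
  also have "\<dots> = exp (ln (real N + 73) - ln (real T + 73)) ^ 4"
    using exp_of_nat_mult[of 4 "ln (real N + 73) - ln (real T + 73)"] by (simp add: algebra_simps)
  also have "exp (ln (real N + 73) - ln (real T + 73)) = (real N + 73) / (real T + 73)"
    by (simp add: exp_diff)
  also have "((real N + 73) / (real T + 73)) ^ 4 \<le> (700 / sqrt y) ^ 4"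
  proof (rule power_mono)
    have "(real N + 73) / (real T + 73) \<le> 700 * (L * sqrt y) / T"
      using N1 T0 by (intro frac_le) auto
    also have "\<dots> = 700 * (sqrt y / y)" using y L by simp
    also have "sqrt y / y = 1 / sqrt y" using y by (simp add: real_div_sqrt field_simps)
    finally show "(real N + 73) / (real T + 73) \<le> 700 / sqrt y" by simp
  qed simp
  also have "\<dots> = 700 ^ 4 / y ^ 2"
  proof -
    have "sqrt y ^ 4 = (sqrt y ^ 2) ^ 2" using power_mult[of "sqrt y" 2 2] by simp
    then show ?thesis using y by (simp add: power_divide)
  qed
  finally show "exp (- exp (- 2) * (\<Sum>i\<in>{N<..T}. p i)) \<le> 700 ^ 4 / y ^ 2" .
qed

theorem exp_upper:
  "\<exists>D. memoryless_protocol D \<and>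
     ext_bigo (\<lambda>n. latency_exp D (adaptive_adversaries D n) n)
       (\<lambda>n. real n * ln (real n) / ln (ln (real n)))"
proof -
  \<comment> \<open>Here 36 is 4 times the bound 9 on \<open>exp 2\<close>, and 72 is twice 36,
    which keeps \<open>p\<close> at most 1/2.\<close>
  define p where "p i = 36 / (real i + 72)" for i :: nat
  have half: "p i \<le> 1/2" for i by (simp add: p_def field_simps)
  have nonneg: "0 \<le> p i" for i by (simp add: p_def)
  have anti: "p j \<le> p i" if "i \<le> j" for i j
    using that unfolding p_def by (intro divide_left_mono) auto
  have "p i \<le> 1" for i using half[of i] by simp
  then obtain D where D: "memoryless_protocol D" "\<And>i. 1 \<le> i \<Longrightarrow> bit_prob D i = p i"
    using memoryless_protocol_exists[of p] nonneg by blast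
  define f where "f n = real n * ln (real n) / ln (ln (real n))" for n :: nat
  \<comment> \<open>One summand for each of the two error terms of \<open>adaptive_tail\<close>,
    both bounded by a multiple of \<open>1 / y ^ 2\<close>.\<close>
  define C :: real where "C = 700 ^ 4 + 1"
  have ev: "eventually (\<lambda>n. 3 \<le> n) sequentially"
    "eventually (\<lambda>n. 1 \<le> ln (ln (real n)) / 8) sequentially"
    "eventually (\<lambda>n. ln (f n) + 3 \<le> 2 * ln (real n)) sequentially"
    "eventually (\<lambda>n. 2 \<le> f n) sequentially"
    "eventually (\<lambda>n. 5 * real n \<le> ln (real n) powr (- 1/4) / 4 * f n) sequentially"
    unfolding f_def by real_asymp+
  have "eventually (\<lambda>n. latency_exp D (adaptive_adversaries D n) n \<le> ennreal ((2 + 2 * C) * f n)) sequentially"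
    using ev
  proof eventually_elim
    case (elim n)
    define B where "B = ln (ln (real n)) / 8"
    define L where "L = f n"
    define K where "K = nat \<lceil>L\<rceil>"
    have lnn: "0 < ln (real n)" using elim by simp
    have L: "2 \<le> L" using elim by (simp add: L_def)
    have K: "L \<le> K" "K \<le> L + 1" using L by (auto simp: K_def)
    have "latency_exp D (adaptive_adversaries D n) n \<le> ennreal (K + 2 * (C * L ^ 2) / K)"
    proof (rule latency_exp_le[OF D(1)])
      show "finite (A h)" if "A \<in> adaptive_adversaries D n" for A h using that by (rule finite_adaptive)
      show "1 \<le> K" using K L by linarith
      show "0 \<le> C * L ^ 2" by (simp add: C_def)
      fix A u T assume Au: "A \<in> adaptive_adversaries D n" "u < n" "K \<le> T"
      define y where "y = T / L"
      have y: "1 \<le> y" "T = L * y" using Au K L by (auto simp: y_def)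
      \<comment> \<open>An allowance growing with \<open>sqrt y\<close> makes the error term of the
        mid slots at most \<open>exp (- 4 * sqrt y) \<le> 1 / y ^ 2\<close>, for all windows at
        once.\<close>
      define M where "M = nat \<lfloor>L * sqrt y\<rfloor>"
      define N where "N = nat \<lceil>577 * L * sqrt y\<rceil>"
      have Lsq: "2 \<le> L * sqrt y" using mult_mono[of 2 L 1 "sqrt y"] y L by simp
      have M: "real M \<le> L * sqrt y" "L * sqrt y - 1 \<le> real M" using Lsq by (auto simp: M_def)
      have mass: "n * (\<Sum>i=1..T. p i) / B + L * sqrt y \<le> N"
        "exp (- exp (- 2) * (\<Sum>i\<in>{N<..T}. p i)) \<le> 700 ^ 4 / y ^ 2"
      proof -
        have "0 < ln (ln (real n))" using elim(2) by linarith
        moreover have "1 \<le> L" using L by simp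
        moreover have "ln L + 3 \<le> 2 * ln n" "L = n * ln n / ln (ln n)" "0 < real n"
          using elim(1,3) by (simp_all add: L_def f_def)
        ultimately have *: "n * (\<Sum>i=1..T. 36 / (real i + 72)) / (ln (ln n) / 8) + L * sqrt y \<le> N"
          "exp (- exp (- 2) * (\<Sum>i\<in>{N<..T}. 36 / (real i + 72))) \<le> 700 ^ 4 / y ^ 2"
          using exp_upper_mass[of y T L "real n" "ln (ln (real n))" N] y N_def by blast+
        show "n * (\<Sum>i=1..T. p i) / B + L * sqrt y \<le> N" using *(1) unfolding p_def B_def .
        show "exp (- exp (- 2) * (\<Sum>i\<in>{N<..T}. p i)) \<le> 700 ^ 4 / y ^ 2" using *(2) unfolding p_def .
      qed
      have "measure (bits D n) {X \<in> space (bits D n). latency A X u > enat T}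
        \<le> exp (- exp (- 2) * (\<Sum>i\<in>{N<..T}. p i)) + exp (n - exp (- 2 * B) / 2 * M)"
        using anti half mass(1) M elim Au by (intro adaptive_tail[OF D]) (auto simp: B_def)
      also have "exp (n - exp (- 2 * B) / 2 * M) \<le> 1 / y ^ 2"
      proof -
        have e: "exp (- 2 * B) = ln n powr (- 1/4)" using lnn by (simp add: B_def powr_def)
        define z where "z = ln n powr (- 1/4)"
        have z: "0 \<le> z" by (simp add: z_def)
        have sq: "1 \<le> sqrt y" using y by simp
        have "5 * real n * sqrt y \<le> z / 4 * L * sqrt y"
          using elim sq by (intro mult_right_mono) (auto simp: z_def L_def)
        also have "\<dots> = z / 2 * (L * sqrt y / 2)" by simp
        also have "\<dots> \<le> z / 2 * M" using z M Lsq by (intro mult_left_mono) auto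
        finally have "n - z / 2 * M \<le> n - 5 * real n * sqrt y" by simp
        also have "\<dots> \<le> - (4 * sqrt y)"
        proof -
          have "real n * 1 \<le> real n * sqrt y" using sq by (intro mult_left_mono) auto
          moreover have "1 * sqrt y \<le> real n * sqrt y" using sq elim by (intro mult_right_mono) auto
          ultimately show ?thesis by simp
        qed
        finally have "exp (n - exp (- 2 * B) / 2 * M) \<le> exp (- (4 * sqrt y))"
          unfolding e z_def[symmetric] by simp
        also have "\<dots> = 1 / exp (sqrt y) ^ 4"
          by (simp add: exp_minus exp_of_nat_mult[of 4, simplified] divide_inverse)
        also have "\<dots> \<le> 1 / sqrt y ^ 4"
        proof -
          have "sqrt y \<le> exp (sqrt y)" using exp_ge_add_one_self[of "sqrt y"] by linarith
          then show ?thesis using y sq by (intro divide_left_mono power_mono) auto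
        qed
        also have "sqrt y ^ 4 = (sqrt y ^ 2) ^ 2" using power_mult[of "sqrt y" 2 2] by simp
        also have "\<dots> = y ^ 2" using y by simp
        finally show ?thesis .
      qed
      also have "exp (- exp (- 2) * (\<Sum>i\<in>{N<..T}. p i)) + 1 / y ^ 2 \<le> C / y ^ 2"
        using mass(2) by (simp add: C_def add_divide_distrib)
      also have "C / y ^ 2 = C * L ^ 2 / real T ^ 2"
        using L by (simp add: y_def power_divide)
      finally show "measure (bits D n) {X \<in> space (bits D n). latency A X u > enat T} \<le> C * L ^ 2 / real T ^ 2"
        by simp
    qed
    also have "\<dots> \<le> ennreal ((2 + 2 * C) * f n)"
    proof (rule ennreal_leI)
      have "2 * (C * L ^ 2) / K \<le> 2 * (C * L ^ 2) / L"
        using K L by (intro divide_left_mono) (auto simp: C_def)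
      also have "\<dots> = 2 * C * L" using L by (simp add: power2_eq_square)
      finally show "K + 2 * (C * L ^ 2) / K \<le> (2 + 2 * C) * f n"
        using K L by (simp add: L_def[symmetric] algebra_simps)
    qed
    finally show ?case .
  qed
  moreover have "eventually (\<lambda>n. 0 \<le> f n) sequentially" unfolding f_def by real_asymp
  ultimately have "ext_bigo (\<lambda>n. latency_exp D (adaptive_adversaries D n) n) f"
    by (rule ext_bigoI) (simp add: C_def)
  then show ?thesis using D(1) unfolding f_def by blast
qed

subsection \<open>Lower bounds\<close>

definition oblivious :: "nat \<Rightarrow> (nat \<Rightarrow> nat) \<Rightarrow> adversary" where
  "oblivious n wake h = {u. u < n \<and> length h = Suc (wake u)}"

lemma oblivious_adversaries_eq: "oblivious_adversaries n = range (oblivious n)"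
  unfolding oblivious_adversaries_def oblivious_def by (auto simp: fun_eq_iff image_iff)

(* In every slot before W either no bit can be 1 yet, or many parties are about to use their first
   bit of positive probability, or the bits of probability at most tau provide contention 2 * b. *)
locale blocking =
  fixes p :: "nat \<Rightarrow> real" and n :: nat and wake :: "nat \<Rightarrow> nat"
    and t1 W :: nat and \<tau> b Y :: real
  assumes p0: "0 \<le> p i" and p1: "p i \<le> 1"
    and t1: "1 \<le> t1" "\<And>i. i < t1 \<Longrightarrow> p i = 0"
    and tau: "0 < \<tau>"
    and cover: "\<And>t. t < W \<Longrightarrow> t < t1 \<or> b \<le> card {v. v < n \<and> wake v + t1 = t} * p t1 \<or>
      2 * b \<le> (\<Sum>v<n. if wake v < t \<and> p (t - wake v) \<le> \<tau> then p (t - wake v) else 0)"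
    and load: "\<And>t. t < W \<Longrightarrow>
      (\<Sum>v<n. if wake v < t \<and> p (t - wake v) \<le> \<tau> then p (t - wake v) else 0) \<le> Y"
    and small: "2 * exp (1 - b) * (\<Sum>i<W. p i) * Y \<le> \<tau>"
begin

sublocale contention p n "oblivious n wake"
  by unfold_locales (auto simp: p0 p1 woken_once_def oblivious_def)

definition fresh :: "nat \<Rightarrow> bool" where
  "fresh t \<longleftrightarrow> b \<le> card {v. v < n \<and> wake v + t1 = t} * p t1"

definition weight :: "nat \<Rightarrow> nat \<Rightarrow> real" where
  "weight t v = (if wake v < t \<and> p (t - wake v) \<le> \<tau> then p (t - wake v) else 0)"

text \<open>Slot \<open>t\<close> may lie in the future of \<open>h\<close>: this is the part of its
  planned contention that the successes so far have already destroyed.\<close>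

definition lost :: "nat \<Rightarrow> history \<Rightarrow> real" where
  "lost t h = (\<Sum>v<n. if {v} \<in> set h then weight t v else 0)"

text \<open>Decided by the history before the slot is played, so the first slot that is not busy can
  act as a stopping time.\<close>

definition busy :: "history \<Rightarrow> bool" where
  "busy h \<longleftrightarrow> length h < t1 \<or> fresh (length h) \<or> lost (length h) h \<le> b"

abbreviation all_busy :: "history \<Rightarrow> bool" where
  "all_busy h \<equiv> (\<forall>j<length h. busy (take j h))"

lemma attempt_prob_oblivious:
  assumes "v < n"
  shows "attempt_prob h v = (if {v} \<in> set h \<or> length h \<le> wake v then 0 else p (length h - wake v))"
proof -
  have "(\<Sum>s<length h. if v \<in> oblivious n wake (take (Suc s) h) then p (length h - s) else 0)
     = (\<Sum>s<length h. if s = wake v then p (length h - s) else 0)"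
  proof (intro sum.cong refl)
    fix s assume "s \<in> {..<length h}"
    then have "v \<in> oblivious n wake (take (Suc s) h) \<longleftrightarrow> s = wake v"
      using assms by (auto simp: oblivious_def)
    then show "(if v \<in> oblivious n wake (take (Suc s) h) then p (length h - s) else 0)
        = (if s = wake v then p (length h - s) else 0)" by simp
  qed
  then show ?thesis by (simp add: attempt_prob_def)
qed

lemma attempt_prob_le: "v < n \<Longrightarrow> attempt_prob h v \<le> (if wake v < length h then p (length h - wake v) else 0)"
  using p0 by (auto simp: attempt_prob_oblivious)

lemma weight_bounds: "0 \<le> weight t v" "weight t v \<le> \<tau>"
  using p0 tau by (auto simp: weight_def)

text \<open>Parties of age \<open>t1\<close> cannot have succeeded in a possible history, since all
  their earlier bits are 0. Unlike spread-out contention, such a group cannot be eroded in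
  advance.\<close>

lemma fresh_contention:
  assumes h: "h \<in> histories t" "hist_prob h \<noteq> 0" and fr: "fresh t"
  shows "b \<le> contention h"
proof -
  let ?F = "{v. v < n \<and> wake v + t1 = t}"
  have len: "length h = t" using h by (simp add: length_histories)
  have "attempt_prob h v = p t1" if v: "v \<in> ?F" for v
  proof -
    have "{v} \<notin> set h"
    proof
      assume "{v} \<in> set h"
      then obtain j where j: "j < t" "h ! j = {v}" using len by (auto simp: in_set_conv_nth)
      have "attempt_prob (take j h) v \<noteq> 0"
        using step_prob_nz[OF h(2), of j] step_prob_nz_attempt[of "take j h" "{v}" v] j v len by auto
      then have "p (j - wake v) \<noteq> 0"
        using v j len by (auto simp: attempt_prob_oblivious min_def split: if_splits)
      then have "t1 \<le> j - wake v" using t1(2)[of "j - wake v"] by linarith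
      then show False using v j t1(1) by auto
    qed
    moreover have "length h - wake v = t1" "wake v < length h" using v t1(1) len by auto
    ultimately show ?thesis using v by (auto simp: attempt_prob_oblivious)
  qed
  then have "card ?F * p t1 = (\<Sum>v\<in>?F. attempt_prob h v)" by simp
  also have "\<dots> \<le> contention h"
    unfolding contention_def using attempt_prob_bounds by (intro sum_mono2) auto
  finally show ?thesis using fr by (simp add: fresh_def)
qed

lemma single_le_contention:
  assumes "v < n" "b \<le> contention h"
  shows "step_prob h {v} \<le> attempt_prob h v * exp (1 - b)"
proof -
  have "step_prob h {v} \<le> attempt_prob h v * exp (1 - contention h)"
    using assms by (intro step_prob_single_le)
  also have "\<dots> \<le> attempt_prob h v * exp (1 - b)"
    using assms attempt_prob_bounds by (intro mult_left_mono) auto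
  finally show ?thesis .
qed

text \<open>Before \<open>t1\<close> nobody attempts; a fresh group is intact; otherwise at most
  \<open>b\<close> of the planned contention \<open>2 * b\<close> is lost.\<close>

lemma busy_single_le:
  assumes h: "h \<in> histories t" "hist_prob h \<noteq> 0" and t: "t < W" and busy: "busy h" and v: "v < n"
  shows "step_prob h {v} \<le> attempt_prob h v * exp (1 - b)"
proof -
  have len: "length h = t" using h by (simp add: length_histories)
  consider "t < t1" | "fresh t" | "\<not> t < t1" "\<not> fresh t" "lost t h \<le> b"
    using busy len by (auto simp: busy_def)
  then show ?thesis
  proof cases
    case 1
    then have "attempt_prob h v = 0" using t1(2)[of "t - wake v"] v len by (simp add: attempt_prob_oblivious)
    then show ?thesis using v by (simp add: step_prob_single)
  next
    case 2
    then show ?thesis using fresh_contention[OF h] v by (intro single_le_contention) auto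
  next
    case 3
    then have "2 * b \<le> (\<Sum>v<n. weight t v)"
      using cover[OF t] by (auto simp: fresh_def weight_def)
    also have "\<dots> \<le> (\<Sum>v<n. attempt_prob h v + (if {v} \<in> set h then weight t v else 0))"
      using len p0 by (intro sum_mono) (auto simp: attempt_prob_oblivious weight_def)
    also have "\<dots> = contention h + lost t h" by (simp add: contention_def lost_def sum.distrib)
    finally have "b \<le> contention h" using 3 by simp
    then show ?thesis using v by (intro single_le_contention) auto
  qed
qed

lemma lost_snoc:
  assumes "{v} \<notin> set h" "v < n" shows "lost t (h @ [{v}]) = lost t h + weight t v"
proof -
  have "lost t (h @ [{v}]) = (\<Sum>w<n. (if {w} \<in> set h then weight t w else 0) + (if w = v then weight t v else 0))"
    unfolding lost_def using assms by (intro sum.cong) auto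
  then show ?thesis using assms by (simp add: sum.distrib lost_def)
qed

lemma all_busy_snoc: "all_busy (h @ [S]) \<longleftrightarrow> all_busy h \<and> busy h"
  by (auto simp: less_Suc_eq)

text \<open>The target slot \<open>t0\<close> is fixed. A success raises the exponent by at most 1,
  as weights are at most \<open>\<tau>\<close>, and while all slots are busy the success bounds of
  one party sum to at most \<open>exp (1 - b)\<close> times its mass; by \<open>small\<close> the
  total growth of the exponent is at most 1. The indicator of \<open>all_busy\<close> breaks the
  circularity between contention and successes.\<close>

lemma lost_mean:
  assumes t0: "t0 < W"
  shows "mean t0 (\<lambda>h. of_bool (all_busy h) * exp (lost t0 h / \<tau>)) \<le> exp 1"
proof -
  define F where "F h = of_bool (all_busy h) * exp (lost t0 h / \<tau>)" for h
  define c where "c s = (\<Sum>v<n. (if wake v < s then p (s - wake v) else 0) * (2 * exp (1 - b) / \<tau> * weight t0 v))" for s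
  have F0: "0 \<le> F h" for h by (simp add: F_def)
  have step: "next_mean F h \<le> exp (c s) * F h"
    if s: "s < t0" and h: "h \<in> histories s" "hist_prob h \<noteq> 0" for s h
  proof (cases "all_busy h \<and> busy h")
    case False
    then have "next_mean F h = 0"
      unfolding next_mean_def F_def using all_busy_snoc[of h] by (intro sum.neutral) auto
    then show ?thesis using F0 by simp
  next
    case True
    have len: "length h = s" using h by (simp add: length_histories)
    have F: "F (h @ [S]) = exp (lost t0 (h @ [S]) / \<tau>)" "F h = exp (lost t0 h / \<tau>)" for S
      using True all_busy_snoc[of h S] by (auto simp: F_def)
    have "next_mean F h \<le> F h + (\<Sum>v<n. step_prob h {v} * (F h * (2 / \<tau> * weight t0 v)))"
    proof (rule next_mean_le_singles)
      fix S assume "\<And>v. v < n \<Longrightarrow> S \<noteq> {v}"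
      then have "lost t0 (h @ [S]) = lost t0 h"
        unfolding lost_def by (intro sum.cong) auto
      then show "F (h @ [S]) \<le> F h" by (simp add: F)
    next
      fix v assume v: "v < n" "step_prob h {v} \<noteq> 0"
      then have ns: "{v} \<notin> set h" using step_prob_nz_attempt[of h "{v}" v] by (auto simp: attempt_prob_def)
      define y where "y = weight t0 v / \<tau>"
      have y: "0 \<le> y" "y \<le> 1" using weight_bounds[of t0 v] tau by (auto simp: y_def)
      have "exp y \<le> 1 + y + y\<^sup>2" using y by (intro exp_bound) auto
      also have "y\<^sup>2 \<le> y" using y by (simp add: power2_eq_square mult_left_le)
      finally have "exp y \<le> 1 + 2 * y" by simp
      then have "F h * exp y \<le> F h * (1 + 2 * y)" using F0 by (intro mult_left_mono) auto
      moreover have "F (h @ [{v}]) = F h * exp y"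
        unfolding F lost_snoc[OF ns v(1)] by (simp add: y_def add_divide_distrib exp_add)
      ultimately show "F (h @ [{v}]) \<le> F h + F h * (2 / \<tau> * weight t0 v)"
        by (simp add: y_def algebra_simps)
    qed
    also have "(\<Sum>v<n. step_prob h {v} * (F h * (2 / \<tau> * weight t0 v)))
       \<le> (\<Sum>v<n. (if wake v < s then p (s - wake v) else 0) * exp (1 - b) * (F h * (2 / \<tau> * weight t0 v)))"
    proof (intro sum_mono mult_right_mono)
      fix v assume v: "v \<in> {..<n}"
      have "step_prob h {v} \<le> attempt_prob h v * exp (1 - b)"
        using busy_single_le[OF h] True v s t0 by auto
      also have "\<dots> \<le> (if wake v < s then p (s - wake v) else 0) * exp (1 - b)"
        using attempt_prob_le[of v h] v len by (intro mult_right_mono) auto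
      finally show "step_prob h {v} \<le> (if wake v < s then p (s - wake v) else 0) * exp (1 - b)" .
      show "0 \<le> F h * (2 / \<tau> * weight t0 v)" using F0 tau weight_bounds by simp
    qed
    also have "\<dots> = F h * c s"
      unfolding c_def sum_distrib_left by (intro sum.cong) (auto simp: field_simps)
    finally have "next_mean F h \<le> F h * (1 + c s)" by (simp add: algebra_simps)
    also have "\<dots> \<le> F h * exp (c s)" using F0 exp_ge_add_one_self by (intro mult_left_mono) auto
    finally show ?thesis by (simp add: mult.commute)
  qed
  have "mean t0 F \<le> (\<Prod>s<t0. exp (c s)) * F []"
    using step by (intro mean_supermartingale) auto
  also have "\<dots> = exp (\<Sum>s<t0. c s)" by (simp add: exp_sum F_def lost_def)
  also have "\<dots> \<le> exp 1"
  proof -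
    have inner: "(\<Sum>s<t0. if wake v < s then p (s - wake v) else 0) \<le> (\<Sum>i<W. p i)" for v
    proof -
      have "(\<Sum>s<t0. if wake v < s then p (s - wake v) else 0) = (\<Sum>s\<in>{wake v<..<t0}. p (s - wake v))"
        by (subst sum.inter_filter[symmetric]) (auto intro!: sum.cong)
      also have "\<dots> = sum p ((\<lambda>s. s - wake v) ` {wake v<..<t0})"
        by (subst sum.reindex) (auto simp: inj_on_def)
      also have "\<dots> \<le> (\<Sum>i<W. p i)" using t0 p0 by (intro sum_mono2) auto
      finally show ?thesis .
    qed
    have "(\<Sum>s<t0. c s) = (\<Sum>v<n. (\<Sum>s<t0. if wake v < s then p (s - wake v) else 0) * (2 * exp (1 - b) / \<tau> * weight t0 v))"
      unfolding c_def sum_distrib_right by (rule sum.swap)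
    also have "\<dots> \<le> (\<Sum>v<n. (\<Sum>i<W. p i) * (2 * exp (1 - b) / \<tau> * weight t0 v))"
      using inner weight_bounds tau by (intro sum_mono mult_right_mono) auto
    also have "\<dots> = (\<Sum>i<W. p i) * (2 * exp (1 - b) / \<tau>) * (\<Sum>v<n. weight t0 v)"
      by (simp add: sum_distrib_left mult.assoc)
    also have "\<dots> \<le> (\<Sum>i<W. p i) * (2 * exp (1 - b) / \<tau>) * Y"
      using load[OF t0] tau p0 by (intro mult_left_mono mult_nonneg_nonneg sum_nonneg) (auto simp: weight_def)
    also have "\<dots> \<le> 1" using small tau by (simp add: field_simps)
    finally show ?thesis by simp
  qed
  finally show ?thesis unfolding F_def[abs_def] .
qed

text \<open>At the first slot that is not busy the loss exceeds \<open>b\<close>, so the potential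
  exceeds \<open>exp (b / \<tau>)\<close>. This is the gain from counting only small attempt
  probabilities.\<close>

lemma not_busy_prob:
  assumes "t < W"
  shows "mean t (\<lambda>h. of_bool (all_busy h \<and> \<not> busy h)) \<le> exp (1 - b / \<tau>)"
proof -
  have "mean t (\<lambda>h. of_bool (all_busy h \<and> \<not> busy h))
     \<le> mean t (\<lambda>h. of_bool (all_busy h) * exp (lost t h / \<tau>)) / exp (b / \<tau>)"
    by (rule markov_mean) (auto simp: busy_def length_histories divide_right_mono tau less_imp_le)
  also have "\<dots> \<le> exp 1 / exp (b / \<tau>)"
    using lost_mean[OF assms] by (intro divide_right_mono) auto
  finally show ?thesis by (simp add: exp_diff)
qed

lemma next_mean_active:
  assumes "u < n"
  shows "next_mean (\<lambda>h. of_bool ({u} \<notin> set h)) h = of_bool ({u} \<notin> set h) * (1 - step_prob h {u})"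
proof (cases "{u} \<in> set h")
  case False
  have "next_mean (\<lambda>h. of_bool ({u} \<notin> set h)) h
     = (\<Sum>S\<in>Pow {..<n}. step_prob h S - (if S = {u} then step_prob h S else 0))"
    unfolding next_mean_def using False by (intro sum.cong) auto
  also have "\<dots> = 1 - step_prob h {u}"
    using assms by (simp add: sum_subtractf sum_step_prob)
  finally show ?thesis using False by simp
qed (simp add: next_mean_def)

text \<open>Union bound: each slot may be the first that is not busy, or a success of
  \<open>u\<close>. As \<open>wake u = 0\<close>, slot number and age of \<open>u\<close>
  coincide.\<close>

lemma busy_survival:
  assumes u: "u < n" "wake u = 0" and t: "t \<le> W"
  shows "1 - (\<Sum>s<t. exp (1 - b / \<tau>) + p s * exp (1 - b)) \<le> mean t (\<lambda>h. of_bool (all_busy h \<and> {u} \<notin> set h))"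
  using t
proof (induction t)
  case 0
  show ?case by (simp add: mean_0)
next
  case (Suc t)
  let ?G = "\<lambda>h. of_bool (all_busy h \<and> {u} \<notin> set h) :: real"
  have "mean t ?G - exp (1 - b / \<tau>) - p t * exp (1 - b)
    \<le> mean t ?G - mean t (\<lambda>h. of_bool (all_busy h \<and> \<not> busy h)) - mean t (\<lambda>h. p t * exp (1 - b))"
    using not_busy_prob[of t] Suc.prems by (simp add: mean_const)
  also have "\<dots> = mean t (\<lambda>h. ?G h - of_bool (all_busy h \<and> \<not> busy h) - p t * exp (1 - b))"
    by (simp add: mean_diff)
  also have "\<dots> \<le> mean t (next_mean ?G)"
  proof (rule mean_mono)
    fix h assume h: "h \<in> histories t" "hist_prob h \<noteq> 0"
    have len: "length h = t" using h by (simp add: length_histories)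
    have pe: "0 \<le> p t * exp (1 - b)" using p0 by simp
    have nn: "0 \<le> next_mean ?G h"
      unfolding next_mean_def using step_prob_nonneg by (intro sum_nonneg) auto
    show "?G h - of_bool (all_busy h \<and> \<not> busy h) - p t * exp (1 - b) \<le> next_mean ?G h"
    proof (cases "all_busy h \<and> busy h \<and> {u} \<notin> set h")
      case True
      have "next_mean ?G h = next_mean (\<lambda>h. of_bool ({u} \<notin> set h)) h"
        unfolding next_mean_def using True all_busy_snoc[of h] by (intro sum.cong) auto
      then have eq: "next_mean ?G h = 1 - step_prob h {u}"
        using next_mean_active[OF u(1), of h] True by simp
      have "step_prob h {u} \<le> attempt_prob h u * exp (1 - b)"
        using busy_single_le[OF h] True u Suc.prems by auto
      also have "\<dots> \<le> p t * exp (1 - b)"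
        using attempt_prob_le[OF u(1), of h] u len p0[of t] by (intro mult_right_mono) (auto split: if_splits)
      finally show ?thesis using True eq by simp
    next
      case False
      then show ?thesis using nn pe by (auto simp: of_bool_def)
    qed
  qed
  finally have "mean t ?G - exp (1 - b / \<tau>) - p t * exp (1 - b) \<le> mean (Suc t) ?G"
    by (simp only: mean_Suc)
  then show ?case using Suc by simp
qed

text \<open>From \<open>W\<close> on no contention is guaranteed: a small attempt is granted its
  full probability of success, and only attempts above \<open>\<tau>\<close> are blocked, by fresh
  groups.\<close>

lemma late_survival:
  assumes u: "u < n" "wake u = 0" and t: "W \<le> t"
    and fr: "\<And>s. W \<le> s \<Longrightarrow> s < t \<Longrightarrow> \<tau> < p s \<Longrightarrow> fresh s" and eta: "exp (1 - b) \<le> 1"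
  shows "mean W (\<lambda>h. of_bool ({u} \<notin> set h)) *
      (\<Prod>s\<in>{W..<t}. 1 - (if p s \<le> \<tau> then p s else p s * exp (1 - b)))
    \<le> mean t (\<lambda>h. of_bool ({u} \<notin> set h))"
  using t fr
proof (induction t rule: dec_induct)
  case (step t)
  let ?R = "\<lambda>h. of_bool ({u} \<notin> set h) :: real"
  define c where "c = (if p t \<le> \<tau> then p t else p t * exp (1 - b))"
  have c1: "0 \<le> 1 - c"
    using p0[of t] p1[of t] eta by (auto simp: c_def mult_le_one)
  have "mean W ?R * (\<Prod>s\<in>{W..<Suc t}. 1 - (if p s \<le> \<tau> then p s else p s * exp (1 - b)))
     = (1 - c) * (mean W ?R * (\<Prod>s\<in>{W..<t}. 1 - (if p s \<le> \<tau> then p s else p s * exp (1 - b))))"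
    using step.hyps by (simp add: c_def)
  also have "\<dots> \<le> (1 - c) * mean t ?R"
    using step c1 by (intro mult_left_mono) auto
  also have "\<dots> = mean t (\<lambda>h. (1 - c) * ?R h)" by (rule mean_cmult[symmetric])
  also have "\<dots> \<le> mean t (next_mean ?R)"
  proof (rule mean_mono)
    fix h assume h: "h \<in> histories t" "hist_prob h \<noteq> 0"
    have len: "length h = t" using h by (simp add: length_histories)
    have ap: "attempt_prob h u \<le> p t"
      using attempt_prob_le[OF u(1), of h] u len p0[of t] by (auto split: if_splits)
    have "step_prob h {u} \<le> c"
    proof (cases "p t \<le> \<tau>")
      case True
      have "step_prob h {u} \<le> attempt_prob h u"
        using attempt_prob_bounds
        by (auto simp: step_prob_single[OF u(1)] intro!: mult_left_le prod_le_1)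
      then show ?thesis using True ap by (simp add: c_def)
    next
      case False
      then have "step_prob h {u} \<le> attempt_prob h u * exp (1 - b)"
        using fresh_contention[OF h] step.prems[of t] step.hyps u by (intro single_le_contention) auto
      also have "\<dots> \<le> p t * exp (1 - b)" using ap by (intro mult_right_mono) auto
      finally show ?thesis using False by (simp add: c_def)
    qed
    then show "(1 - c) * ?R h \<le> next_mean ?R h"
      unfolding next_mean_active[OF u(1)] by simp
  qed
  finally show ?case by (simp only: mean_Suc)
qed simp

end

section \<open>Sparse wake-up sets by averaging\<close>

lemma exists_subset_le_mean:
  fixes l :: real and F :: "'a set \<Rightarrow> real"
  assumes I: "finite I" and l: "0 \<le> l" "l \<le> 1"
  shows "\<exists>A\<subseteq>I. F A \<le> (\<Sum>A\<in>Pow I. (\<Prod>s\<in>A. l) * (\<Prod>s\<in>I - A. 1 - l) * F A)"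
proof (rule ccontr)
  \<comment> \<open>The probability of \<open>A\<close> as a random subset that contains each
    element independently with probability \<open>l\<close>.\<close>
  define w where "w A = (\<Prod>s\<in>A. l) * (\<Prod>s\<in>I - A. 1 - l)" for A :: "'a set"
  let ?m = "\<Sum>A\<in>Pow I. w A * F A"
  assume "\<not> ?thesis"
  then have gt: "\<And>A. A \<subseteq> I \<Longrightarrow> ?m < F A" unfolding w_def by (meson not_le)
  have w0: "0 \<le> w A" for A unfolding w_def using l by (intro mult_nonneg_nonneg prod_nonneg) auto
  have w1: "(\<Sum>A\<in>Pow I. w A) = 1"
    using prod_add[OF I, of "\<lambda>_. l" "\<lambda>_. 1 - l"] by (simp add: w_def)
  have "\<exists>A\<in>Pow I. 0 < w A"
  proof (rule ccontr)
    assume "\<not> ?thesis"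
    then have "(\<Sum>A\<in>Pow I. w A) = 0" using w0 by (intro sum.neutral) (auto simp: not_less antisym)
    then show False using w1 by simp
  qed
  then obtain B where B: "B \<in> Pow I" "0 < w B" by blast
  have "(\<Sum>A\<in>Pow I. w A * ?m) < (\<Sum>A\<in>Pow I. w A * F A)"
  proof (rule sum_strict_mono_ex1)
    show "\<forall>A\<in>Pow I. w A * ?m \<le> w A * F A"
    proof
      fix A assume "A \<in> Pow I"
      then have "?m \<le> F A" using gt[of A] by simp
      then show "w A * ?m \<le> w A * F A" using w0 by (rule mult_left_mono)
    qed
    show "\<exists>A\<in>Pow I. w A * ?m < w A * F A"
      using B gt[of B] by (intro bexI[of _ B] mult_strict_left_mono) auto
  qed (use I in simp)
  then show False by (simp add: sum_distrib_right[symmetric] w1)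
qed

lemma exp_minus_le_half:
  fixes y :: real assumes "0 \<le> y" "y \<le> 1" shows "exp (- y) \<le> 1 - y / 2"
proof -
  have "exp (- y) \<le> 1 / (1 + y)"
    using assms exp_ge_add_one_self[of y] by (simp add: exp_minus divide_simps)
  also have "\<dots> \<le> 1 - y / 2"
    using assms mult_left_le[of y y] by (simp add: divide_simps algebra_simps)
  finally show ?thesis .
qed

text \<open>The potential adds a penalty \<open>G t\<close> per poorly covered slot and a penalty
  \<open>H\<close> for size. Its mean over random sets of density \<open>l\<close> is at most 1, so
  some set keeps every penalty at most 1, which says that every exponent is at most 0. The slack
  between \<open>8 * b\<close> and \<open>2 * b\<close> pays for
  \<open>exp (- y) \<le> 1 - y / 2\<close> and for the union over \<open>T\<close>.\<close>

lemma sparse_cover_exists: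
  fixes q :: "'b \<Rightarrow> 'a \<Rightarrow> real" and d :: "'b \<Rightarrow> real" and l \<tau> b :: real
  assumes I: "finite I" and T: "finite T" and l: "0 \<le> l" "l \<le> 1" and tau: "0 < \<tau>"
    and q: "\<And>t s. 0 \<le> q t s" "\<And>t s. q t s \<le> \<tau>" and d: "\<And>t. 0 \<le> d t"
    and cov: "\<And>t. t \<in> T \<Longrightarrow> 8 * b \<le> d t + l * (\<Sum>s\<in>I. q t s)"
    and small: "card T * exp (- 2 * b / \<tau>) \<le> 1 / 2"
  shows "\<exists>A\<subseteq>I. card A \<le> 2 * l * card I + 1 \<and> (\<forall>t\<in>T. 2 * b \<le> d t + (\<Sum>s\<in>A. q t s))"
proof -
  define G where "G t A = exp ((2 * b - d t) / \<tau>) * (\<Prod>s\<in>A. exp (- q t s / \<tau>))" for t A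
  \<comment> \<open>Since \<open>exp 1 - 1 \<le> 2\<close>, the mean of \<open>exp (card A)\<close>
    is at most \<open>exp (2 * l * card I)\<close>; the extra 1 brings the mean of \<open>H\<close>
    below 1/2.\<close>
  define H where "H A = exp (- (2 * l * card I + 1)) * (\<Prod>s\<in>A. exp 1)" for A :: "'a set"
  define w where "w A = (\<Prod>s\<in>A. l) * (\<Prod>s\<in>I - A. 1 - l)" for A :: "'a set"
  have mean: "(\<Sum>A\<in>Pow I. w A * (\<Prod>s\<in>A. a s)) = (\<Prod>s\<in>I. l * a s + (1 - l))" for a :: "'a \<Rightarrow> real"
    unfolding prod_add[OF I] w_def by (intro sum.cong) (auto simp: prod.distrib)
  have meanG: "(\<Sum>A\<in>Pow I. w A * G t A) \<le> exp (- 2 * b / \<tau>)" if t: "t \<in> T" for t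
  proof -
    have "(\<Sum>A\<in>Pow I. w A * G t A) = exp ((2 * b - d t) / \<tau>) * (\<Prod>s\<in>I. l * exp (- q t s / \<tau>) + (1 - l))"
      unfolding mean[symmetric] sum_distrib_left by (intro sum.cong) (auto simp: G_def)
    also have "\<dots> \<le> exp ((2 * b - d t) / \<tau>) * (\<Prod>s\<in>I. exp (- (l * q t s / (2 * \<tau>))))"
    proof (intro mult_left_mono prod_mono conjI)
      fix s
      define y where "y = q t s / \<tau>"
      have y: "0 \<le> y" "y \<le> 1" using q[of t s] tau by (auto simp: y_def)
      have "l * exp (- y) + (1 - l) \<le> l * (1 - y / 2) + (1 - l)"
        using exp_minus_le_half[OF y] l by (intro add_mono mult_left_mono) auto
      also have "\<dots> = 1 + - (l * y / 2)" by (simp add: algebra_simps)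
      also have "\<dots> \<le> exp (- (l * y / 2))" by (rule exp_ge_add_one_self)
      finally show "l * exp (- q t s / \<tau>) + (1 - l) \<le> exp (- (l * q t s / (2 * \<tau>)))"
        by (simp add: y_def mult.commute)
      show "0 \<le> l * exp (- q t s / \<tau>) + (1 - l)" using l by simp
    qed auto
    also have "\<dots> = exp ((2 * b - d t) / \<tau> - l * (\<Sum>s\<in>I. q t s) / (2 * \<tau>))"
      using I by (simp add: exp_sum[symmetric] exp_add[symmetric] sum_negf sum_distrib_left sum_divide_distrib)
    also have "\<dots> \<le> exp (- 2 * b / \<tau>)"
    proof -
      define Q where "Q = l * (\<Sum>s\<in>I. q t s)"
      have "(2 * b - d t) * 2 - Q \<le> - 4 * b" using cov[OF t] d[of t] unfolding Q_def[symmetric] by simp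
      then have "((2 * b - d t) * 2 - Q) / (2 * \<tau>) \<le> (- 4 * b) / (2 * \<tau>)"
        using tau by (intro divide_right_mono) auto
      then show ?thesis using tau unfolding Q_def[symmetric] by (simp add: diff_divide_distrib)
    qed
    finally show ?thesis .
  qed
  have meanH: "(\<Sum>A\<in>Pow I. w A * H A) \<le> 1 / 2"
  proof -
    have "(\<Sum>A\<in>Pow I. w A * H A) = exp (- (2 * l * card I + 1)) * (\<Prod>s\<in>I. l * exp 1 + (1 - l))"
      unfolding mean[symmetric] sum_distrib_left by (intro sum.cong) (auto simp: H_def)
    also have "\<dots> \<le> exp (- (2 * l * card I + 1)) * (\<Prod>s\<in>I. exp (2 * l))"
    proof (intro mult_left_mono prod_mono conjI)
      have "l * exp 1 \<le> l * 3" using exp_le l by (intro mult_left_mono) auto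
      then have "l * exp 1 + (1 - l) \<le> 1 + 2 * l" by simp
      also have "\<dots> \<le> exp (2 * l)" by (rule exp_ge_add_one_self)
      finally show "l * exp 1 + (1 - l) \<le> exp (2 * l)" .
      show "0 \<le> l * exp 1 + (1 - l)" using l by simp
    qed auto
    also have "\<dots> = exp (- 1)"
      by (simp add: exp_of_nat_mult[symmetric] exp_add[symmetric])
    also have "\<dots> \<le> 1 / 2" using exp_minus_le_half[of 1] by simp
    finally show ?thesis .
  qed
  define F where "F A = (\<Sum>t\<in>T. G t A) + H A" for A
  obtain A where A: "A \<subseteq> I" "F A \<le> (\<Sum>A\<in>Pow I. w A * F A)"
    using exists_subset_le_mean[OF I l, of F] unfolding w_def by blast
  have "(\<Sum>A\<in>Pow I. w A * F A) = (\<Sum>t\<in>T. \<Sum>A\<in>Pow I. w A * G t A) + (\<Sum>A\<in>Pow I. w A * H A)"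
    unfolding F_def by (simp add: distrib_left sum.distrib sum_distrib_left) (rule sum.swap)
  also have "\<dots> \<le> (\<Sum>t\<in>T. exp (- 2 * b / \<tau>)) + 1 / 2"
    using meanG meanH by (intro add_mono sum_mono) auto
  also have "\<dots> \<le> 1" using small by simp
  finally have FA: "F A \<le> 1" using A by simp
  have fA: "finite A" using A I finite_subset by auto
  have pos: "0 \<le> G t A" "0 \<le> H A" for t by (auto simp: G_def H_def prod_nonneg)
  have "H A \<le> 1" using FA pos sum_nonneg[of T "\<lambda>t. G t A"] by (simp add: F_def)
  moreover have "H A = exp (card A - (2 * l * card I + 1))"
    by (simp add: H_def exp_of_nat_mult[symmetric] exp_add[symmetric])
  ultimately have "card A \<le> 2 * l * card I + 1" by simp
  moreover have "2 * b \<le> d t + (\<Sum>s\<in>A. q t s)" if t: "t \<in> T" for t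
  proof -
    have "G t A \<le> (\<Sum>t\<in>T. G t A)" using pos T t by (intro member_le_sum) auto
    then have "G t A \<le> 1" using FA pos by (simp add: F_def)
    moreover have "G t A = exp ((2 * b - d t - (\<Sum>s\<in>A. q t s)) / \<tau>)"
      using fA by (simp add: G_def exp_sum[symmetric] exp_add[symmetric] sum_negf sum_divide_distrib[symmetric] diff_divide_distrib)
    ultimately show ?thesis using tau by (simp add: divide_le_0_iff)
  qed
  ultimately show ?thesis using A by blast
qed

section \<open>Wake-up schedules and the blocking adversary\<close>

lemma wake_from_counts_exact:
  fixes cnt :: "nat \<Rightarrow> nat"
  shows "\<exists>wake. (\<forall>s<k. card {v. v < (\<Sum>s<k. cnt s) \<and> wake v = s} = cnt s) \<and> (\<forall>v<\<Sum>s<k. cnt s. wake v < k)"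
proof (induction k)
  case (Suc k)
  define N where "N = (\<Sum>s<k. cnt s)"
  obtain wake where w: "\<And>s. s < k \<Longrightarrow> card {v. v < N \<and> wake v = s} = cnt s" "\<And>v. v < N \<Longrightarrow> wake v < k"
    using Suc unfolding N_def by blast
  define wake' where "wake' v = (if v < N then wake v else k)" for v
  have N: "(\<Sum>s<Suc k. cnt s) = N + cnt k" by (simp add: N_def)
  have "card {v. v < N + cnt k \<and> wake' v = s} = cnt s" if s: "s < Suc k" for s
  proof (cases "s = k")
    case True
    have "{v. v < N + cnt k \<and> wake' v = s} = {N..<N + cnt k}"
    proof (intro set_eqI)
      fix v
      show "v \<in> {v. v < N + cnt k \<and> wake' v = s} \<longleftrightarrow> v \<in> {N..<N + cnt k}"
        using w(2)[of v] True by (cases "v < N") (auto simp: wake'_def)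
    qed
    then show ?thesis using True by simp
  next
    case False
    then have "{v. v < N + cnt k \<and> wake' v = s} = {v. v < N \<and> wake v = s}"
      by (auto simp: wake'_def)
    then show ?thesis using w(1)[of s] False s by simp
  qed
  moreover have "wake' v < Suc k" for v using w(2)[of v] by (auto simp: wake'_def)
  ultimately show ?case unfolding N by blast
qed simp

text \<open>Surplus parties are woken in slot \<open>k\<close>, too late to attempt in any slot up
  to \<open>k\<close>.\<close>

lemma wake_from_counts:
  fixes cnt :: "nat \<Rightarrow> nat"
  assumes "(\<Sum>s<k. cnt s) \<le> n"
  shows "\<exists>wake. \<forall>s<k. card {v. v < n \<and> wake v = s} = cnt s"
proof -
  obtain wake where w: "\<And>s. s < k \<Longrightarrow> card {v. v < (\<Sum>s<k. cnt s) \<and> wake v = s} = cnt s"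
    using wake_from_counts_exact[of k cnt] by blast
  define wake' where "wake' v = (if v < (\<Sum>s<k. cnt s) then wake v else k)" for v
  have "{v. v < n \<and> wake' v = s} = {v. v < (\<Sum>s<k. cnt s) \<and> wake v = s}" if "s < k" for s
    using that assms by (auto simp: wake'_def)
  then show ?thesis using w by (intro exI[of _ wake']) simp
qed

lemma sum_over_wake:
  fixes f :: "nat \<Rightarrow> real" and n :: nat
  assumes cnt: "\<And>s. s < k \<Longrightarrow> card {v. v < n \<and> wake v = s} = cnt s" and t: "t \<le> k"
  shows "(\<Sum>v<n. if wake v < t then f (wake v) else 0) = (\<Sum>s<t. cnt s * f s)"
proof -
  have "(\<Sum>v<n. if wake v < t then f (wake v) else 0) = (\<Sum>v\<in>{v. v < n \<and> wake v < t}. f (wake v))"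
    by (subst sum.inter_filter[symmetric]) (auto intro!: sum.cong)
  also have "\<dots> = (\<Sum>s<t. \<Sum>v\<in>{v. v < n \<and> wake v = s}. f (wake v))"
  proof -
    have "{v. v < n \<and> wake v < t} = (\<Union>s<t. {v. v < n \<and> wake v = s})" by auto
    then show ?thesis by (simp only:) (subst sum.UNION_disjoint, auto)
  qed
  also have "\<dots> = (\<Sum>s<t. cnt s * f s)" using cnt t by (intro sum.cong) auto
  finally show ?thesis .
qed

lemma sum_age:
  fixes f :: "nat \<Rightarrow> real" shows "(\<Sum>s<t. f (t - s)) = (\<Sum>i=1..t. f i)"
  by (rule sum.reindex_bij_witness[of _ "\<lambda>i. t - i" "\<lambda>s. t - s"]) auto

(* g parties are woken in each slot before M, and g parties t1 slots before each slot from W on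
   in which u would attempt with probability above tau; in between, single parties are woken
   in a sparse set of slots that is found by averaging over a random set of density l. *)
theorem blocking_adversary:
  fixes p :: "nat \<Rightarrow> real" and M W W' g n t1 :: nat and l \<tau> b :: real
  defines "plo \<equiv> \<lambda>i. if p i \<le> \<tau> then p i else 0"
  assumes p0: "\<And>i. 0 \<le> p i" and p1: "\<And>i. p i \<le> 1"
    and t1: "1 \<le> t1" "\<And>i. i < t1 \<Longrightarrow> p i = 0"
    and M: "1 \<le> M" "M \<le> W" "t1 \<le> W" "W \<le> W'"
    and tau: "0 < \<tau>" and tau_half: "W < W' \<Longrightarrow> \<tau> \<le> 1/2" and b: "1 \<le> b"
    and g: "1 \<le> g" "b \<le> g * p t1"
    and l: "0 \<le> l" "l \<le> 1" and dense: "M = W \<or> 8 * b \<le> l * (\<Sum>i<M. plo i)"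
    and rare: "W * exp (1 - b / \<tau>) \<le> 1/8"
    and small: "2 * exp (1 - b) * (\<Sum>i<W. p i) * ((2 * g + 1) * (\<Sum>i<W. p i)) \<le> \<tau>"
    and mass: "(\<Sum>i<W'. p i) * exp (1 - b) \<le> 1/8"
    and n: "g * M + 2 * l * (W - M) + 1 + g * card {i\<in>{W..<W'}. \<tau> < p i} \<le> n"
  shows "\<exists>wake u. u < n \<and> wake u = 0 \<and>
    1/2 * exp (- 2 * (\<Sum>i\<in>{W..<W'}. plo i))
      \<le> contention.mean p n (oblivious n wake) W' (\<lambda>h. of_bool ({u} \<notin> set h))"
proof -
  define H where "H = {i\<in>{W..<W'}. \<tau> < p i}"
  have plo: "0 \<le> plo i" "plo i \<le> \<tau>" "plo i \<le> p i" for i using p0 tau by (auto simp: plo_def)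
  have eta: "exp (1 - b) \<le> 1" using b by simp
  \<comment> \<open>Planned contention of slot \<open>t\<close> from the groups woken before
    \<open>M\<close>, as if none of them had succeeded; \<open>q t s\<close> is that of a single
    party woken in slot \<open>s\<close>.\<close>
  define d where "d t = (\<Sum>s<M. real g * plo (t - s))" for t
  define q where "q t s = (if s < t then plo (t - s) else 0)" for t s
  have "\<exists>A\<subseteq>{M..<W}. card A \<le> 2 * l * card {M..<W} + 1 \<and>
      (\<forall>t\<in>{M..<W}. 2 * b \<le> d t + (\<Sum>s\<in>A. q t s))"
  proof (rule sparse_cover_exists[OF _ _ l tau])
    show "8 * b \<le> d t + l * (\<Sum>s\<in>{M..<W}. q t s)" if t: "t \<in> {M..<W}" for t
    proof -
      \<comment> \<open>At rate \<open>l\<close> in every slot before \<open>t\<close>, the ages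
        \<open>1, ..., t\<close> occur with weight \<open>l\<close> each and include all ages below
        \<open>M\<close>. Slots before \<open>M\<close> carry the higher rate \<open>g\<close>; the
        others are what the random set replaces.\<close>
      have "8 * b \<le> l * (\<Sum>i<M. plo i)" using dense t by auto
      also have "(\<Sum>i<M. plo i) = (\<Sum>i\<in>{1..<M}. plo i)"
        using M t1 by (simp add: lessThan_atLeast0 sum.atLeast_Suc_lessThan plo_def)
      also have "\<dots> \<le> (\<Sum>i=1..t. plo i)" using t plo by (intro sum_mono2) auto
      also have "\<dots> = (\<Sum>s<t. plo (t - s))" by (rule sum_age[symmetric])
      also have "\<dots> = (\<Sum>s<M. plo (t - s)) + (\<Sum>s\<in>{M..<t}. plo (t - s))"
        using t by (subst sum.union_disjoint[symmetric]) (auto intro!: sum.cong)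
      also have "(\<Sum>s\<in>{M..<t}. plo (t - s)) = (\<Sum>s\<in>{M..<W}. q t s)"
        using t unfolding q_def by (intro sum.mono_neutral_cong_left) auto
      finally have "8 * b \<le> l * (\<Sum>s<M. plo (t - s)) + l * (\<Sum>s\<in>{M..<W}. q t s)"
        using l by (simp add: distrib_left mult_left_mono)
      moreover have "l * (\<Sum>s<M. plo (t - s)) \<le> d t"
        unfolding d_def sum_distrib_left using l g plo by (intro sum_mono mult_right_mono) auto
      ultimately show ?thesis by (rule order_trans[OF _ add_right_mono])
    qed
    have "real (card {M..<W}) * exp (- 2 * b / \<tau>) \<le> W * exp (1 - b / \<tau>)"
    proof (rule mult_mono)
      have "0 \<le> b / \<tau>" using b tau by simp
      then show "exp (- 2 * b / \<tau>) \<le> exp (1 - b / \<tau>)" by simp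
    qed auto
    then show "real (card {M..<W}) * exp (- 2 * b / \<tau>) \<le> 1 / 2" using rare by linarith
  qed (use plo tau in \<open>auto simp: q_def d_def intro!: sum_nonneg\<close>)
  then obtain A where A: "A \<subseteq> {M..<W}" "card A \<le> 2 * l * (W - M) + 1"
      and Acov: "\<And>t. t \<in> {M..<W} \<Longrightarrow> 2 * b \<le> d t + (\<Sum>s\<in>A. q t s)" by auto
  \<comment> \<open>The three reasons to wake parties may coincide in a slot, so at most
    \<open>2 * g + 1\<close> parties are woken in it; this is the factor in the load bound.\<close>
  define cnt where "cnt s = (if s < M then g else 0) + (if s \<in> A then 1 else 0) + (if s + t1 \<in> H then g else 0)" for s
  have fA: "finite A" using A finite_subset by blast
  have "(\<Sum>s<W'. cnt s) = g * M + card A + g * card {s. s < W' \<and> s + t1 \<in> H}"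
  proof -
    have "(\<Sum>s<W'. if s < M then g else 0) = (\<Sum>s<M. g)"
      using M by (intro sum.mono_neutral_cong_right) auto
    moreover have "(\<Sum>s<W'. if s \<in> A then 1 else 0) = (\<Sum>s\<in>A. 1::nat)"
      using M A by (intro sum.mono_neutral_cong_right) auto
    moreover have "(\<Sum>s<W'. if s + t1 \<in> H then g else 0) = (\<Sum>s\<in>{s. s < W' \<and> s + t1 \<in> H}. g)"
      by (intro sum.mono_neutral_cong_right) auto
    ultimately show ?thesis unfolding cnt_def sum.distrib by simp
  qed
  moreover have "card {s. s < W' \<and> s + t1 \<in> H} \<le> card H"
    by (rule card_inj_on_le[where f="\<lambda>s. s + t1"]) (auto simp: inj_on_def H_def)
  ultimately have "real (\<Sum>s<W'. cnt s) \<le> g * M + card A + g * card H"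
    by (simp add: mult_left_mono)
  then have "real (\<Sum>s<W'. cnt s) \<le> n" using n A(2) by (simp add: H_def)
  then have "(\<Sum>s<W'. cnt s) \<le> n" by (simp only: of_nat_le_iff)
  from wake_from_counts[OF this] obtain wake where
    wake: "\<And>s. s < W' \<Longrightarrow> card {v. v < n \<and> wake v = s} = cnt s" by blast
  have W0: "0 < W'" using M by auto
  have "card {v. v < n \<and> wake v = 0} > 0" using wake[OF W0] M g by (simp add: cnt_def)
  then obtain u where u: "u < n" "wake u = 0" by (force simp: card_gt_0_iff)
  have freshc: "real (card {v. v < n \<and> wake v + t1 = t}) = cnt (t - t1)" if "t1 \<le> t" "t < W'" for t
  proof -
    have "{v. v < n \<and> wake v + t1 = t} = {v. v < n \<and> wake v = t - t1}" using that by auto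
    then show ?thesis using wake[of "t - t1"] that by simp
  qed
  have loadeq: "(\<Sum>v<n. if wake v < t \<and> p (t - wake v) \<le> \<tau> then p (t - wake v) else 0)
      = (\<Sum>s<t. cnt s * plo (t - s))" if "t \<le> W'" for t
  proof -
    have "(\<Sum>v<n. if wake v < t \<and> p (t - wake v) \<le> \<tau> then p (t - wake v) else 0)
        = (\<Sum>v<n. if wake v < t then plo (t - wake v) else 0)"
      by (intro sum.cong) (auto simp: plo_def)
    also have "\<dots> = (\<Sum>s<t. cnt s * plo (t - s))"
      using wake that by (rule sum_over_wake)
    finally show ?thesis .
  qed
  interpret blocking p n wake t1 W \<tau> b "(2 * g + 1) * (\<Sum>i<W. p i)"
  proof
    fix t assume t: "t < W"
    show "t < t1 \<or> b \<le> card {v. v < n \<and> wake v + t1 = t} * p t1 \<or>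
      2 * b \<le> (\<Sum>v<n. if wake v < t \<and> p (t - wake v) \<le> \<tau> then p (t - wake v) else 0)"
    \<comment> \<open>The groups woken before \<open>M\<close> reach age \<open>t1\<close> one after
      another, so every slot from \<open>t1\<close> until just before \<open>M + t1\<close> is
      fresh.\<close>
    proof (cases "t < t1 \<or> t - t1 < M")
      case True
      have "b \<le> card {v. v < n \<and> wake v + t1 = t} * p t1" if "\<not> t < t1"
      proof -
        have "real g * p t1 \<le> cnt (t - t1) * p t1"
          using True that p0 by (intro mult_right_mono) (auto simp: cnt_def)
        then show ?thesis using freshc[of t] g that t M by simp
      qed
      then show ?thesis by blast
    next
      case False
      then have tM: "t \<in> {M..<W}" using t by auto
      have "2 * b \<le> d t + (\<Sum>s\<in>A. q t s)" by (rule Acov[OF tM])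
      also have "d t = (\<Sum>s<t. (if s < M then real g else 0) * plo (t - s))"
        unfolding d_def using tM by (intro sum.mono_neutral_cong_left) auto
      also have "(\<Sum>s\<in>A. q t s) = (\<Sum>s\<in>{s\<in>A. s < t}. plo (t - s))"
        unfolding q_def using fA by (intro sum.mono_neutral_cong_right) auto
      also have "\<dots> = (\<Sum>s<t. (if s \<in> A then 1 else 0) * plo (t - s))"
        by (intro sum.mono_neutral_cong_left) auto
      also have "(\<Sum>s<t. (if s < M then real g else 0) * plo (t - s)) + \<dots> \<le> (\<Sum>s<t. cnt s * plo (t - s))"
        unfolding sum.distrib[symmetric] distrib_right[symmetric]
        using plo by (intro sum_mono mult_right_mono) (auto simp: cnt_def)
      finally show ?thesis using loadeq[of t] t M by simp
    qed
    have "(\<Sum>s<t. cnt s * plo (t - s)) \<le> (\<Sum>s<t. real (2 * g + 1) * plo (t - s))"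
      using plo by (intro sum_mono mult_right_mono) (auto simp: cnt_def)
    also have "\<dots> = real (2 * g + 1) * (\<Sum>i=1..t. plo i)"
      by (simp only: sum_distrib_left[symmetric] sum_age)
    also have "\<dots> \<le> real (2 * g + 1) * (\<Sum>i<W. p i)"
    proof (rule mult_left_mono)
      have "(\<Sum>i=1..t. plo i) \<le> (\<Sum>i=1..t. p i)" using plo by (intro sum_mono)
      also have "\<dots> \<le> (\<Sum>i<W. p i)" using t p0 by (intro sum_mono2) auto
      finally show "(\<Sum>i=1..t. plo i) \<le> (\<Sum>i<W. p i)" .
    qed simp
    finally show "(\<Sum>v<n. if wake v < t \<and> p (t - wake v) \<le> \<tau> then p (t - wake v) else 0)
      \<le> real (2 * g + 1) * (\<Sum>i<W. p i)"
      using loadeq[of t] t M by simp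
  qed (use p0 p1 t1 tau small in auto)
  have SW: "(\<Sum>i<W. p i) * exp (1 - b) \<le> 1/8"
  proof -
    have "(\<Sum>i<W. p i) \<le> (\<Sum>i<W'. p i)" using M p0 by (intro sum_mono2) auto
    then have "(\<Sum>i<W. p i) * exp (1 - b) \<le> (\<Sum>i<W'. p i) * exp (1 - b)" by (rule mult_right_mono) auto
    then show ?thesis using mass by linarith
  qed
  have "3/4 \<le> 1 - (\<Sum>s<W. exp (1 - b / \<tau>) + p s * exp (1 - b))"
  proof -
    have "(\<Sum>s<W. exp (1 - b / \<tau>) + p s * exp (1 - b)) = W * exp (1 - b / \<tau>) + (\<Sum>s<W. p s) * exp (1 - b)"
      by (simp add: sum.distrib sum_distrib_right)
    then show ?thesis using SW rare by linarith
  qed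
  also have "\<dots> \<le> mean W (\<lambda>h. of_bool (all_busy h \<and> {u} \<notin> set h))"
    by (rule busy_survival[OF u]) simp
  also have "\<dots> \<le> mean W (\<lambda>h. of_bool ({u} \<notin> set h))"
    by (rule mean_mono) auto
  finally have early: "3/4 \<le> mean W (\<lambda>h. of_bool ({u} \<notin> set h))" .
  define c where "c s = (if p s \<le> \<tau> then p s else p s * exp (1 - b))" for s
  have high_mass: "(\<Sum>s\<in>{W..<W'}. p s * exp (1 - b)) \<le> 1/8"
  proof -
    have "(\<Sum>s\<in>{W..<W'}. p s * exp (1 - b)) \<le> (\<Sum>s<W'. p s * exp (1 - b))"
      using p0 by (intro sum_mono2) auto
    also have "\<dots> = (\<Sum>s<W'. p s) * exp (1 - b)" by (rule sum_distrib_right[symmetric])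
    finally show ?thesis using mass by linarith
  qed
  have c: "0 \<le> c s" "c s \<le> 1/2" if "s \<in> {W..<W'}" for s
  proof -
    have "p s * exp (1 - b) \<le> (\<Sum>s\<in>{W..<W'}. p s * exp (1 - b))"
      using that p0 by (intro member_le_sum) auto
    then show "0 \<le> c s" "c s \<le> 1/2" using high_mass tau_half p0 that by (auto simp: c_def)
  qed
  \<comment> \<open>Going from 3/4 down to 1/2 absorbs the blocked large attempts, whose success
    probabilities sum to at most 1/8.\<close>
  have "1/2 * exp (- 2 * (\<Sum>i\<in>{W..<W'}. plo i)) \<le> 3/4 * (exp (- 1/4) * exp (- 2 * (\<Sum>i\<in>{W..<W'}. plo i)))"
  proof -
    have "3/4 \<le> exp (- 1/4 :: real)" using exp_ge_add_one_self[of "- 1/4::real"] by simp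
    then have "1/2 * exp (- 2 * (\<Sum>i\<in>{W..<W'}. plo i)) \<le> 3/4 * exp (- 1/4) * exp (- 2 * (\<Sum>i\<in>{W..<W'}. plo i))"
      by (intro mult_right_mono) auto
    then show ?thesis by (simp only: mult.assoc)
  qed
  also have "\<dots> \<le> 3/4 * exp (- 2 * (\<Sum>s\<in>{W..<W'}. c s))"
  proof -
    have "(\<Sum>s\<in>{W..<W'}. c s) \<le> (\<Sum>s\<in>{W..<W'}. plo s + p s * exp (1 - b))"
      using p0 by (intro sum_mono) (auto simp: c_def plo_def)
    also have "\<dots> \<le> (\<Sum>s\<in>{W..<W'}. plo s) + 1/8" using high_mass by (simp add: sum.distrib)
    finally show ?thesis by (simp add: exp_add[symmetric])
  qed
  also have "exp (- 2 * (\<Sum>s\<in>{W..<W'}. c s)) \<le> (\<Prod>s\<in>{W..<W'}. 1 - c s)"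
    unfolding sum_distrib_left exp_sum[OF finite_atLeastLessThan]
    using exp_m2_le c by (intro prod_mono) auto
  then have "3/4 * exp (- 2 * (\<Sum>s\<in>{W..<W'}. c s)) \<le> mean W (\<lambda>h. of_bool ({u} \<notin> set h)) * (\<Prod>s\<in>{W..<W'}. 1 - c s)"
    using early by (intro mult_mono) auto
  also have "\<dots> \<le> mean W' (\<lambda>h. of_bool ({u} \<notin> set h))"
    unfolding c_def
  proof (rule late_survival[OF u M(4) _ eta])
    fix s assume s: "W \<le> s" "s < W'" "\<tau> < p s"
    then have "s - t1 + t1 \<in> H" using M by (auto simp: H_def)
    then have "real g * p t1 \<le> cnt (s - t1) * p t1"
      using p0 by (intro mult_right_mono) (auto simp: cnt_def)
    then show "fresh s" using freshc[of s] s M g by (simp add: fresh_def)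
  qed
  finally show ?thesis using u by blast
qed

section \<open>Fast protocols and the mass they need\<close>

lemma oblivious_latency_ge:
  assumes "u < n" "wake u = 0" "{u} \<notin> set (run (oblivious n wake) X W)"
  shows "enat W \<le> latency (oblivious n wake) X u"
proof -
  let ?A = "oblivious n wake"
  have "u \<in> ?A (run ?A X (Suc 0))" using assms unfolding oblivious_def by simp
  then have "wake_time ?A X u = 0"
    unfolding wake_time_def by (metis (mono_tags, lifting) Least_eq_0)
  moreover have "enat W \<le> success_time ?A X u"
    unfolding success_time_def
  proof (intro INF_greatest)
    fix t assume t: "t \<in> {t. attempters ?A X (run ?A X t) = {u}}"
    show "enat W \<le> enat t"
    proof (rule ccontr)
      assume "\<not> ?thesis"
      then have "t < W" by simp
      then have "run ?A X W ! t = {u}" using t by (simp add: nth_run)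
      then show False using \<open>t < W\<close> assms(3) by (metis length_run nth_mem)
    qed
  qed
  ultimately show ?thesis unfolding latency_def by (simp add: zero_enat_def[symmetric])
qed

lemma oblivious_memoryless_contention:
  "memoryless_protocol D \<Longrightarrow> memoryless_contention D n (oblivious n wake)"
  by unfold_locales (auto simp: woken_once_def oblivious_def)

definition survival :: "(nat \<Rightarrow> real) \<Rightarrow> nat \<Rightarrow> (nat \<Rightarrow> nat) \<Rightarrow> nat \<Rightarrow> nat \<Rightarrow> real" where
  "survival p n wake u k = contention.mean p n (oblivious n wake) k (\<lambda>h. of_bool ({u} \<notin> set h))"

definition latency_scale :: "nat \<Rightarrow> nat \<Rightarrow> real" where
  "latency_scale a n = real n * ln (real n) ^ a / ln (ln (real n))"

text \<open>A common consequence of both kinds of small latency. For \<open>a = 1\<close> the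
  threshold is a constant, reached by Markov's inequality; for \<open>a = 2\<close> it is of order
  \<open>n powr (- 1/2)\<close>, above \<open>1 / n ^ 2\<close> for large \<open>n\<close>.\<close>

definition fast_at :: "(nat \<Rightarrow> real) \<Rightarrow> nat \<Rightarrow> real \<Rightarrow> nat \<Rightarrow> bool" where
  "fast_at p a \<epsilon> n \<longleftrightarrow> (\<forall>wake u k. u < n \<longrightarrow> wake u = 0 \<longrightarrow> \<epsilon> * latency_scale a n < real k \<longrightarrow>
     survival p n wake u k < 1/4 * exp (- (ln (real n) ^ (a - 1) / 2)))"

lemma lnln_ge_1:
  assumes "27 \<le> x" shows "1 \<le> ln (ln (x::real))"
proof -
  have "exp (exp 1) \<le> exp (3::real)" using exp_le by simp
  also have "\<dots> = exp 1 ^ 3" using exp_of_nat_mult[of 3 "1::real"] by simp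
  also have "\<dots> \<le> 3 ^ 3" using exp_le by (intro power_mono) auto
  finally have "exp (exp 1) \<le> x" using assms by simp
  then have "ln (exp (exp 1)) \<le> ln x" by (intro ln_mono) auto
  then have "exp 1 \<le> ln x" by simp
  then have "ln (exp 1) \<le> ln (ln x)" by (intro ln_mono) auto
  then show ?thesis by simp
qed

lemma nat_ceiling_bounds:
  "0 \<le> y \<Longrightarrow> y \<le> real (nat \<lceil>y\<rceil>)" "0 \<le> y \<Longrightarrow> real (nat \<lceil>y\<rceil>) \<le> y + 1"
  by linarith+

locale fast_protocol =
  fixes p :: "nat \<Rightarrow> real" and a :: nat
  assumes p0: "\<And>i. 0 \<le> p i" and p1: "\<And>i. p i \<le> 1" and p_zero: "p 0 = 0"
    and a: "a = 1 \<or> a = 2"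
    and fast: "\<And>\<epsilon>. 0 < \<epsilon> \<Longrightarrow> eventually (fast_at p a \<epsilon>) sequentially"
begin

definition capped :: "real \<Rightarrow> nat \<Rightarrow> real" where
  "capped \<tau> i = (if p i \<le> \<tau> then p i else 0)"

definition t1 :: nat where
  "t1 = (LEAST i. p i \<noteq> 0)"

lemma ex_nonzero: "\<exists>i. p i \<noteq> 0"
proof (rule ccontr)
  assume "\<not> ?thesis"
  then have z: "p i = 0" for i by simp
  obtain N where N: "\<And>n. N \<le> n \<Longrightarrow> fast_at p a 1 n"
    using fast[of 1] by (auto simp: eventually_sequentially)
  define n where "n = Suc N"
  define wake where "wake = (\<lambda>_::nat. 0::nat)"
  \<comment> \<open>With an empty first phase, \<open>W = 0\<close>, only the late phase remains; as
    all bits are 0, its survival probability is 1.\<close>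
  interpret blocking p n wake 1 0 1 1 0 by unfold_locales (auto simp: z)
  obtain k where k: "latency_scale a n < real k" using reals_Archimedean2 by blast
  have "mean 0 (\<lambda>h. of_bool ({0} \<notin> set h)) *
      (\<Prod>s\<in>{0..<k}. 1 - (if p s \<le> 1 then p s else p s * exp (1 - 1)))
    \<le> mean k (\<lambda>h. of_bool ({0} \<notin> set h))"
    by (rule late_survival) (auto simp: n_def wake_def z)
  then have "1 \<le> survival p n wake 0 k" by (simp add: z mean_0 survival_def)
  moreover have "survival p n wake 0 k < 1/4 * exp (- (ln (real n) ^ (a - 1) / 2))"
    using N[of n] k unfolding fast_at_def n_def wake_def by auto
  moreover have "exp (- (ln (real n) ^ (a - 1) / 2)) \<le> 1" by (simp add: n_def)
  ultimately show False by simp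
qed

lemma t1: "1 \<le> t1" "\<And>i. i < t1 \<Longrightarrow> p i = 0" "0 < p t1"
proof -
  have nz: "p t1 \<noteq> 0" unfolding t1_def using ex_nonzero by (rule LeastI_ex)
  then show "0 < p t1" using p0[of t1] by simp
  show "1 \<le> t1" using nz p_zero by (cases "t1 = 0") auto
  show "p i = 0" if "i < t1" for i using not_less_Least[of i "\<lambda>i. p i \<noteq> 0"] that unfolding t1_def by auto
qed

lemma sum_p_le: "(\<Sum>i<m. p i) \<le> m"
  using sum_mono[of "{..<m}" p "\<lambda>_. 1"] p1 by simp

lemma sum_p_mono: "m \<le> k \<Longrightarrow> (\<Sum>i<m. p i) \<le> (\<Sum>i<k. p i)"
  using p0 by (intro sum_mono2) auto

lemma latency_scale_le:
  assumes "27 \<le> n" "ln (real n) \<le> X" "1 \<le> X"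
  shows "latency_scale a n \<le> n * X ^ 2"
proof -
  have l: "1 \<le> ln (ln (real n))" using assms by (intro lnln_ge_1) auto
  have "0 \<le> ln (real n)" using assms by simp
  have "latency_scale a n \<le> real n * ln (real n) ^ a / 1"
    unfolding latency_scale_def using l assms by (intro frac_le) auto
  also have "\<dots> \<le> n * X ^ a" using assms \<open>0 \<le> ln (real n)\<close> by (simp add: mult_left_mono power_mono)
  also have "\<dots> \<le> n * X ^ 2" using a assms by (intro mult_left_mono power_increasing) auto
  finally show ?thesis .
qed

text \<open>The blocked party survives to \<open>W'\<close> with probability at least
  \<open>1/2 * exp (- 2 * mass)\<close>, where the mass is the capped one on
  \<open>{W..<W'}\<close>; \<open>fast_at\<close> forbids this unless that mass is large. For
  \<open>W = W'\<close> the conclusion is absurd, so the lemma also serves to refute its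
  hypotheses.\<close>

lemma mass_gain:
  fixes M W W' g n :: nat and l \<tau> b \<epsilon> :: real
  assumes fa: "fast_at p a \<epsilon> n" and W': "\<epsilon> * latency_scale a n < W'" and n1: "1 \<le> n"
    and M: "1 \<le> M" "M \<le> W" "t1 \<le> W" "W \<le> W'"
    and tau: "0 < \<tau>" and tau_half: "W < W' \<Longrightarrow> \<tau> \<le> 1/2" and b: "1 \<le> b"
    and g: "1 \<le> g" "b \<le> g * p t1"
    and l: "0 \<le> l" "l \<le> 1" and dense: "M = W \<or> 8 * b \<le> l * (\<Sum>i<M. capped \<tau> i)"
    and rare: "W * exp (1 - b / \<tau>) \<le> 1/8"
    and small: "2 * exp (1 - b) * (\<Sum>i<W. p i) * ((2 * g + 1) * (\<Sum>i<W. p i)) \<le> \<tau>"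
    and mass: "(\<Sum>i<W'. p i) * exp (1 - b) \<le> 1/8"
    and n: "g * M + 2 * l * (W - M) + 1 + g * card {i\<in>{W..<W'}. \<tau> < p i} \<le> n"
  shows "ln (real n) ^ (a - 1) / 4 < (\<Sum>i\<in>{W..<W'}. capped \<tau> i)"
proof -
  have "\<exists>wake u. u < n \<and> wake u = 0 \<and>
    1/2 * exp (- 2 * (\<Sum>i\<in>{W..<W'}. if p i \<le> \<tau> then p i else 0))
      \<le> contention.mean p n (oblivious n wake) W' (\<lambda>h. of_bool ({u} \<notin> set h))"
    using dense unfolding capped_def
    by (intro blocking_adversary[OF p0 p1 t1(1,2) M tau tau_half b g l _ rare small mass n])
  then obtain wake u where wu: "u < n" "wake u = 0"
    "1/2 * exp (- 2 * (\<Sum>i\<in>{W..<W'}. capped \<tau> i)) \<le> survival p n wake u W'"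
    unfolding capped_def survival_def by blast
  note wu(3)
  also have "survival p n wake u W' < 1/4 * exp (- (ln (real n) ^ (a - 1) / 2))"
    using fa wu W' unfolding fast_at_def by blast
  also have "\<dots> \<le> 1/2 * exp (- (ln (real n) ^ (a - 1) / 2))" by simp
  finally show ?thesis by simp
qed

(* A mass above (log M)^4 would let the adversary sustain contention 6 log M with so few parties
   that nobody succeeds for longer than the assumed latency. *)
lemma crude_mass: "eventually (\<lambda>M. (\<Sum>i<M. p i) \<le> ln (real M) ^ 4) sequentially"
proof -
  have "eventually (\<lambda>M. 27 \<le> M) sequentially" "eventually (\<lambda>M. t1 \<le> M) sequentially"
    by (rule eventually_ge_at_top)+
  moreover have "eventually (\<lambda>M. 1 / p t1 \<le> ln (real M)) sequentially"
  proof -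
    have "filterlim (\<lambda>M. ln (real M)) at_top sequentially" by real_asymp
    then show ?thesis unfolding filterlim_at_top by blast
  qed
  moreover have "eventually (\<lambda>M. 1000 \<le> ln (real M)) sequentially"
    "eventually (\<lambda>M. ln (real M) ^ 6 + 1 \<le> real M) sequentially"
    "eventually (\<lambda>M. exp (1 - 4 * ln (real M)) \<le> 1/8) sequentially"
    "eventually (\<lambda>M. 30 * ln (real M) ^ 2 * exp (1 - 2 * ln (real M)) \<le> 1) sequentially"
    by real_asymp+
  moreover have "eventually (\<lambda>M. \<forall>n\<ge>M. fast_at p a 1 n) sequentially"
    using fast[of 1] eventually_all_ge_at_top by auto
  ultimately show ?thesis
  proof eventually_elim
    case (elim M)
    define x where "x = ln (real M)"
    define S where "S = (\<Sum>i<M. p i)"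
    show ?case
    proof (rule ccontr)
      assume "\<not> ?case"
      then have S: "x ^ 4 < S" by (simp add: x_def S_def)
      have x: "1000 \<le> x" "1 / p t1 \<le> x" "x ^ 6 + 1 \<le> M" "exp x = M"
        using elim by (auto simp: x_def)
      \<comment> \<open>The window is longer than \<open>M\<close> by a factor of about
        \<open>x ^ 6\<close>, so the cost \<open>g * M\<close> of the initial groups, with
        \<open>g \<le> 7 * x ^ 2\<close>, is at most \<open>W / x ^ 3\<close>.\<close>
      define k where "k = nat \<lceil>x ^ 6\<rceil>"
      have k: "x ^ 6 \<le> k" "k \<le> x ^ 6 + 1" using x by (auto simp: k_def)
      define W where "W = M * k"
      have x6: "1 \<le> x ^ 6" using x by (intro one_le_power) simp
      have W: "M * x ^ 6 \<le> W" using k by (simp add: W_def mult_left_mono)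
      have "real W \<le> M * (x ^ 6 + 1)" using k by (simp add: W_def mult_left_mono)
      also have "\<dots> \<le> real M * real M" using x by (intro mult_left_mono) auto
      also have "\<dots> = exp (2 * x)" unfolding x(4)[symmetric] exp_add[symmetric] by simp
      finally have We: "W \<le> exp (2 * x)" .
      have MW: "M \<le> W" using k x6 unfolding W_def by (cases k) auto
      define b where "b = 6 * x"
      define g where "g = nat \<lceil>b / p t1\<rceil>"
      have bp: "0 \<le> b / p t1" "b / p t1 \<le> 6 * x ^ 2"
        using x t1(3) mult_left_mono[of "1 / p t1" x "6 * x"] by (auto simp: b_def power2_eq_square)
      have x1: "1 \<le> x ^ 2" "x \<le> x ^ 2"
        using x(1) power_increasing[of 0 2 x] power_increasing[of 1 2 x] by auto
      have g: "b / p t1 \<le> g" "g \<le> 7 * x ^ 2"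
        using nat_ceiling_bounds[OF bp(1)] bp x1 unfolding g_def by linarith+
      have g1: "1 \<le> g"
      proof -
        have "0 < b / p t1" using x t1(3) by (simp add: b_def)
        then have "0 < real g" using g(1) by linarith
        then show ?thesis by simp
      qed
      \<comment> \<open>The density that sustains contention. A mass above \<open>x ^ 4\<close>
        makes it at most \<open>48 / x ^ 3\<close>, so \<open>n\<close> is of order
        \<open>W / x ^ 3\<close> and the latency, at most \<open>n * (2 * x) ^ 2\<close>, is below
        \<open>W\<close>: the exponent 4 comes from here.\<close>
      define l where "l = 8 * b / S"
      have x4: "0 < x ^ 4" using x by simp
      have S0: "0 < S" using S x4 by linarith
      have "l \<le> 48 * x / x ^ 4" unfolding l_def b_def using S x4 x S0 by (intro frac_le) auto
      then have l: "0 \<le> l" "l \<le> 48 / x ^ 3" using x S0 by (auto simp: l_def b_def power_def divide_simps eval_nat_numeral)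
      have x3: "1000 \<le> x ^ 3" using x x1 mult_mono[of 1000 x 1 "x ^ 2"] by (simp add: power3_eq_cube power2_eq_square mult.assoc)
      have l1: "l \<le> 1"
      proof -
        have "0 < x ^ 3" using x3 by linarith
        then have "48 / x ^ 3 \<le> 1" using x3 by (simp add: divide_le_eq)
        then show ?thesis using l by linarith
      qed
      define n where "n = nat \<lceil>g * M + 2 * l * (W - M) + 1\<rceil>"
      have nn: "0 \<le> g * M + 2 * l * (W - M) + 1" using l MW by (intro add_nonneg_nonneg mult_nonneg_nonneg) auto
      have n_ge: "g * M + 2 * l * (W - M) + 1 \<le> n" "n \<le> g * M + 2 * l * (W - M) + 2"
        using nat_ceiling_bounds[OF nn] unfolding n_def by linarith+
      note n_ge' = n_ge[unfolded of_nat_mult]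
      have Mn: "M \<le> n"
      proof -
        have "1 * real M \<le> real g * real M" using g1 by (intro mult_right_mono) auto
        moreover have "0 \<le> 2 * l * (W - M)" using l MW by simp
        ultimately have "real M \<le> n" using n_ge' by linarith
        then show ?thesis by simp
      qed
      have Wx3: "x ^ 3 * M \<le> W / x ^ 3" using W x by (simp add: field_simps eval_nat_numeral)
      have nW: "n \<le> 100 * (W / x ^ 3)"
      proof -
        have "real g * M \<le> (7 * x ^ 2) * M" using g by (intro mult_right_mono) auto
        also have "\<dots> \<le> x ^ 3 * M"
          using x by (intro mult_right_mono) (auto simp: power3_eq_cube power2_eq_square)
        finally have 1: "real g * M \<le> W / x ^ 3" using Wx3 by linarith
        have "2 * l * (W - M) \<le> 2 * (48 / x ^ 3) * W"
          using l MW x(1) by (intro mult_mono) auto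
        then have 2: "2 * l * (W - M) \<le> 96 * (W / x ^ 3)" by simp
        have "1 * 1 \<le> x ^ 3 * M" using x3 x(1) elim(1) by (intro mult_mono) auto
        then have 3: "1 \<le> W / x ^ 3" using Wx3 by linarith
        show ?thesis using 1 2 3 n_ge' by linarith
      qed
      have nW': "real n \<le> W"
      proof -
        have "real W * 100 \<le> real W * x ^ 3" using x3 by (intro mult_left_mono) auto
        then have "100 * (W / x ^ 3) \<le> W" using x(1) by (simp add: divide_simps)
        then show ?thesis using nW by linarith
      qed
      have "ln (real n) \<le> ln (exp (2 * x))"
        using nW' We Mn elim by (intro ln_mono) auto
      then have lnn: "ln (real n) \<le> 2 * x" by simp
      have "latency_scale a n \<le> n * (2 * x) ^ 2" using Mn elim lnn x by (intro latency_scale_le) auto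
      also have "\<dots> \<le> 100 * (W / x ^ 3) * (2 * x) ^ 2" using nW by (intro mult_right_mono) auto
      also have "\<dots> = 400 * (W / x)" using x by (simp add: power2_eq_square power3_eq_cube)
      also have "\<dots> < W"
      proof -
        have "0 < real W" using MW elim by linarith
        then show ?thesis using x by (simp add: divide_simps)
      qed
      finally have sc: "1 * latency_scale a n < W" by simp
      have SW: "(\<Sum>i<W. p i) \<le> exp (2 * x)" using sum_p_le[of W] We by linarith
      \<comment> \<open>The cut-off 1 excludes nothing: \<open>b = 6 * x\<close> alone beats the
        union bound over \<open>W \<le> exp (2 * x)\<close> slots. The range of ages is empty, so
        the gain is a contradiction.\<close>
      have "ln (real n) ^ (a - 1) / 4 < (\<Sum>i\<in>{W..<W}. capped 1 i)"
      proof (rule mass_gain[OF _ sc, where b=b and g=g and M=M and l=l])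
        show "fast_at p a 1 n" using elim Mn by auto
        show "1 \<le> n" "1 \<le> M" "t1 \<le> W" using elim Mn MW by auto
        show "b \<le> g * p t1" using g t1(3) by (simp add: field_simps)
        show "M = W \<or> 8 * b \<le> l * (\<Sum>i<M. capped 1 i)"
        proof -
          have "(\<Sum>i<M. capped 1 i) = S" unfolding S_def capped_def using p1 by (intro sum.cong) auto
          then show ?thesis using S0 by (simp add: l_def)
        qed
        have "W * exp (1 - b / 1) \<le> exp (2 * x) * exp (1 - b / 1)" using We by (intro mult_right_mono) auto
        also have "\<dots> = exp (1 - 4 * x)" by (simp add: b_def exp_add[symmetric])
        also have "\<dots> \<le> 1/8" using elim by (simp add: x_def)
        finally show "W * exp (1 - b / 1) \<le> 1/8" .
        have "(\<Sum>i<W. p i) * exp (1 - b) \<le> exp (2 * x) * exp (1 - b)" using SW by (intro mult_right_mono) auto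
        also have "\<dots> = exp (1 - 4 * x)" by (simp add: b_def exp_add[symmetric])
        also have "\<dots> \<le> 1/8" using elim by (simp add: x_def)
        finally show "(\<Sum>i<W. p i) * exp (1 - b) \<le> 1/8" .
        have S_0: "0 \<le> (\<Sum>i<W. p i)" using p0 by (intro sum_nonneg) auto
        have "2 * exp (1 - b) * (\<Sum>i<W. p i) * ((2 * g + 1) * (\<Sum>i<W. p i))
           \<le> 2 * exp (1 - b) * exp (2 * x) * ((15 * x ^ 2) * exp (2 * x))"
        proof -
          have "real (2 * g + 1) \<le> 15 * x ^ 2" using g x1 by simp
          then show ?thesis using SW S_0 by (intro mult_mono mult_nonneg_nonneg) auto
        qed
        also have "\<dots> = 30 * x ^ 2 * exp (1 - 2 * x)" by (simp add: b_def exp_add[symmetric])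
        also have "\<dots> \<le> 1" using elim by (simp add: x_def)
        finally show "2 * exp (1 - b) * (\<Sum>i<W. p i) * ((2 * g + 1) * (\<Sum>i<W. p i)) \<le> 1" .
        show "g * M + 2 * l * (W - M) + 1 + g * card {i\<in>{W..<W}. 1 < p i} \<le> n" using n_ge by simp
      qed (use MW l l1 g1 x in \<open>auto simp: b_def\<close>)
      moreover have "0 \<le> ln (real n) ^ (a - 1)" using Mn elim(1) by (intro zero_le_power) simp
      moreover have "(\<Sum>i\<in>{W..<W}. capped 1 i) = 0" by simp
      ultimately show False by linarith
    qed
  qed
qed

end

text \<open>Monotonicity and \<open>\<kappa> > 0\<close> force \<open>W \<le> W'\<close> in each
  step, so the iterates stay above \<open>W0\<close>; the bound \<open>Z\<close> delimits where
  steps are available.\<close>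

lemma iterate_growth:
  fixes f :: "nat \<Rightarrow> real" and Q Z \<kappa> :: real
  assumes f: "mono f" and k: "0 < \<kappa>" and Q: "1 \<le> Q"
    and step: "\<And>W. W0 \<le> W \<Longrightarrow> real W \<le> Z \<Longrightarrow> \<exists>W'. real W' \<le> Q * W \<and> f W + \<kappa> \<le> f W'"
    and Z: "Q ^ J * W0 \<le> Z"
  shows "\<exists>W\<ge>W0. real W \<le> Q ^ J * W0 \<and> f W0 + J * \<kappa> \<le> f W"
  using Z
proof (induction J)
  case (Suc J)
  have "1 * (Q ^ J * W0) \<le> Q * (Q ^ J * W0)" using Q by (intro mult_right_mono) auto
  then have "Q ^ J * W0 \<le> Q ^ Suc J * W0" by (simp add: mult.assoc)
  then have QZ: "Q ^ J * W0 \<le> Z" using Suc.prems by linarith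
  obtain W where W: "W0 \<le> W" "real W \<le> Q ^ J * W0" "f W0 + J * \<kappa> \<le> f W"
    using Suc.IH[OF QZ] by blast
  obtain W' where W': "real W' \<le> Q * W" "f W + \<kappa> \<le> f W'"
    using step[OF W(1)] W(2) QZ by force
  have "W \<le> W'"
  proof (rule ccontr)
    assume "\<not> ?thesis"
    then have "f W' \<le> f W" using f by (simp add: monoD)
    then show False using W' k by linarith
  qed
  moreover have "real W' \<le> Q ^ Suc J * W0"
  proof -
    have "Q * W \<le> Q * (Q ^ J * W0)" using W Q by (intro mult_left_mono) auto
    then show ?thesis using W'(1) by (simp add: mult.assoc)
  qed
  moreover have "f W0 + Suc J * \<kappa> \<le> f W'" using W W' by (simp add: algebra_simps)
  ultimately show ?case using W(1) by (intro exI[of _ W']) auto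
qed (intro exI[of _ W0], simp)

section \<open>Growth of the mass of small attempt probabilities\<close>

context fast_protocol
begin

definition capped_mass :: "real \<Rightarrow> nat \<Rightarrow> real" where
  "capped_mass L m = (\<Sum>i<m. capped (1 / L ^ 3) i)"

lemma capped_bounds: "0 \<le> capped \<tau> i" "capped \<tau> i \<le> p i"
  using p0 by (auto simp: capped_def)

lemma mono_low_mass: "mono (capped_mass L)"
  unfolding capped_mass_def using capped_bounds by (intro monoI sum_mono2) auto

lemma capped_mass_le: "capped_mass L m \<le> (\<Sum>i<m. p i)"
  unfolding capped_mass_def using capped_bounds by (intro sum_mono)

lemma capped_mass_nonneg: "0 \<le> capped_mass L m"
  unfolding capped_mass_def using capped_bounds by (intro sum_nonneg)

lemma capped_mass_split:
  "W \<le> W' \<Longrightarrow> capped_mass L W' = capped_mass L W + (\<Sum>i\<in>{W..<W'}. capped (1 / L ^ 3) i)"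
  unfolding capped_mass_def by (subst sum.union_disjoint[symmetric]) (auto intro!: sum.cong)

lemma eventually_threshold: "eventually (\<lambda>L. c \<le> ln (L :: real)) at_top"
proof -
  have "filterlim (\<lambda>L. ln (L::real)) at_top at_top" by (rule ln_at_top)
  then show ?thesis unfolding filterlim_at_top by blast
qed

(* The cut-off 1 / L^3 has to stay fixed while M is squared repeatedly; this is possible because
   the contradiction is reached before log M exceeds L^2. *)
definition regime :: "real \<Rightarrow> real \<Rightarrow> bool" where
  "regime \<epsilon> L \<longleftrightarrow> (\<forall>(M::nat) (W::nat) (W'::nat) (n::nat) (l::real). 1 \<le> M \<longrightarrow> M \<le> W \<longrightarrow> exp L \<le> W \<longrightarrow> W \<le> W' \<longrightarrow>
     W' \<le> exp (L ^ 2) \<longrightarrow> 0 \<le> l \<longrightarrow> l \<le> 1 \<longrightarrow> M = W \<or> 240 * ln L \<le> l * capped_mass L M \<longrightarrow>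
     L * real M + 2 * l * real W + 1 + L ^ 12 \<le> real n \<longrightarrow> \<epsilon> * latency_scale a n < W' \<longrightarrow>
     ln (real n) ^ (a - 1) / 4 < (\<Sum>i\<in>{W..<W'}. capped (1 / L ^ 3) i))"

text \<open>For \<open>W' \<le> exp (L ^ 2)\<close> the crude bound gives mass at most
  \<open>L ^ 8\<close>, so only powers of \<open>L\<close> must be beaten and
  \<open>b = 30 * ln L\<close> suffices. With cut-off \<open>1 / L ^ 3\<close> the quotient
  \<open>b / \<tau>\<close> is at least \<open>L ^ 3\<close>, which beats the \<open>L ^ 2\<close>
  from the union over slots. At most \<open>L ^ 11\<close> ages exceed the cut-off, each costing
  \<open>g \<le> L\<close> parties: hence \<open>L ^ 12\<close>.\<close>

lemma eventually_regime:
  assumes eps: "0 < \<epsilon>"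
  shows "eventually (regime \<epsilon>) at_top"
proof -
  obtain n0 where n0: "\<And>n. n0 \<le> n \<Longrightarrow> fast_at p a \<epsilon> n"
    using fast[OF eps] by (auto simp: eventually_sequentially)
  obtain m0 where m0: "\<And>M. m0 \<le> M \<Longrightarrow> (\<Sum>i<M. p i) \<le> ln (real M) ^ 4"
    using crude_mass by (auto simp: eventually_sequentially)
  have "eventually (\<lambda>L::real. real n0 \<le> L) at_top" "eventually (\<lambda>L::real. real m0 \<le> L) at_top"
    "eventually (\<lambda>L::real. real t1 \<le> L) at_top" "eventually (\<lambda>L::real. 10 \<le> L) at_top"
    by (rule eventually_ge_at_top)+
  moreover note eventually_threshold[of "1 / p t1"]
  moreover have "eventually (\<lambda>L. 30 * ln L ^ 2 + 1 \<le> (L::real)) at_top"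
    "eventually (\<lambda>L::real. 1 \<le> 30 * ln L) at_top"
    "eventually (\<lambda>L::real. exp (L ^ 2) * exp (1 - L ^ 3) \<le> 1/8) at_top"
    "eventually (\<lambda>L::real. 6 * exp (1 - 30 * ln L) * L ^ 17 \<le> 1 / L ^ 3) at_top"
    "eventually (\<lambda>L::real. L ^ 8 * exp (1 - 30 * ln L) \<le> 1/8) at_top"
    by real_asymp+
  ultimately show ?thesis
  proof eventually_elim
    case (elim L)
    show ?case
      unfolding regime_def
    proof (intro allI impI)
      fix M W W' n :: nat and l :: real
      assume M: "1 \<le> M" "M \<le> W" "exp L \<le> W" "W \<le> W'" "W' \<le> exp (L ^ 2)"
        and l: "0 \<le> l" "l \<le> 1" and dense: "M = W \<or> 240 * ln L \<le> l * capped_mass L M"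
        and n: "L * M + 2 * l * W + 1 + L ^ 12 \<le> n" and sc: "\<epsilon> * latency_scale a n < W'"
      define b where "b = 30 * ln L"
      define \<tau> where "\<tau> = 1 / L ^ 3"
      define g where "g = nat \<lceil>b / p t1\<rceil>"
      have L3: "1000 \<le> L ^ 3" using power_mono[of 10 L 3] elim by simp
      have tau: "0 < \<tau>" "\<tau> \<le> 1/2" using L3 elim by (auto simp: \<tau>_def divide_le_eq)
      have b1: "1 \<le> b" using elim by (simp add: b_def)
      have LW: "L \<le> W" using M(3) exp_ge_add_one_self[of L] by linarith
      have lnW': "0 \<le> ln W'" "ln W' \<le> L ^ 2"
      proof -
        show "0 \<le> ln W'" using M by simp
        have "ln W' \<le> ln (exp (L ^ 2))" using M by (intro ln_mono) auto
        then show "ln W' \<le> L ^ 2" by simp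
      qed
      have S: "(\<Sum>i<W'. p i) \<le> L ^ 8"
      proof -
        have "m0 \<le> W'" using LW elim(2) M(4) by linarith
        then have "(\<Sum>i<W'. p i) \<le> ln W' ^ 4" by (rule m0)
        also have "\<dots> \<le> (L ^ 2) ^ 4" using lnW' by (intro power_mono) auto
        finally show ?thesis by (simp add: power_mult[symmetric])
      qed
      have SW: "(\<Sum>i<W. p i) \<le> L ^ 8" "0 \<le> (\<Sum>i<W. p i)"
        using sum_p_mono[OF M(4)] S p0 by (auto intro: sum_nonneg)
      have bp: "0 < b / p t1" "b / p t1 \<le> 30 * ln L ^ 2"
      proof -
        show "0 < b / p t1" using b1 t1(3) by simp
        have "b * (1 / p t1) \<le> b * ln L" using elim b1 by (intro mult_left_mono) auto
        then show "b / p t1 \<le> 30 * ln L ^ 2" by (simp add: b_def power2_eq_square)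
      qed
      have g: "b / p t1 \<le> g" "g \<le> L"
        using nat_ceiling_bounds[of "b / p t1"] bp elim(6) unfolding g_def by linarith+
      have "0 < real g" using bp(1) g(1) by linarith
      then have g1: "1 \<le> g" by simp
      show "ln (real n) ^ (a - 1) / 4 < (\<Sum>i\<in>{W..<W'}. capped (1 / L ^ 3) i)"
        unfolding \<tau>_def[symmetric]
      proof (rule mass_gain[OF _ sc, where b=b and g=g and M=M and l=l])
        have "0 \<le> L * M + 2 * l * W" using elim l by simp
        moreover have "L * 1 \<le> L ^ 12" using elim power_increasing[of 1 12 L] by simp
        ultimately have "L \<le> n" using n by linarith
        then have "real n0 \<le> n" "1 \<le> real n" using elim by linarith+
        then show "fast_at p a \<epsilon> n" "1 \<le> n" using n0 by auto
        show "t1 \<le> W" using LW elim(3) by linarith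
        show "b \<le> g * p t1" using g t1(3) by (simp add: field_simps)
        show "M = W \<or> 8 * b \<le> l * (\<Sum>i<M. capped \<tau> i)" using dense by (simp add: b_def capped_mass_def \<tau>_def)
        have "W * exp (1 - b / \<tau>) \<le> exp (L ^ 2) * exp (1 - L ^ 3)"
        proof (rule mult_mono)
          have "1 * L ^ 3 \<le> b * L ^ 3" using b1 L3 elim(4) by (intro mult_right_mono) auto
          then show "exp (1 - b / \<tau>) \<le> exp (1 - L ^ 3)" by (simp add: \<tau>_def)
        qed (use M in auto)
        then show "W * exp (1 - b / \<tau>) \<le> 1/8" using elim by linarith
        have "(\<Sum>i<W'. p i) * exp (1 - b) \<le> L ^ 8 * exp (1 - b)" using S by (intro mult_right_mono) auto
        then show "(\<Sum>i<W'. p i) * exp (1 - b) \<le> 1/8" using elim unfolding b_def by linarith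
        have g3: "real (2 * g + 1) \<le> 3 * L" using g elim by simp
        have "2 * exp (1 - b) * (\<Sum>i<W. p i) * ((2 * g + 1) * (\<Sum>i<W. p i))
            \<le> 2 * exp (1 - b) * L ^ 8 * ((3 * L) * L ^ 8)"
          using g3 SW elim by (intro mult_mono mult_nonneg_nonneg) auto
        also have "\<dots> = 6 * exp (1 - b) * L ^ 17" by (simp add: power_add[symmetric] eval_nat_numeral)
        finally show "2 * exp (1 - b) * (\<Sum>i<W. p i) * ((2 * g + 1) * (\<Sum>i<W. p i)) \<le> \<tau>"
          using elim unfolding b_def \<tau>_def by linarith
        have "card {i\<in>{W..<W'}. \<tau> < p i} * \<tau> = (\<Sum>i\<in>{i\<in>{W..<W'}. \<tau> < p i}. \<tau>)" by simp
        also have "\<dots> \<le> (\<Sum>i\<in>{i\<in>{W..<W'}. \<tau> < p i}. p i)" by (intro sum_mono) auto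
        also have "\<dots> \<le> (\<Sum>i<W'. p i)" using p0 by (intro sum_mono2) auto
        also have "\<dots> \<le> L ^ 8" by (rule S)
        finally have "real (card {i\<in>{W..<W'}. \<tau> < p i}) \<le> L ^ 8 * L ^ 3"
        proof -
          have L3p: "0 < L ^ 3" using L3 by linarith
          assume "card {i\<in>{W..<W'}. \<tau> < p i} * \<tau> \<le> L ^ 8"
          then have "real (card {i\<in>{W..<W'}. \<tau> < p i}) / L ^ 3 \<le> L ^ 8"
            unfolding \<tau>_def by simp
          then show ?thesis unfolding pos_divide_le_eq[OF L3p] .
        qed
        then have "g * card {i\<in>{W..<W'}. \<tau> < p i} \<le> L * (L ^ 8 * L ^ 3)"
          using g elim by (subst of_nat_mult) (intro mult_mono, auto)
        also have "\<dots> = L ^ 12" by (simp add: power_add[symmetric] eval_nat_numeral)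
        finally have 1: "real g * real (card {i\<in>{W..<W'}. \<tau> < p i}) \<le> L ^ 12" by simp
        have 2: "real g * M \<le> L * M" using g by (intro mult_right_mono) auto
        have 3: "2 * l * (W - M) \<le> 2 * l * W" using l by (intro mult_left_mono) auto
        show "g * M + 2 * l * (W - M) + 1 + g * card {i\<in>{W..<W'}. \<tau> < p i} \<le> n"
          unfolding of_nat_mult using 1 2 3 n by linarith
      qed (use M l g1 b1 tau in auto)
    qed
  qed
qed

text \<open>Until the mass permits a density \<open>l \<le> 1\<close>, groups are woken in every
  slot (\<open>M = W\<close>, \<open>l = 0\<close>). This wastes powers of \<open>L\<close>, yet
  each factor \<open>L ^ 5\<close> in \<open>W\<close> still forces a gain of 1/4, and enough such
  factors fit between \<open>exp L\<close> and \<open>exp (2 * L)\<close>.\<close>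

lemma eventually_initial_mass:
  "eventually (\<lambda>L. 240 * ln L \<le> capped_mass L (nat \<lceil>exp (2 * L)\<rceil>)) at_top"
proof -
  have "eventually (regime 1) at_top" by (rule eventually_regime) simp
  moreover have "eventually (\<lambda>L::real. 20 \<le> L) at_top"
    "eventually (\<lambda>L::real. L ^ 12 + 2 \<le> exp L) at_top"
    "eventually (\<lambda>L::real. 2 * L \<le> exp L) at_top"
    "eventually (\<lambda>L::real. L ^ 5 * exp (2 * L) \<le> exp (L ^ 2)) at_top"
    "eventually (\<lambda>L::real. 960 * ln L \<le> (L - 1) / (5 * ln L) - 1) at_top"
    by real_asymp+
  ultimately show ?thesis
  proof eventually_elim
    case (elim L)
    have reg: "regime 1 L" and L: "20 \<le> L" using elim by auto
    have lnL: "0 < ln L" using L by simp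
    define W0 where "W0 = nat \<lceil>exp L\<rceil>"
    have W0: "exp L \<le> W0" "W0 \<le> exp L + 1" using nat_ceiling_bounds[of "exp L"] by (auto simp: W0_def)
    \<comment> \<open>One unit of the exponent is reserved for rounding up \<open>W0\<close>. As
      each step gains 1/4, a mass of \<open>240 * ln L\<close> needs \<open>960 * ln L\<close>
      steps.\<close>
    define J where "J = nat \<lfloor>(L - 1) / (5 * ln L)\<rfloor>"
    have J: "J \<le> (L - 1) / (5 * ln L)" "(L - 1) / (5 * ln L) - 1 \<le> J"
    proof -
      have "0 \<le> (L - 1) / (5 * ln L)" using L lnL by simp
      then show "J \<le> (L - 1) / (5 * ln L)" "(L - 1) / (5 * ln L) - 1 \<le> J" unfolding J_def by linarith+
    qed
    have "(L ^ 5) ^ J * W0 \<le> exp (L - 1) * (exp L * exp 1)"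
    proof (rule mult_mono)
      have "(L ^ 5) ^ J = exp (real J * (5 * ln L))"
      proof -
        have "exp (real J * (5 * ln L)) = exp (ln L) ^ (5 * J)"
          by (simp add: exp_of_nat_mult[symmetric] mult_ac)
        then show ?thesis using L by (simp add: power_mult)
      qed
      also have "\<dots> \<le> exp (L - 1)" using J(1) lnL by (simp add: le_divide_eq)
      finally show "(L ^ 5) ^ J \<le> exp (L - 1)" .
      have "exp L * 2 \<le> exp L * exp 1" using exp_ge_add_one_self[of "1::real"] by (intro mult_left_mono) auto
      moreover have "1 \<le> exp L" using L by simp
      ultimately show "W0 \<le> exp L * exp 1" using W0(2) by linarith
    qed auto
    also have "\<dots> = exp (2 * L)" by (simp add: exp_add[symmetric])
    finally have QJ: "(L ^ 5) ^ J * W0 \<le> exp (2 * L)" .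
    have L5: "1 \<le> L ^ 5" using L by (intro one_le_power) auto
    have "\<exists>W\<ge>W0. real W \<le> (L ^ 5) ^ J * W0 \<and> capped_mass L W0 + J * (1/4) \<le> capped_mass L W"
    proof (rule iterate_growth[OF mono_low_mass _ L5 _ QJ])
      fix W assume "W0 \<le> W" and W2: "real W \<le> exp (2 * L)"
      then have W: "exp L \<le> W" using W0(1) by linarith
      have W1: "1 \<le> real W" using W L exp_ge_add_one_self[of L] by linarith
      define n where "n = nat \<lceil>L * W + 1 + L ^ 12\<rceil>"
      have "0 \<le> L * W + 1 + L ^ 12" using L by (intro add_nonneg_nonneg) auto
      note n = nat_ceiling_bounds[OF this, folded n_def]
      have LW: "1 * real W \<le> L * W" using L by (intro mult_right_mono) auto
      have n2: "n \<le> 2 * (L * W)" using n(2) elim(3) W LW by linarith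
      have n27: "27 \<le> n" and n_exp: "exp L \<le> n"
      proof -
        have "0 \<le> L ^ 12" using L by simp
        moreover have "20 \<le> real W" using L W exp_ge_add_one_self[of L] by linarith
        then have "20 * 20 \<le> L * W" using L by (intro mult_mono) auto
        ultimately have "27 \<le> real n" "exp L \<le> real n" using n(1) LW W by linarith+
        then show "27 \<le> n" "exp L \<le> n" by auto
      qed
      have lnn: "ln (real n) \<le> 3 * L"
      proof -
        have "real n \<le> 2 * L * W" using n2 by simp
        also have "\<dots> \<le> exp L * exp (2 * L)" using elim W2 L by (intro mult_mono) auto
        also have "\<dots> = exp (3 * L)" by (simp add: exp_add[symmetric])
        finally have "ln (real n) \<le> ln (exp (3 * L))" using n27 by (intro ln_mono) auto
        then show ?thesis by simp
      qed
      have lnn1: "1 \<le> ln (real n)"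
      proof -
        have "ln (exp L) \<le> ln (real n)" using n_exp by (intro ln_mono) auto
        then show ?thesis using L by simp
      qed
      \<comment> \<open>From \<open>n \<le> 2 * L * W\<close> and \<open>ln n \<le> 3 * L\<close>
        the latency scale is at most \<open>18 * L ^ 3 * W\<close>, below
        \<open>L ^ 4 * W\<close>.\<close>
      define W' where "W' = nat \<lceil>L ^ 4 * W\<rceil>"
      have "0 \<le> L ^ 4 * W" using L by simp
      note W' = nat_ceiling_bounds[OF this, folded W'_def]
      have L4W: "1 \<le> L ^ 4 * W"
        using mult_mono[of 1 "L ^ 4" 1 "real W"] W1 L one_le_power[of L 4] by simp
      have W'5: "W' \<le> L ^ 5 * W"
      proof -
        have "2 * (L ^ 4 * W) \<le> L * (L ^ 4 * W)" using L L4W by (intro mult_right_mono) auto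
        then show ?thesis using W' L4W by (simp add: eval_nat_numeral mult.assoc)
      qed
      have WW': "W \<le> W'"
      proof -
        have "1 * real W \<le> L ^ 4 * W" using L one_le_power[of L 4] by (intro mult_right_mono) auto
        then have "real W \<le> W'" using W' by linarith
        then show ?thesis by simp
      qed
      have "latency_scale a n \<le> n * (3 * L) ^ 2" using n27 lnn L by (intro latency_scale_le) auto
      also have "\<dots> \<le> 2 * (L * W) * (3 * L) ^ 2" using n2 by (intro mult_right_mono) auto
      also have "\<dots> = 18 * (L ^ 3 * W)" by (simp add: power2_eq_square power3_eq_cube)
      also have "\<dots> < L * (L ^ 3 * W)" using L W1 by (intro mult_strict_right_mono mult_pos_pos) auto
      also have "\<dots> = L ^ 4 * W" by (simp add: eval_nat_numeral)
      finally have sc: "1 * latency_scale a n < W'" using W' by linarith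
      have "ln (real n) ^ (a - 1) / 4 < (\<Sum>i\<in>{W..<W'}. capped (1 / L ^ 3) i)"
      proof (rule reg[unfolded regime_def, rule_format, where M=W and l=0 and W'=W' and n=n])
        show "W' \<le> exp (L ^ 2)"
        proof -
          have "L ^ 5 * W \<le> L ^ 5 * exp (2 * L)" using W2 L by (intro mult_left_mono) auto
          then show ?thesis using W'5 elim by linarith
        qed
        show "1 \<le> W" using W1 by simp
        show "L * real W + 2 * 0 * real W + 1 + L ^ 12 \<le> real n" using n(1) by simp
      qed (use W WW' sc in auto)
      moreover have "1 / 4 \<le> ln (real n) ^ (a - 1) / 4" using lnn1 by (simp add: one_le_power)
      ultimately have "capped_mass L W + 1/4 \<le> capped_mass L W'"
        using capped_mass_split[OF WW', of L] by linarith
      then show "\<exists>W'. real W' \<le> L ^ 5 * W \<and> capped_mass L W + 1/4 \<le> capped_mass L W'"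
        using W'5 by blast
    qed simp
    then obtain W where W: "real W \<le> (L ^ 5) ^ J * W0" "capped_mass L W0 + J * (1/4) \<le> capped_mass L W" by blast
    have "W \<le> nat \<lceil>exp (2 * L)\<rceil>" using W(1) QJ by linarith
    then have "capped_mass L W \<le> capped_mass L (nat \<lceil>exp (2 * L)\<rceil>)" by (rule monoD[OF mono_low_mass])
    moreover have "960 * ln L \<le> J" using J elim by linarith
    ultimately show ?case using W(2) capped_mass_nonneg[of L W0] by linarith
  qed
qed

end

context fast_protocol
begin

text \<open>With density \<open>l = 240 * ln L / s\<close> at most \<open>4 * l * W\<close> parties
  are needed, and the \<open>ln L\<close> in \<open>l\<close> cancels against
  \<open>ln (ln n)\<close> in the latency scale: the assumed latency is at most \<open>q * W\<close>
  with \<open>q\<close> of order \<open>\<epsilon> * x ^ a / s\<close>. Each factor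
  \<open>Q = 2 * q\<close> in \<open>W\<close> gains \<open>x ^ (a - 1) / 4\<close>, and at least
  \<open>x / (2 * Q)\<close> such factors fit below \<open>M ^ 2\<close>.\<close>

lemma eventually_doubling:
  "eventually (\<lambda>L. \<forall>M. exp (2 * L) \<le> real M \<longrightarrow> 3 * ln (real M) \<le> L ^ 2 \<longrightarrow>
     240 * ln L \<le> capped_mass L M \<longrightarrow> 4096 * capped_mass L M \<le> capped_mass L (M ^ 2)) at_top"
proof -
  \<comment> \<open>This is \<open>960 * 9\<close>: 960 from \<open>n \<le> 4 * l * W\<close> and
    the 240 in \<open>l\<close>, 9 from \<open>(3 * x) ^ a \<le> 9 * x ^ a\<close>. Then
    \<open>\<epsilon>\<close> is set so that the total gain \<open>x ^ a / (16 * q)\<close> equals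
    \<open>4096 * s\<close>.\<close>
  define C :: real where "C = 8640"
  define \<epsilon> :: real where "\<epsilon> = 1 / (16 * 4096 * C)"
  have eps: "0 < \<epsilon>" "C * \<epsilon> = 1 / (16 * 4096)" by (simp_all add: \<epsilon>_def C_def)
  obtain m0 where m0: "\<And>M. m0 \<le> M \<Longrightarrow> (\<Sum>i<M. p i) \<le> ln (real M) ^ 4"
    using crude_mass by (auto simp: eventually_sequentially)
  have "eventually (\<lambda>x::real. ln (2 * x ^ 2) \<le> x / 4 \<and> 2 * x ^ 2 \<le> exp x) at_top"
    by (intro eventually_conj) real_asymp+
  then obtain x0 :: real where "\<forall>x\<ge>x0. ln (2 * x ^ 2) \<le> x / 4 \<and> 2 * x ^ 2 \<le> exp x"
    unfolding eventually_at_top_linorder by blast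
  then have x0: "\<And>x. x0 \<le> x \<Longrightarrow> ln (2 * x ^ 2) \<le> x / 4" "\<And>x. x0 \<le> x \<Longrightarrow> 2 * x ^ 2 \<le> exp x"
    by blast+
  have "eventually (regime \<epsilon>) at_top" by (rule eventually_regime[OF eps(1)])
  moreover have "eventually (\<lambda>L::real. real m0 \<le> L) at_top" "eventually (\<lambda>L::real. x0 \<le> L) at_top"
    "eventually (\<lambda>L::real. 100 \<le> L) at_top"
    by (rule eventually_ge_at_top)+
  moreover have "eventually (\<lambda>L::real. L ^ 12 + 2 \<le> exp L) at_top"
    "eventually (\<lambda>L::real. 24 * ln L \<le> L) at_top"
    "eventually (\<lambda>L::real. 1 \<le> ln L) at_top"
    by real_asymp+
  ultimately show ?thesis
  proof eventually_elim
    case (elim L)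
    have reg: "regime \<epsilon> L" and L: "100 \<le> L" and lnL: "1 \<le> ln L" using elim by auto
    show ?case
    proof (intro allI impI)
      fix M :: nat
      assume M: "exp (2 * L) \<le> real M" "3 * ln (real M) \<le> L ^ 2" and sM: "240 * ln L \<le> capped_mass L M"
      define x where "x = ln (real M)"
      define s where "s = capped_mass L M"
      define l where "l = 240 * ln L / s"
      define q where "q = C * \<epsilon> * x ^ a / s"
      have M0: "0 < real M" using M(1) by (rule less_le_trans[rotated]) simp
      have ex: "exp x = M" using M0 by (simp add: x_def)
      have x2L: "2 * L \<le> x"
      proof -
        have "ln (exp (2 * L)) \<le> x" unfolding x_def using M by (intro ln_mono) auto
        then show ?thesis by simp
      qed
      have x: "200 \<le> x" "L \<le> x" "x0 \<le> x" using x2L L elim by linarith+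
      have eL: "exp L \<le> M"
      proof -
        have "exp L \<le> exp (2 * L)" using L by simp
        then show ?thesis using M by linarith
      qed
      have s1: "240 \<le> s" "240 * ln L \<le> s" using sM lnL unfolding s_def by linarith+
      have s8: "s \<le> L ^ 8"
      proof -
        have "m0 \<le> M" using elim(2) eL exp_ge_add_one_self[of L] by linarith
        then have "s \<le> x ^ 4" unfolding s_def x_def using order_trans[OF capped_mass_le m0] by blast
        also have "\<dots> \<le> (L ^ 2) ^ 4" using M(2) x by (intro power_mono) (auto simp: x_def)
        finally show ?thesis by (simp add: power_mult[symmetric])
      qed
      have l: "0 \<le> l" "l \<le> 1" using s1 lnL by (auto simp: l_def)
      have L8: "0 < L ^ 8" "0 < L ^ 10" using L by simp_all
      have l8: "240 / L ^ 8 \<le> l"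
        unfolding l_def using s1 s8 lnL L8 by (intro frac_le) auto
      \<comment> \<open>As \<open>s \<le> L ^ 8\<close> bounds \<open>l\<close> from below, starting
        at \<open>M * L ^ 10\<close> makes \<open>l * W\<close> dominate \<open>L * M\<close> and
        \<open>L ^ 12\<close> in the party count.\<close>
      have gain: "x ^ (a - 1) / 4 < (\<Sum>i\<in>{W..<W'}. capped (1 / L ^ 3) i)"
        if W: "M * L ^ 10 \<le> real W" "real W \<le> real M * M" "W \<le> W'" "W' \<le> exp (L ^ 2)" "q * W < W'"
        for W W' :: nat
      proof -
        define y where "y = l * W"
        define n where "n = nat \<lceil>L * M + 2 * l * W + 1 + L ^ 12\<rceil>"
        have "0 \<le> L * M + 2 * l * W + 1 + L ^ 12" using L l by (intro add_nonneg_nonneg mult_nonneg_nonneg) auto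
        note n = nat_ceiling_bounds[OF this, folded n_def]
        have y8: "240 * (W / L ^ 8) \<le> y"
        proof -
          have "240 / L ^ 8 * W \<le> l * W" using l8 by (intro mult_right_mono) auto
          then show ?thesis by (simp add: y_def)
        qed
        have "M * L ^ 2 * L ^ 8 \<le> W" using W(1) by (simp add: power_add[symmetric] mult.assoc)
        then have WL: "M * L ^ 2 \<le> W / L ^ 8" by (simp only: pos_le_divide_eq[OF L8(1)])
        have LM: "L * M \<le> M * L ^ 2" "1 * real M \<le> M * L ^ 2"
        proof -
          have "M * L * 1 \<le> M * L * L" using L by (intro mult_left_mono) auto
          then show "L * M \<le> M * L ^ 2" by (simp add: power2_eq_square mult_ac)
          have "1 \<le> L ^ 2" using L by simp
          then have "real M * 1 \<le> M * L ^ 2" by (intro mult_left_mono) auto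
          then show "1 * real M \<le> M * L ^ 2" by simp
        qed
        have MW: "M \<le> W"
        proof -
          have "1 \<le> L ^ 10" using L by (intro one_le_power) auto
          then have "real M * 1 \<le> M * L ^ 10" by (intro mult_left_mono) auto
          then have "real M \<le> W" using W(1) by linarith
          then show ?thesis by simp
        qed
        have n4: "n \<le> 4 * y" using n(2) y8 WL LM eL elim(5) unfolding y_def by linarith
        have nM: "M \<le> real n"
        proof -
          have "0 \<le> L * M" "0 \<le> L ^ 12" using L by auto
          then show ?thesis using n(1) y8 WL LM unfolding y_def by linarith
        qed
        have lnn: "x \<le> ln (real n)" unfolding x_def using nM M0 by (intro ln_mono) auto
        have lnn3: "ln (real n) \<le> 3 * x"
        proof -
          have "y \<le> 1 * real W" unfolding y_def using l by (intro mult_right_mono) auto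
          then have "n \<le> 4 * (real M * M)" using n4 W by linarith
          also have "\<dots> = 4 * exp (2 * x)" by (simp add: ex[symmetric] exp_add[symmetric])
          also have "\<dots> \<le> exp x * exp (2 * x)"
        proof (rule mult_right_mono)
          show "4 \<le> exp x" using x(1) exp_ge_add_one_self[of x] by linarith
        qed simp
          also have "\<dots> = exp (3 * x)" by (simp add: exp_add[symmetric])
          finally have "ln (real n) \<le> ln (exp (3 * x))" using nM M0 by (intro ln_mono) auto
          then show ?thesis by simp
        qed
        have lnln: "ln L \<le> ln (ln (real n))" using x lnn L by (intro ln_mono) auto
        have "latency_scale a n \<le> (4 * y) * (3 * x) ^ a / ln L"
          unfolding latency_scale_def
        proof (rule frac_le)
          have "ln (real n) ^ a \<le> (3 * x) ^ a" using lnn3 lnn x by (intro power_mono) auto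
          moreover have "0 \<le> 4 * y" using n4 by (rule order_trans[rotated]) simp
          ultimately show "real n * ln (real n) ^ a \<le> (4 * y) * (3 * x) ^ a"
            using n4 lnn x by (intro mult_mono) auto
          show "0 \<le> 4 * y * (3 * x) ^ a" using \<open>0 \<le> 4 * y\<close> x by (intro mult_nonneg_nonneg) auto
          show "0 < ln L" "ln L \<le> ln (ln (real n))" using lnL lnln by linarith+
        qed
        also have "\<dots> = 960 * (W * (3 * x) ^ a / s)" using lnL by (simp add: y_def l_def)
        also have "\<dots> \<le> 960 * (9 * (W * x ^ a / s))"
        proof -
          have "(3 * x) ^ a \<le> 9 * x ^ a" using a x by (auto simp: power_mult_distrib)
          then have "W * (3 * x) ^ a / s \<le> W * (9 * x ^ a) / s"
            using s1 by (intro divide_right_mono mult_left_mono) auto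
          then show ?thesis by simp
        qed
        finally have "\<epsilon> * latency_scale a n \<le> \<epsilon> * (960 * (9 * (W * x ^ a / s)))"
          using eps by (intro mult_left_mono) auto
        also have "\<dots> = q * W" by (simp add: q_def C_def)
        finally have sc: "\<epsilon> * latency_scale a n < W'" using W(5) by linarith
        have "ln (real n) ^ (a - 1) / 4 < (\<Sum>i\<in>{W..<W'}. capped (1 / L ^ 3) i)"
        proof (rule reg[unfolded regime_def, rule_format, where M=M and l=l and W'=W' and n=n])
          show "exp L \<le> W" using eL MW by linarith
          show "M = W \<or> 240 * ln L \<le> l * capped_mass L M" using s1 by (simp add: l_def s_def)
          show "L * real M + 2 * l * real W + 1 + L ^ 12 \<le> real n" using n(1) .
        qed (use W MW l M0 sc in auto)
        moreover have "x ^ (a - 1) \<le> ln (real n) ^ (a - 1)" using lnn x by (intro power_mono) auto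
        ultimately show ?thesis by linarith
      qed
      have xa1: "0 < x ^ (a - 1)" using x by simp
      define W0 where "W0 = nat \<lceil>M * L ^ 10\<rceil>"
      have "0 \<le> M * L ^ 10" using L by simp
      note W0 = nat_ceiling_bounds[OF this, folded W0_def]
      have MLp: "M * L ^ 10 + 1 \<le> M * L ^ 11"
      proof -
        have "1 * 1 \<le> real M * L ^ 10" using M0 L one_le_power[of L 10] by (intro mult_mono) auto
        then have "2 * (M * L ^ 10) \<le> L * (M * L ^ 10)" "1 \<le> M * L ^ 10" using L by (auto intro!: mult_right_mono)
        then show ?thesis by (simp add: eval_nat_numeral mult_ac)
      qed
      have LM12: "L ^ 12 \<le> M" using elim(5) eL by linarith
      have L11: "L ^ 11 \<le> M" using power_increasing[of 11 12 L] L LM12 by linarith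
      have W0M: "real W0 \<le> real M * M"
      proof -
        have "M * L ^ 11 \<le> real M * M" using L11 by (intro mult_left_mono) auto
        then show ?thesis using W0(2) MLp by linarith
      qed
      have e3: "exp (3 * x) \<le> exp (L ^ 2)" using M(2) by (simp add: x_def)
      have MMM: "real M * M \<le> exp (L ^ 2)"
      proof -
        have "real M * M = exp (2 * x)" by (simp add: ex[symmetric] exp_add[symmetric])
        also have "\<dots> \<le> exp (3 * x)" using x by simp
        finally show ?thesis using e3 by linarith
      qed
      \<comment> \<open>For \<open>q < 1\<close> the choice \<open>W' = W\<close> would be
        admissible, and an empty range of ages would have positive mass.\<close>
      have q1: "1 \<le> q"
      proof (rule ccontr)
        assume "\<not> ?thesis"
        moreover have "0 < real W0" using W0(1) M0 L8 by (meson less_le_trans mult_pos_pos)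
        ultimately have "q * W0 < W0" by simp
        then have "x ^ (a - 1) / 4 < (\<Sum>i\<in>{W0..<W0}. capped (1 / L ^ 3) i)"
          using W0(1) W0M MMM by (intro gain) auto
        moreover have "(\<Sum>i\<in>{W0..<W0}. capped (1 / L ^ 3) i) = 0" by simp
        ultimately show False using xa1 by linarith
      qed
      have qx: "q \<le> x ^ 2"
      proof -
        have "q \<le> C * \<epsilon> * x ^ a / 1" unfolding q_def using s1 eps x by (intro divide_left_mono) auto
        also have "\<dots> \<le> 1 * x ^ a / 1" using eps x by (intro divide_right_mono mult_right_mono) auto
        also have "\<dots> \<le> x ^ 2" using a x by auto
        finally show ?thesis .
      qed
      define Q where "Q = 2 * q"
      have Q2: "2 \<le> Q" using q1 by (simp add: Q_def)
      have lnQ: "0 < ln Q" "ln Q \<le> Q" "ln Q \<le> x / 4"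
      proof -
        show "0 < ln Q" using Q2 by simp
        show "ln Q \<le> Q" using Q2 ln_le_minus_one[of Q] by linarith
        have "ln Q \<le> ln (2 * x ^ 2)" using Q2 qx by (intro ln_mono) (auto simp: Q_def)
        then show "ln Q \<le> x / 4" using x0(1)[of x] x by linarith
      qed
      \<comment> \<open>The term \<open>12 * ln L\<close> accounts for the start at
        \<open>W0 \<le> M * L ^ 12\<close>; the remaining room up to \<open>M ^ 2\<close> is
        \<open>exp (x - 12 * ln L)\<close>.\<close>
      define J where "J = nat \<lfloor>(x - 12 * ln L) / ln Q\<rfloor>"
      have lnLx: "12 * ln L \<le> x / 4" using elim(6) x2L by linarith
      have "0 \<le> (x - 12 * ln L) / ln Q" using lnQ lnLx x by (intro divide_nonneg_pos) auto
      then have J: "J \<le> (x - 12 * ln L) / ln Q" "(x - 12 * ln L) / ln Q - 1 \<le> J"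
        unfolding J_def by linarith+
      have QJ: "Q ^ J * W0 \<le> real M * M"
      proof -
        have "Q ^ J = exp (real J * ln Q)" using Q2 by (simp add: exp_of_nat_mult)
        also have "\<dots> \<le> exp (x - 12 * ln L)" using J(1) lnQ by (simp add: le_divide_eq)
        also have "\<dots> = M / L ^ 12"
        proof -
          have "exp (12 * ln L) = L ^ 12" using exp_of_nat_mult[of 12 "ln L"] L by simp
          then show ?thesis by (simp add: exp_diff ex)
        qed
        finally have "Q ^ J * W0 \<le> M / L ^ 12 * (M * L ^ 12)"
        proof (rule mult_mono)
          have "L ^ 11 \<le> L ^ 12" using L by (intro power_increasing) auto
          then have "M * L ^ 11 \<le> M * L ^ 12" by (intro mult_left_mono) auto
          then show "W0 \<le> M * L ^ 12" using W0(2) MLp by linarith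
        qed auto
        also have "\<dots> = real M * M" using L by simp
        finally show ?thesis .
      qed
      have "\<exists>W\<ge>W0. real W \<le> Q ^ J * W0 \<and> capped_mass L W0 + J * (x ^ (a - 1) / 4) \<le> capped_mass L W"
      proof (rule iterate_growth[OF mono_low_mass _ _ _ QJ])
        fix W assume W: "W0 \<le> W" "real W \<le> real M * M"
        define W' where "W' = Suc (nat \<lfloor>q * W\<rfloor>)"
        have qW: "1 * real W \<le> q * W" using q1 by (intro mult_right_mono) auto
        have "0 < real W0" using W0(1) M0 L8 by (meson less_le_trans mult_pos_pos)
        then have W1: "1 \<le> real W" using W by simp
        have W': "q * W < W'" "W' \<le> q * W + 1" using qW W1 unfolding W'_def by linarith+
        have WW': "W \<le> W'" using W' qW by linarith
        have "Q * W = 2 * (q * W)" by (simp add: Q_def)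
        then have W'Q: "W' \<le> Q * W" using W'(2) qW W1 by linarith
        have "Q * W \<le> (2 * x ^ 2) * (real M * M)" using W qx Q2 by (intro mult_mono) (auto simp: Q_def)
        also have "\<dots> \<le> exp x * (real M * M)" using x0(2)[of x] x by (intro mult_right_mono) auto
        also have "\<dots> = exp (3 * x)" by (simp add: ex[symmetric] exp_add[symmetric])
        finally have "W' \<le> exp (L ^ 2)" using W'Q e3 by linarith
        then have "x ^ (a - 1) / 4 < (\<Sum>i\<in>{W..<W'}. capped (1 / L ^ 3) i)"
          using W W0(1) WW' W' by (intro gain) auto
        then have "capped_mass L W + x ^ (a - 1) / 4 \<le> capped_mass L W'"
          using capped_mass_split[OF WW', of L] by linarith
        then show "\<exists>W'. real W' \<le> Q * W \<and> capped_mass L W + x ^ (a - 1) / 4 \<le> capped_mass L W'"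
          using W'Q by blast
      qed (use Q2 xa1 in auto)
      then obtain W where W: "real W \<le> Q ^ J * W0" "capped_mass L W0 + J * (x ^ (a - 1) / 4) \<le> capped_mass L W"
        by blast
      have "real W \<le> real (M ^ 2)" using W(1) QJ by (simp add: power2_eq_square)
      then have "W \<le> M ^ 2" by (simp only: of_nat_le_iff)
      then have "capped_mass L W \<le> capped_mass L (M ^ 2)" by (rule monoD[OF mono_low_mass])
      then have fin: "J * (x ^ (a - 1) / 4) \<le> capped_mass L (M ^ 2)"
        using W(2) capped_mass_nonneg[of L W0] by linarith
      \<comment> \<open>The crude \<open>ln Q \<le> Q\<close> is affordable, since
        \<open>1 / Q\<close> carries the factor \<open>s / \<epsilon>\<close> that produces the
        growth.\<close>
      have "x / (2 * Q) \<le> x / (2 * ln Q)" using lnQ x by (intro divide_left_mono) auto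
      also have "\<dots> \<le> (x - 12 * ln L) / ln Q - 1"
      proof -
        have "x / 2 \<le> x - 12 * ln L - ln Q" using lnLx lnQ(3) by linarith
        then have "x / 2 / ln Q \<le> (x - 12 * ln L - ln Q) / ln Q"
          by (rule divide_right_mono) (use lnQ in linarith)
        moreover have "ln Q / ln Q = 1" by (rule divide_self) (use lnQ in linarith)
        then have "(x - 12 * ln L - ln Q) / ln Q = (x - 12 * ln L) / ln Q - 1"
          by (simp only: diff_divide_distrib[of "x - 12 * ln L"])
        ultimately show ?thesis by simp
      qed
      finally have "x / (2 * Q) \<le> J" using J by linarith
      then have "x / (2 * Q) * (x ^ (a - 1) / 4) \<le> J * (x ^ (a - 1) / 4)"
        using xa1 by (intro mult_right_mono) auto
      moreover have "x / (2 * Q) * (x ^ (a - 1) / 4) = 4096 * s"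
      proof -
        have xa: "x * x ^ (a - 1) = x ^ a" using a by (auto simp: power2_eq_square)
        have "x / (2 * Q) * (x ^ (a - 1) / 4) = (x * x ^ (a - 1)) / (16 * q)" by (simp add: Q_def)
        also have "\<dots> = x ^ a / (16 * (C * \<epsilon> * x ^ a / s))" unfolding xa q_def ..
        also have "\<dots> = 4096 * s" unfolding eps(2) using x s1 by simp
        finally show ?thesis .
      qed
      ultimately show "4096 * capped_mass L M \<le> capped_mass L (M ^ 2)" using fin unfolding s_def by linarith
    qed
  qed
qed

text \<open>Squaring \<open>M\<close> doubles \<open>ln M\<close>, so after \<open>i\<close>
  squarings a mass above \<open>4096 ^ i = (2 ^ i * 4 ^ i) ^ 4\<close> meets the crude bound
  \<open>(2 ^ i * (3 * L)) ^ 4\<close>. The factor \<open>4 ^ i\<close> overtakes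
  \<open>3 * L\<close> while \<open>2 ^ i\<close> is only of order \<open>sqrt L\<close>, so
  \<open>3 * ln M \<le> L ^ 2\<close> still holds at every squaring.\<close>

theorem no_fast_protocol: False
proof -
  obtain m0 where m0: "\<And>M. m0 \<le> M \<Longrightarrow> (\<Sum>i<M. p i) \<le> ln (real M) ^ 4"
    using crude_mass by (auto simp: eventually_sequentially)
  note eventually_initial_mass eventually_doubling
  moreover have "eventually (\<lambda>L::real. real m0 \<le> L) at_top" "eventually (\<lambda>L::real. 243 \<le> L) at_top"
    by (rule eventually_ge_at_top)+
  moreover have "eventually (\<lambda>L::real. exp (2 * L) + 1 \<le> exp (3 * L)) at_top"
    "eventually (\<lambda>L::real. 1 \<le> ln L) at_top"
    by real_asymp+
  ultimately have "eventually (\<lambda>L::real. False) at_top"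
  proof eventually_elim
    case (elim L)
    define M0 where "M0 = nat \<lceil>exp (2 * L)\<rceil>"
    have M0: "exp (2 * L) \<le> M0" "M0 \<le> exp (2 * L) + 1"
      using nat_ceiling_bounds[of "exp (2 * L)"] by (auto simp: M0_def)
    have M01: "1 \<le> real M0"
    proof -
      have "1 \<le> exp (2 * L)" using elim by simp
      then show ?thesis using M0 by linarith
    qed
    have lnM0: "0 \<le> ln (real M0)" "ln (real M0) \<le> 3 * L"
    proof -
      show "0 \<le> ln (real M0)" using M01 by simp
      have "ln (real M0) \<le> ln (exp (3 * L))" using M0 M01 elim by (intro ln_mono) auto
      then show "ln (real M0) \<le> 3 * L" by simp
    qed
    define M where "M j = M0 ^ (2 ^ j)" for j :: nat
    have lnM: "ln (real (M j)) = 2 ^ j * ln (real M0)" for j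
      using M01 by (simp add: M_def ln_realpow)
    have MM0: "M0 \<le> M j" for j
    proof -
      have "M0 ^ 1 \<le> M0 ^ (2 ^ j)" using M01 by (intro power_increasing) auto
      then show ?thesis by (simp add: M_def)
    qed
    have chain: "4096 ^ i * (240 * ln L) \<le> capped_mass L (M i)" if "\<And>k. k < i \<Longrightarrow> 9 * 2 ^ k \<le> L" for i
      using that
    proof (induction i)
      case 0
      show ?case using elim(1) by (simp add: M_def M0_def)
    next
      case (Suc i)
      have IH: "4096 ^ i * (240 * ln L) \<le> capped_mass L (M i)" using Suc by auto
      have "1 * (240 * ln L) \<le> 4096 ^ i * (240 * ln L)" using elim by (intro mult_right_mono) auto
      then have big: "240 * ln L \<le> capped_mass L (M i)" using IH by linarith
      have "real M0 \<le> M i" using MM0[of i] by simp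
      then have "exp (2 * L) \<le> M i" using M0 by linarith
      moreover have "3 * ln (real (M i)) \<le> L ^ 2"
      proof -
        have "3 * ln (real (M i)) \<le> 3 * (2 ^ i * (3 * L))"
          unfolding lnM using lnM0 by (intro mult_left_mono) auto
        also have "\<dots> = (9 * 2 ^ i) * L" by simp
        also have "\<dots> \<le> L * L" using Suc.prems[of i] elim by (intro mult_right_mono) auto
        finally show ?thesis by (simp add: power2_eq_square)
      qed
      ultimately have "4096 * capped_mass L (M i) \<le> capped_mass L (M i ^ 2)" using elim(2) big by blast
      moreover have "M i ^ 2 = M (Suc i)" by (simp add: M_def power_mult[symmetric] mult.commute)
      ultimately show ?case using IH by simp
    qed
    obtain j where "3 * L < (4::real) ^ j" using real_arch_pow[of 4 "3 * L"] by auto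
    then have ex: "\<exists>j. 3 * L < (4::real) ^ j" by blast
    define i where "i = (LEAST j. 3 * L < (4::real) ^ j)"
    have i: "3 * L < 4 ^ i" unfolding i_def using ex by (rule LeastI_ex)
    \<comment> \<open>Minimality of \<open>i\<close> gives
      \<open>(9 * 2 ^ k) ^ 2 = 81 * 4 ^ k \<le> 243 * L\<close>, the origin of the requirement
      \<open>243 \<le> L\<close>.\<close>
    have "9 * 2 ^ k \<le> L" if "k < i" for k
    proof -
      have "(4::real) ^ k \<le> 3 * L" using not_less_Least[of k "\<lambda>j. 3 * L < (4::real) ^ j"] that unfolding i_def by auto
      moreover have "(2 ^ k) ^ 2 = (4::real) ^ k" by (simp add: power2_eq_square power_mult_distrib[symmetric])
      ultimately have "(9 * 2 ^ k) ^ 2 \<le> 243 * L" by (simp add: power_mult_distrib)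
      also have "\<dots> \<le> L ^ 2" using elim by (simp add: power2_eq_square)
      finally show ?thesis using elim by (intro power2_le_imp_le[of "9 * 2 ^ k" L]) auto
    qed
    from chain[OF this] have "4096 ^ i * (240 * ln L) \<le> capped_mass L (M i)" .
    also have "\<dots> \<le> (\<Sum>i<M i. p i)" by (rule capped_mass_le)
    also have "\<dots> \<le> ln (real (M i)) ^ 4"
    proof (rule m0)
      have "L \<le> M0" using M0(1) exp_ge_add_one_self[of "2 * L"] elim by linarith
      then have "m0 \<le> M0" using elim by linarith
      then show "m0 \<le> M i" using MM0[of i] by linarith
    qed
    also have "\<dots> \<le> (2 ^ i * (3 * L)) ^ 4"
      unfolding lnM using lnM0 by (intro power_mono mult_left_mono) auto
    also have "\<dots> \<le> (2 ^ i * 4 ^ i) ^ 4"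
      using i elim by (intro power_mono mult_left_mono) auto
    also have "\<dots> = 4096 ^ i"
    proof -
      have "(2 ^ i * 4 ^ i :: real) ^ 4 = (8 ^ 4) ^ i"
        by (simp only: power_mult_distrib[symmetric] power_mult[symmetric] mult.commute) simp
      then show ?thesis by simp
    qed
    finally have "4096 ^ i * (240 * ln L) \<le> 4096 ^ i * 1" by simp
    then have "240 * ln L \<le> 1" by (subst (asm) mult_le_cancel_left_pos) auto
    then show False using elim by linarith
  qed
  then show False by simp
qed

end

section \<open>From latency bounds to survival probabilities\<close>

lemma survival_eq_prob:
  assumes D: "memoryless_protocol D"
  shows "{X \<in> space (bits D n). {u} \<notin> set (run (oblivious n wake) X k)} \<in> sets (bits D n)"
    and "survival (bit_prob D) n wake u k
      = measure (bits D n) {X \<in> space (bits D n). {u} \<notin> set (run (oblivious n wake) X k)}"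
proof -
  interpret memoryless_contention D n "oblivious n wake"
    using D by (rule oblivious_memoryless_contention)
  show "{X \<in> space (bits D n). {u} \<notin> set (run (oblivious n wake) X k)} \<in> sets (bits D n)"
    by (rule prob_run)
  show "survival (bit_prob D) n wake u k
      = measure (bits D n) {X \<in> space (bits D n). {u} \<notin> set (run (oblivious n wake) X k)}"
    unfolding survival_def by (rule prob_run(2)[symmetric])
qed

lemma latency_scale_nonneg: "27 \<le> n \<Longrightarrow> 0 \<le> latency_scale a n"
proof -
  assume n: "27 \<le> n"
  then have "1 \<le> ln (ln (real n))" by (intro lnln_ge_1) auto
  moreover have "0 \<le> ln (real n)" using n by simp
  ultimately show "0 \<le> latency_scale a n" unfolding latency_scale_def by (intro divide_nonneg_nonneg mult_nonneg_nonneg) auto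
qed

lemma ext_smalloD:
  assumes "ext_smallo f (latency_scale a)" "0 < c"
  shows "eventually (\<lambda>n. f n < top \<and> enn2real (f n) \<le> c * latency_scale a n) sequentially"
proof -
  have o: "(\<lambda>n. enn2real (f n)) \<in> o(latency_scale a)" using assms by (simp add: ext_smallo_def)
  have "eventually (\<lambda>n. f n < top) sequentially" using assms by (simp add: ext_smallo_def)
  moreover note landau_o.smallD[OF o assms(2)]
  moreover have "eventually (\<lambda>n. 27 \<le> n) sequentially" by (rule eventually_ge_at_top)
  ultimately show ?thesis
  proof eventually_elim
    case (elim n)
    then show ?case using latency_scale_nonneg[of n a] by simp
  qed
qed

text \<open>The least bound is attained, because \<open>enat\<close> is well-ordered and infinity
  always qualifies.\<close>

lemma latency_quantile_prob:
  assumes D: "memoryless_protocol D" and q: "0 \<le> q" and A: "A \<in> Adv" and u: "u < n"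
  shows "1 - q \<le> measure (bits D n) {X \<in> space (bits D n). latency A X u \<le> latency_quantile D Adv n q}"
proof -
  interpret prob_space "bits D n" by (rule prob_space_bits[OF D])
  define P where "P L \<longleftrightarrow> (\<forall>A\<in>Adv. \<forall>u<n. measure (bits D n) {X \<in> space (bits D n). latency A X u \<le> L} \<ge> 1 - q)" for L
  have "P \<infinity>" using q by (simp add: P_def prob_space)
  then have "P (LEAST L. P L)" by (rule LeastI)
  then show ?thesis using A u unfolding P_def latency_quantile_def by blast
qed

lemma whp_lower:
  assumes D: "memoryless_protocol D"
  shows "\<not> ext_smallo (\<lambda>n. ennreal_of_enat (latency_whp D (oblivious_adversaries n) n)) (latency_scale 2)"
proof
  assume small: "ext_smallo (\<lambda>n. ennreal_of_enat (latency_whp D (oblivious_adversaries n) n)) (latency_scale 2)"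
  interpret fast_protocol "bit_prob D" 2
  proof
    fix \<epsilon> :: real assume eps: "0 < \<epsilon>"
    have "eventually (\<lambda>n. 1 / real n ^ 2 < 1/4 * exp (- (ln (real n) ^ (2 - 1) / 2))) sequentially"
      by simp real_asymp
    then show "eventually (fast_at (bit_prob D) 2 \<epsilon>) sequentially"
      using ext_smalloD[OF small eps]
    proof eventually_elim
      case (elim n)
      interpret prob_space "bits D n" by (rule prob_space_bits[OF D])
      obtain m where m: "latency_whp D (oblivious_adversaries n) n = enat m"
        using elim(2) by (cases "latency_whp D (oblivious_adversaries n) n") auto
      then have mle: "real m \<le> \<epsilon> * latency_scale 2 n" using elim(2) by simp
      show ?case
        unfolding fast_at_def
      proof (intro allI impI)
        fix wake :: "nat \<Rightarrow> nat" and u k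
        assume u: "u < n" "wake u = 0" and k: "\<epsilon> * latency_scale 2 n < real k"
        let ?A = "oblivious n wake"
        let ?L = "{X \<in> space (bits D n). latency ?A X u \<le> enat m}"
        have A: "?A \<in> oblivious_adversaries n" by (simp add: oblivious_adversaries_eq)
        have "1 - 1 / real n ^ 2 \<le> prob ?L"
          using latency_quantile_prob[OF D _ A u(1), of "1 / real n ^ 2"] m by (simp add: latency_whp_def)
        moreover have meas: "?L \<in> events"
        proof -
          have "finite (?A h)" for h by (simp add: oblivious_def)
          then show ?thesis
            using latency_measurable[OF D, where A="?A" and u=u and n=n] by measurable
        qed
        moreover have "survival (bit_prob D) n wake u k \<le> prob (space (bits D n) - ?L)"
          unfolding survival_eq_prob(2)[OF D]
        proof (rule finite_measure_mono)
          show "{X \<in> space (bits D n). {u} \<notin> set (run ?A X k)} \<subseteq> space (bits D n) - ?L"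
          proof safe
            fix X assume "{u} \<notin> set (run ?A X k)" "latency ?A X u \<le> enat m"
            then have "enat k \<le> enat m"
              using oblivious_latency_ge[where wake=wake, OF u] by (meson order_trans)
            then show False using k mle by simp
          qed
        qed (use meas in auto)
        ultimately have "survival (bit_prob D) n wake u k \<le> 1 / real n ^ 2"
          using prob_compl[OF meas] by simp
        then show "survival (bit_prob D) n wake u k < 1/4 * exp (- (ln (real n) ^ (2 - 1) / 2))"
          using elim(1) by linarith
      qed
    qed
  qed (use bit_prob_bounds[OF D] in \<open>auto simp: bit_prob_def\<close>)
  show False by (rule no_fast_protocol)
qed

lemma exp_lower:
  assumes D: "memoryless_protocol D"
  shows "\<not> ext_smallo (\<lambda>n. latency_exp D (oblivious_adversaries n) n) (latency_scale 1)"
proof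
  assume small: "ext_smallo (\<lambda>n. latency_exp D (oblivious_adversaries n) n) (latency_scale 1)"
  interpret fast_protocol "bit_prob D" 1
  proof
    fix \<epsilon> :: real assume "0 < \<epsilon>"
    \<comment> \<open>With \<open>\<epsilon> / 16\<close>, Markov's inequality puts the survival
      probability below 1/16, and \<open>1/4 * exp (- 1/2)\<close> is at least 1/8.\<close>
    then have eps: "0 < \<epsilon> / 16" by simp
    show "eventually (fast_at (bit_prob D) 1 \<epsilon>) sequentially"
      using ext_smalloD[OF small eps] eventually_ge_at_top[of 27]
    proof eventually_elim
      case (elim n)
      interpret prob_space "bits D n" by (rule prob_space_bits[OF D])
      have le: "latency_exp D (oblivious_adversaries n) n \<le> ennreal (\<epsilon> / 16 * latency_scale 1 n)"
      proof -
        have "latency_exp D (oblivious_adversaries n) n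
            = ennreal (enn2real (latency_exp D (oblivious_adversaries n) n))"
          using elim(1) by simp
        also have "\<dots> \<le> ennreal (\<epsilon> / 16 * latency_scale 1 n)" using elim(1) by (intro ennreal_leI) simp
        finally show ?thesis .
      qed
      show ?case
        unfolding fast_at_def
      proof (intro allI impI)
        fix wake :: "nat \<Rightarrow> nat" and u k
        assume u: "u < n" "wake u = 0" and k: "\<epsilon> * latency_scale 1 n < real k"
        let ?A = "oblivious n wake"
        let ?E = "{X \<in> space (bits D n). {u} \<notin> set (run ?A X k)}"
        have A: "?A \<in> oblivious_adversaries n" by (simp add: oblivious_adversaries_eq)
        have E: "?E \<in> events" by (rule survival_eq_prob(1)[OF D])
        have s0: "0 \<le> \<epsilon> / 16 * latency_scale 1 n" using eps latency_scale_nonneg elim(2) by simp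
        have "ennreal (real k * prob ?E) = of_nat k * emeasure (bits D n) ?E"
          by (simp add: emeasure_eq_measure ennreal_mult ennreal_of_nat_eq_real_of_nat)
        also have "\<dots> = (\<integral>\<^sup>+ X. of_nat k * indicator ?E X \<partial>bits D n)"
          using E by (simp add: nn_integral_cmult_indicator)
        also have "\<dots> \<le> (\<integral>\<^sup>+ X. ennreal_of_enat (latency ?A X u) \<partial>bits D n)"
        proof (rule nn_integral_mono)
          fix X
          show "of_nat k * indicator ?E X \<le> ennreal_of_enat (latency ?A X u)"
          proof (cases "X \<in> ?E")
            case True
            then have "enat k \<le> latency ?A X u" using oblivious_latency_ge[where wake=wake, OF u] by auto
            then have "ennreal_of_enat (enat k) \<le> ennreal_of_enat (latency ?A X u)"
              by (simp only: ennreal_of_enat_le_iff)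
            then show ?thesis using True by simp
          qed simp
        qed
        also have "\<dots> \<le> latency_exp D (oblivious_adversaries n) n"
          unfolding latency_exp_def using u by (intro SUP_upper2[OF A] SUP_upper) auto
        also note le
        finally have "real k * prob ?E \<le> \<epsilon> / 16 * latency_scale 1 n" using s0 by (simp add: ennreal_le_iff)
        also have "\<dots> < real k * (1/16)" using k by simp
        finally have "prob ?E < 1/16" using s0 k by (simp add: mult_less_cancel_left)
        moreover have "1/2 \<le> exp (- 1/2 :: real)" using exp_ge_add_one_self[of "- 1/2::real"] by simp
        ultimately show "survival (bit_prob D) n wake u k < 1/4 * exp (- (ln (real n) ^ (1 - 1) / 2))"
          unfolding survival_eq_prob(2)[OF D] by simp
      qed
    qed
  qed (use bit_prob_bounds[OF D] in \<open>auto simp: bit_prob_def\<close>)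
  show False by (rule no_fast_protocol)
qed

theorem theorem1p4:
  "(\<exists>D. memoryless_protocol D \<and>
       ext_bigo (\<lambda>n. ennreal_of_enat (latency_whp D (adaptive_adversaries D n) n))
         (\<lambda>n. real n * ln (real n) ^ 2 / ln (ln (real n)))) \<and>
   (\<exists>D. memoryless_protocol D \<and>
       ext_bigo (\<lambda>n. latency_exp D (adaptive_adversaries D n) n)
         (\<lambda>n. real n * ln (real n) / ln (ln (real n)))) \<and>
   \<not> (\<exists>D. memoryless_protocol D \<and>
       ext_smallo (\<lambda>n. ennreal_of_enat (latency_whp D (oblivious_adversaries n) n))
         (\<lambda>n. real n * ln (real n) ^ 2 / ln (ln (real n)))) \<and>
   \<not> (\<exists>D. memoryless_protocol D \<and>
       ext_smallo (\<lambda>n. latency_exp D (oblivious_adversaries n) n)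
         (\<lambda>n. real n * ln (real n) / ln (ln (real n))))"
proof -
  have "latency_scale 2 = (\<lambda>n. real n * ln (real n) ^ 2 / ln (ln (real n)))"
    "latency_scale 1 = (\<lambda>n. real n * ln (real n) / ln (ln (real n)))"
    by (simp_all add: latency_scale_def fun_eq_iff)
  then show ?thesis using whp_upper exp_upper whp_lower exp_lower by simp
qed

end
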